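(* Let $d\ge 3$ be an integer. Then the Veronese embedding $\varphi_{\mathcal{O}_{\mathbb{P}^2}(d)}:\mathbb{P}^2\hookrightarrow\mathbb{P}^N$ satisfies property $N_p$ if and only if $0\le p\le 3d-3$. Moreover, for $d=2$, the Veronese embedding $\varphi_{\mathcal{O}_{\mathbb{P}^2}(2)}:\mathbb{P}^2\hookrightarrow\mathbb{P}^5$ satisfies property $N_p$ for all integers $p\ge 0$.
   Context: The base field $K$ is algebraically closed of characteristic zero. $\varphi_{\mathcal{O}_{\mathbb{P}^n}(d)}:\mathbb{P}^n\hookrightarrow\mathbb{P}^N$, $N+1=\binom{n+d}{n}$, is the embedding given by the complete linear system $|\mathcal{O}_{\mathbb{P}^n}(d)|$ (here $n=2$). Let $S=\bigoplus_{k\ge 0}S^k\big(H^0(\mathbb{P}^n,\mathcal{O}_{\mathbb{P}^n}(d))\big)$ be the homogeneous coordinate ring of $\mathbb{P}^N$ and let $R=\bigoplus_{k\ge0}H^0(\mathbb{P}^n,\mathcal{O}_{\mathbb{P}^n}(kd))$, a graded $S$-module. Let $$0\to\bigoplus_j S(-j)^{\widetilde b_{rj}}\to\cdots\to\bigoplus_j S(-j)^{\widetilde b_{0j}}\to R\to 0$$ be a minimal graded free resolution of $R$, with graded Betti numbers $\widetilde b_{ij}$. For an integer $p\ge0$, the embedding satisfies property $N_p$ if $\widetilde b_{00}=1$, $\widetilde b_{0j}=0$ for $j\ne0$, and $\widetilde b_{ij}=0$ for all $j\neq i+1$ whenever $1\le i\le p$. *)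

theory Defs
  imports
    "HOL-Library.Poly_Mapping"
    "HOL-Library.Function_Algebras"
    "HOL-Computational_Algebra.Polynomial"
begin

text \<open>
  Multivariate polynomials are finitely supported maps from exponent vectors to coefficients,
  with the convolution product of \<^theory>\<open>HOL-Library.Poly_Mapping\<close>. The set of variables of
  a polynomial ring may depend on a term, so the ring is a carrier set rather than a type.
\<close>

type_synonym ('v, 'k) mpoly = "('v \<Rightarrow>\<^sub>0 nat) \<Rightarrow>\<^sub>0 'k"

definition mdeg :: "('v \<Rightarrow>\<^sub>0 nat) \<Rightarrow> nat" where
  "mdeg m = (\<Sum>x\<in>Poly_Mapping.keys m. Poly_Mapping.lookup m x)"

definition polys :: "'v set \<Rightarrow> ('v, 'k::zero) mpoly set" where
  "polys V = {p. \<forall>m\<in>Poly_Mapping.keys p. Poly_Mapping.keys m \<subseteq> V}"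

text \<open>Degrees are integers, so that twists are available; a form of negative degree is \<open>0\<close>.\<close>

definition forms :: "'v set \<Rightarrow> int \<Rightarrow> ('v, 'k::zero) mpoly set" where
  "forms V t = {p \<in> polys V. \<forall>m\<in>Poly_Mapping.keys p. int (mdeg m) = t}"

definition irrelevant_ideal :: "'v set \<Rightarrow> ('v, 'k::zero) mpoly set" where
  "irrelevant_ideal V = {p \<in> polys V. Poly_Mapping.lookup p 0 = 0}"


text \<open>
  A \<open>\<int>\<close>-graded module is given by its graded pieces and the scalar action; the module itself is
  the (internal) sum of the pieces.
\<close>

record ('s, 'm) graded_module =
  piece :: "int \<Rightarrow> 'm set"
  act :: "'s \<Rightarrow> 'm \<Rightarrow> 'm"

definition total :: "('s, 'm::comm_monoid_add) graded_module \<Rightarrow> 'm set" where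
  "total M = {sum x T | x T. finite T \<and> (\<forall>t\<in>T. x t \<in> piece M t)}"

definition graded_hom ::
  "'s set \<Rightarrow> ('s, 'm::comm_monoid_add) graded_module \<Rightarrow> ('s, 'n::comm_monoid_add) graded_module
    \<Rightarrow> ('m \<Rightarrow> 'n) \<Rightarrow> bool" where
  "graded_hom S M N f \<longleftrightarrow>
     (\<forall>t. f ` piece M t \<subseteq> piece N t) \<and>
     (\<forall>x\<in>total M. \<forall>y\<in>total M. f (x + y) = f x + f y) \<and>
     (\<forall>s\<in>S. \<forall>x\<in>total M. f (act M s x) = act N s (f x))"

text \<open>
  \<open>free_module V b\<close> is \<open>\<Oplus>\<^sub>j S(-j)\<^bsup>b j\<^esup>\<close> over \<open>S = polys V\<close>: the coordinate of \<open>v\<close>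
  in the \<open>k\<close>-th copy (\<open>k < b j\<close>) of \<open>S(-j)\<close> is \<open>v (j, k)\<close>, and \<open>S(-j)\<^sub>t = S\<^bsub>t-j\<^esub>\<close>. It is
  meant for \<open>b\<close> of finite support.
\<close>

type_synonym ('v, 'k) vec = "int \<times> nat \<Rightarrow> ('v, 'k) mpoly"

definition free_module ::
  "'v set \<Rightarrow> (int \<Rightarrow> nat) \<Rightarrow> (('v, 'k::comm_ring_1) mpoly, ('v, 'k) vec) graded_module" where
  "free_module V b = \<lparr>
     piece = (\<lambda>t. {v. (\<forall>j k. k < b j \<longrightarrow> v (j, k) \<in> forms V (t - j)) \<and>
                      (\<forall>j k. b j \<le> k \<longrightarrow> v (j, k) = 0)}),
     act = (\<lambda>s v i. s * v i) \<rparr>"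

text \<open>
  A finite minimal graded free resolution
  \<open>0 \<rightarrow> F\<^sub>r \<rightarrow> \<dots> \<rightarrow> F\<^sub>1 \<rightarrow> F\<^sub>0 \<rightarrow> M \<rightarrow> 0\<close> with \<open>F\<^sub>i = \<Oplus>\<^sub>j S(-j)\<^bsup>b i j\<^esup>\<close>, differentials
  \<open>\<delta> i : F\<^bsub>i+1\<^esub> \<rightarrow> F\<^sub>i\<close> and augmentation \<open>\<epsilon> : F\<^sub>0 \<rightarrow> M\<close>. Finiteness of the support of \<open>b\<close> says
  that every \<open>F\<^sub>i\<close> is finitely generated and that almost all of them vanish. Minimality is
  \<open>\<delta> i (F\<^bsub>i+1\<^esub>) \<subseteq> \<mm> F\<^sub>i\<close> for the irrelevant ideal \<open>\<mm>\<close> of \<open>S\<close>.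
\<close>

definition minimal_graded_free_resolution ::
  "'v set \<Rightarrow> (('v, 'k::comm_ring_1) mpoly, 'm::comm_monoid_add) graded_module
    \<Rightarrow> (nat \<Rightarrow> int \<Rightarrow> nat) \<Rightarrow> (nat \<Rightarrow> ('v, 'k) vec \<Rightarrow> ('v, 'k) vec)
    \<Rightarrow> (('v, 'k) vec \<Rightarrow> 'm) \<Rightarrow> bool" where
  "minimal_graded_free_resolution V M b \<delta> \<epsilon> \<longleftrightarrow>
     finite {(i, j). b i j \<noteq> 0} \<and>
     graded_hom (polys V) (free_module V (b 0)) M \<epsilon> \<and>
     (\<forall>i. graded_hom (polys V) (free_module V (b (Suc i))) (free_module V (b i)) (\<delta> i)) \<and>
     \<epsilon> ` total (free_module V (b 0)) = total M \<and>
     \<delta> 0 ` total (free_module V (b 1)) = {v \<in> total (free_module V (b 0)). \<epsilon> v = 0} \<and>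
     (\<forall>i. \<delta> (Suc i) ` total (free_module V (b (Suc (Suc i))))
            = {v \<in> total (free_module V (b (Suc i))). \<delta> i v = 0}) \<and>
     (\<forall>i. \<forall>v\<in>total (free_module V (b (Suc i))). \<forall>l. \<delta> i v l \<in> irrelevant_ideal V)"

text \<open>The table \<open>b\<close> is unique if it exists, minimal resolutions being unique up to isomorphism.\<close>

definition is_graded_betti_table ::
  "'v set \<Rightarrow> (('v, 'k::comm_ring_1) mpoly, 'm::comm_monoid_add) graded_module
    \<Rightarrow> (nat \<Rightarrow> int \<Rightarrow> nat) \<Rightarrow> bool" where
  "is_graded_betti_table V M b \<longleftrightarrow> (\<exists>\<delta> \<epsilon>. minimal_graded_free_resolution V M b \<delta> \<epsilon>)"


text \<open>
  The Veronese embedding of \<open>\<P>\<^sup>n\<close> by \<open>|\<O>(d)|\<close>. Here \<open>H\<^sup>0(\<P>\<^sup>n, \<O>(m))\<close> is the space of forms of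
  degree \<open>m\<close> in \<open>x\<^sub>0, \<dots>, x\<^sub>n\<close>. Its monomial basis identifies \<open>\<Oplus>\<^sub>k S\<^sup>k(H\<^sup>0(\<P>\<^sup>n, \<O>(d)))\<close> with the
  polynomial ring \<open>S = polys (veronese_vars n d)\<close> that has one variable \<open>z\<^sub>m\<close> for each monomial
  \<open>x\<^sup>m\<close> of degree \<open>d\<close>, and \<open>veronese_map\<close> is the multiplication map \<open>S \<rightarrow> R\<close>,
  \<open>z\<^sub>m \<mapsto> x\<^sup>m\<close>, through which \<open>S\<close> acts on \<open>R\<close>.
\<close>

definition veronese_vars :: "nat \<Rightarrow> nat \<Rightarrow> (nat \<Rightarrow>\<^sub>0 nat) set" where
  "veronese_vars n d = {m. Poly_Mapping.keys m \<subseteq> {0..n} \<and> mdeg m = d}"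

definition veronese_map ::
  "(nat \<Rightarrow>\<^sub>0 nat, 'k::comm_ring_1) mpoly \<Rightarrow> (nat, 'k) mpoly" where
  "veronese_map s =
     (\<Sum>u\<in>Poly_Mapping.keys s. Poly_Mapping.single 0 (Poly_Mapping.lookup s u) *
        (\<Prod>m\<in>Poly_Mapping.keys u. Poly_Mapping.single m 1 ^ Poly_Mapping.lookup u m))"

definition veronese_module ::
  "nat \<Rightarrow> nat \<Rightarrow> ((nat \<Rightarrow>\<^sub>0 nat, 'k::comm_ring_1) mpoly, (nat, 'k) mpoly) graded_module" where
  "veronese_module n d = \<lparr>
     piece = (\<lambda>k. forms {0..n} (k * int d)),
     act = (\<lambda>s r. veronese_map s * r) \<rparr>"

text \<open>Property \<open>N\<^sub>p\<close>; the type argument carries the base field.\<close>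

definition veronese_satisfies_N ::
  "'k::field itself \<Rightarrow> nat \<Rightarrow> nat \<Rightarrow> nat \<Rightarrow> bool" where
  "veronese_satisfies_N K n d p \<longleftrightarrow>
     (\<exists>b. is_graded_betti_table (veronese_vars n d)
            (veronese_module n d :: (_, (nat, 'k) mpoly) graded_module) b \<and>
          b 0 0 = 1 \<and> (\<forall>j. j \<noteq> 0 \<longrightarrow> b 0 j = 0) \<and>
          (\<forall>i j. 1 \<le> i \<and> i \<le> p \<and> j \<noteq> int i + 1 \<longrightarrow> b i j = 0))"

end

theory Submission
  imports Defs
begin

text \<open>
  If \<open>0 \<rightarrow> Z \<rightarrow> F \<rightarrow> M \<rightarrow> 0\<close> is exact with \<open>F\<close> free, the Koszul homology of \<open>M\<close> at \<open>\<Lambda>\<^sup>n\<^sup>+\<^sup>1\<close> is that of \<open>Z\<close>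
  at \<open>\<Lambda>\<^sup>n\<close>. Going down a resolution, the Betti number \<open>b\<^sub>i\<^sub>j\<close> vanishes iff the Koszul complex of \<open>R\<close> is
  exact at \<open>\<Lambda>\<^sup>i V \<otimes> R\<^sub>j\<^sub>-\<^sub>i\<close>, and this exactness also bounds the degrees of minimal generators of the
  syzygy modules, so no Noetherian argument is needed to construct the resolution.

  The three pure powers \<open>x\<^sub>i\<^sup>d\<close> form a regular sequence on \<open>R\<close>, and the quotient lives in degrees
  \<open>0, 1, 2\<close>. For \<open>d = 2\<close> degree \<open>2\<close> vanishes as well. For \<open>d \<ge> 3\<close> the only question is the
  surjectivity of \<open>\<Lambda>\<^sup>n\<^sup>+\<^sup>1 V' \<otimes> R'\<^sub>1 \<rightarrow> \<Lambda>\<^sup>n V' \<otimes> R'\<^sub>2\<close>. By linear duality the cokernel is dual to the cycles in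
  \<open>\<Lambda>\<^sup>q V' \<otimes> W\<close>, \<open>q = card V' - n\<close>, where \<open>W\<close> is the space of forms of degree \<open>d - 3\<close> in the canonical
  module, and these lift to cycles over all variables. Green's argument kills them when \<open>q \<ge> dim W\<close>:
  contracting a cycle with the evaluations at \<open>q\<close> general points gives an element of \<open>W\<close> that vanishes
  at these points. Since \<open>card V' = dim W + 3d - 3\<close>, this is the range \<open>n \<le> 3d - 3\<close>. For \<open>n = 3d - 2\<close>
  the Koszul-type cycle built from the products \<open>x\<^sub>0 x\<^sub>1 x\<^sub>2 \<cdot> w\<close>, with \<open>w\<close> in the monomial basis of \<open>W\<close>, is
  nonzero.
\<close>


section \<open>Koszul homology with coefficients in a graded module\<close>

text \<open>The bound counts lattice points. \<open>V'\<close> consists of the points of the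
  triangle of degree \<open>d\<close> monomials other than its vertices. Those divisible by
  \<open>x0 x1 x2\<close> correspond to a basis of \<open>W\<close>; the others are the interior
  points of the three edges, \<open>3 * (d - 1)\<close> in number.

  Two settings have to be combined. Duality is elementary only modulo the \<open>x_i^d\<close>,
  where a monomial is paired with its complement in the socle monomial of degree
  \<open>3 * d - 3\<close>; degree \<open>2 * d\<close> is thus dual to degree \<open>d - 3\<close>.
  Green's argument evaluates at points, which makes no sense modulo \<open>x_i^d\<close>, so it has
  to run over all variables. For this reason the removal of a regular variable is an equivalence,
  applied in both directions.

  \<open>N_p\<close> asks for some Betti table, so its two implications need different inputs: for
  one, a resolution with prescribed \<open>b 0\<close> is constructed; for the other, exactness is
  read off an arbitrary resolution, whose maps are controlled only on sums of homogeneous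
  elements.\<close>

text \<open>
  A chain \<open>c\<close> stands for \<open>\<Sum>\<^sub>A e\<^sub>A \<otimes> c A\<close>, the sum over the subsets \<open>A\<close> of \<open>V\<close> with \<open>n\<close> elements, and
  \<open>kexact V a P I n t\<close> is exactness of the Koszul complex of \<open>P / I\<close> at \<open>\<Lambda>\<^sup>n \<otimes> (P / I)\<^sub>t\<close>. The index \<open>t\<close> is the
  degree of the coefficients, so the total degree is \<open>n + t\<close>.
\<close>

definition ksign :: "'v::linorder \<Rightarrow> 'v set \<Rightarrow> 'm::ab_group_add \<Rightarrow> 'm" where
  "ksign v C x = (if even (card {u\<in>C. u < v}) then x else - x)"

definition kdiff :: "'v::linorder set \<Rightarrow> ('v \<Rightarrow> 'm \<Rightarrow> 'm) \<Rightarrow> ('v set \<Rightarrow> 'm) \<Rightarrow> 'v set \<Rightarrow> 'm::ab_group_add" where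
  "kdiff V a c C = (\<Sum>v\<in>V - C. ksign v C (a v (c (insert v C))))"

definition chains :: "'v set \<Rightarrow> 'm set \<Rightarrow> nat \<Rightarrow> ('v set \<Rightarrow> 'm::zero) set" where
  "chains V M n = {c. \<forall>A. if A \<subseteq> V \<and> card A = n then c A \<in> M else c A = 0}"

definition kexact :: "'v::linorder set \<Rightarrow> ('v \<Rightarrow> 'm \<Rightarrow> 'm) \<Rightarrow> (int \<Rightarrow> 'm::ab_group_add set) \<Rightarrow> (int \<Rightarrow> 'm set)
    \<Rightarrow> nat \<Rightarrow> int \<Rightarrow> bool" where
  "kexact V a P I n t \<longleftrightarrow>
     (\<forall>c\<in>chains V (P t) n. (\<forall>C. kdiff V a c C \<in> I (t + 1)) \<longrightarrow>
        (\<exists>b\<in>chains V (P (t - 1)) (Suc n). \<forall>C. c C - kdiff V a b C \<in> I t))"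

text \<open>Koszul exactness sees only addition and the variables; closure under constants enters
  later as \<open>const_mem\<close>.\<close>

definition graded_sub :: "'v set \<Rightarrow> ('v \<Rightarrow> 'm \<Rightarrow> 'm) \<Rightarrow> (int \<Rightarrow> 'm::ab_group_add set) \<Rightarrow> bool" where
  "graded_sub V a P \<longleftrightarrow> (\<forall>t. 0 \<in> P t \<and> (\<forall>x\<in>P t. \<forall>y\<in>P t. x - y \<in> P t) \<and>
     (\<forall>v\<in>V. \<forall>x\<in>P t. a v x \<in> P (t + 1)))"

lemma graded_subD:
  assumes "graded_sub V a P"
  shows "0 \<in> P t" "x \<in> P t \<Longrightarrow> y \<in> P t \<Longrightarrow> x - y \<in> P t" "x \<in> P t \<Longrightarrow> - x \<in> P t"
    "x \<in> P t \<Longrightarrow> y \<in> P t \<Longrightarrow> x + y \<in> P t" "v \<in> V \<Longrightarrow> x \<in> P t \<Longrightarrow> a v x \<in> P (t + 1)"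
proof -
  show z: "0 \<in> P t" and s: "\<And>x y. x \<in> P t \<Longrightarrow> y \<in> P t \<Longrightarrow> x - y \<in> P t"
    and "v \<in> V \<Longrightarrow> x \<in> P t \<Longrightarrow> a v x \<in> P (t + 1)"
    using assms unfolding graded_sub_def by blast+
  show n: "\<And>x. x \<in> P t \<Longrightarrow> - x \<in> P t" using s[OF z] by simp
  show "x \<in> P t \<Longrightarrow> y \<in> P t \<Longrightarrow> x + y \<in> P t" using s[of x "- y"] n[of y] by simp
qed

lemma graded_sub_sum:
  assumes "graded_sub V a P" "\<And>i. i \<in> S \<Longrightarrow> f i \<in> P t"
  shows "sum f S \<in> P t"
  using assms(2) by (induction S rule: infinite_finite_induct) (auto intro: graded_subD[OF assms(1)])

lemma graded_sub_mono: "graded_sub V a P \<Longrightarrow> U \<subseteq> V \<Longrightarrow> graded_sub U a P"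
  unfolding graded_sub_def by blast

section \<open>Signs and chains\<close>

lemma ksign_0 [simp]: "ksign v C 0 = 0" by (simp add: ksign_def)
lemma ksign_add: "ksign v C (x + y) = ksign v C x + ksign v C y" by (simp add: ksign_def)
lemma ksign_minus: "ksign v C (- x) = - ksign v C x" by (simp add: ksign_def)
lemma ksign_diff: "ksign v C (x - y) = ksign v C x - ksign v C y" by (simp add: ksign_def)
lemma ksign_sg [simp]: "ksign v C (ksign v C x) = x" by (simp add: ksign_def)
lemma ksign_commute: "ksign v C (ksign u D x) = ksign u D (ksign v C x)" by (simp add: ksign_def)
lemma ksign_mem: "graded_sub V a P \<Longrightarrow> x \<in> P t \<Longrightarrow> ksign v C x \<in> P t"
  by (simp add: ksign_def graded_subD)
lemma ksign_sum: "ksign v C (sum f S) = (\<Sum>i\<in>S. ksign v C (f i))"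
  by (simp add: ksign_def sum_negf)
lemma ksign_eq_0_iff [simp]: "ksign v C x = 0 \<longleftrightarrow> x = 0" by (simp add: ksign_def)

lemma ksign_insert:
  assumes "finite C" "u \<notin> C"
  shows "ksign v (insert u C) x = (if u < v then - ksign v C x else ksign v C x)"
proof (cases "u < v")
  case True
  then have "{w \<in> insert u C. w < v} = insert u {w \<in> C. w < v}" by auto
  then show ?thesis using assms True by (simp add: ksign_def)
next
  case False
  then have "{w \<in> insert u C. w < v} = {w \<in> C. w < v}" by auto
  then show ?thesis using False by (simp add: ksign_def)
qed

lemma chainsI:
  assumes "\<And>A. A \<subseteq> V \<Longrightarrow> card A = n \<Longrightarrow> c A \<in> M" "\<And>A. \<not> (A \<subseteq> V \<and> card A = n) \<Longrightarrow> c A = 0"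
  shows "c \<in> chains V M n"
  using assms by (auto simp: chains_def)

lemma chainsD:
  assumes "c \<in> chains V M n"
  shows "A \<subseteq> V \<Longrightarrow> card A = n \<Longrightarrow> c A \<in> M" "\<not> (A \<subseteq> V \<and> card A = n) \<Longrightarrow> c A = 0"
  using assms unfolding chains_def mem_Collect_eq by metis+

lemma chains_mem: "c \<in> chains V M n \<Longrightarrow> 0 \<in> M \<Longrightarrow> c A \<in> M"
  using chainsD[of c V M n] by metis

lemma chains_mono: "c \<in> chains V M n \<Longrightarrow> M \<subseteq> N \<Longrightarrow> c \<in> chains V N n"
  using chainsI[of V n c N] chainsD[of c V M n] by blast

lemma chains_change:
  assumes "c \<in> chains V M n" "\<And>A. A \<subseteq> V \<Longrightarrow> card A = n \<Longrightarrow> c A \<in> N"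
  shows "c \<in> chains V N n"
  using chainsI[of V n c N] chainsD[OF assms(1)] assms(2) by blast

lemma chains_diff:
  assumes "graded_sub V a P" "b \<in> chains V (P t) n" "c \<in> chains V (P t) n"
  shows "(\<lambda>A. b A - c A) \<in> chains V (P t) n"
proof (rule chainsI)
  show "b A - c A \<in> P t" if "A \<subseteq> V" "card A = n" for A
    using graded_subD(2)[OF assms(1)] chainsD(1)[OF assms(2) that] chainsD(1)[OF assms(3) that] by blast
  show "b A - c A = 0" if "\<not> (A \<subseteq> V \<and> card A = n)" for A
    using chainsD(2)[OF assms(2) that] chainsD(2)[OF assms(3) that] by simp
qed

section \<open>The Koszul differential of a family of commuting operators\<close>

locale commuting_action =
  fixes a :: "'v::linorder \<Rightarrow> 'm::ab_group_add \<Rightarrow> 'm"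
  assumes a_add: "a v (x + y) = a v x + a v y"
    and a_comm: "a u (a v x) = a v (a u x)"
begin

lemma a_0 [simp]: "a v 0 = 0"
  using a_add[of v 0 0] by simp

lemma a_minus: "a v (- x) = - a v x"
  by (rule minus_unique[symmetric]) (simp flip: a_add)

lemma a_diff: "a v (x - y) = a v x - a v y"
  using a_add[of v x "- y"] by (simp add: a_minus)

lemma a_sum: "a v (sum f S) = (\<Sum>i\<in>S. a v (f i))"
  by (induction S rule: infinite_finite_induct) (auto simp: a_add)

lemma a_sg: "a u (ksign v C x) = ksign v C (a u x)"
  by (simp add: ksign_def a_minus)

lemma kdiff_diff: "kdiff V a (\<lambda>A. b A - c A) C = kdiff V a b C - kdiff V a c C"
  by (simp add: kdiff_def a_diff ksign_diff sum_subtractf)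

lemma kdiff_add: "kdiff V a (\<lambda>A. b A + c A) C = kdiff V a b C + kdiff V a c C"
  by (simp add: kdiff_def a_add ksign_add sum.distrib)

lemma kdiff_0 [simp]: "kdiff V a (\<lambda>_. 0) C = 0"
  by (simp add: kdiff_def)

lemma kdiff_outside:
  assumes "finite V" "c \<in> chains V M (Suc n)" "\<not> (C \<subseteq> V \<and> card C = n)"
  shows "kdiff V a c C = 0"
  unfolding kdiff_def
proof (rule sum.neutral, intro ballI)
  fix v assume v: "v \<in> V - C"
  have "\<not> (insert v C \<subseteq> V \<and> card (insert v C) = Suc n)"
  proof
    assume *: "insert v C \<subseteq> V \<and> card (insert v C) = Suc n"
    then have "finite C" using finite_subset[OF _ assms(1)] by simp
    then show False using * v assms(3) by auto
  qed
  then show "ksign v C (a v (c (insert v C))) = 0" using chainsD(2)[OF assms(2)] by simp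
qed

lemma kdiff_0_chain:
  assumes "finite V" "c \<in> chains V M 0"
  shows "kdiff V a c C = 0"
  unfolding kdiff_def
proof (rule sum.neutral, intro ballI)
  fix v assume v: "v \<in> V - C"
  have "\<not> (insert v C \<subseteq> V \<and> card (insert v C) = 0)"
    using finite_subset[OF _ assms(1), of "insert v C"] by (metis card_eq_0_iff insert_not_empty)
  then show "ksign v C (a v (c (insert v C))) = 0" using chainsD(2)[OF assms(2)] by simp
qed

lemma kdiff_mem:
  assumes "graded_sub V a P" "\<And>A. A \<subseteq> V \<Longrightarrow> c A \<in> P t" "\<And>A. \<not> A \<subseteq> V \<Longrightarrow> c A = 0"
  shows "kdiff V a c C \<in> P (t + 1)"
  unfolding kdiff_def
proof (rule graded_sub_sum[OF assms(1)])
  fix v assume v: "v \<in> V - C"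
  have "c (insert v C) \<in> P t"
    using assms(2,3)[of "insert v C"] graded_subD(1)[OF assms(1), of t] by metis
  then show "ksign v C (a v (c (insert v C))) \<in> P (t + 1)"
    using v by (intro ksign_mem[OF assms(1)] graded_subD(5)[OF assms(1)]) auto
qed

lemma kdiff_chains:
  assumes "finite V" "graded_sub V a P" "c \<in> chains V (P t) (Suc n)"
  shows "kdiff V a c \<in> chains V (P (t + 1)) n"
proof (rule chainsI)
  fix C
  show "kdiff V a c C \<in> P (t + 1)"
    by (rule kdiff_mem[OF assms(2)])
      (use chains_mem[OF assms(3) graded_subD(1)[OF assms(2), of t]] chainsD(2)[OF assms(3)] in blast)+
next
  fix C assume "\<not> (C \<subseteq> V \<and> card C = n)"
  then show "kdiff V a c C = 0" using kdiff_outside[OF assms(1,3)] by blast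
qed

end

text \<open>Two actions are allowed so that the same expansion yields both \<open>d d = 0\<close>
  and the anticommutation of the differential with the contractions in Green's argument. Removing
  \<open>u\<close> and \<open>v\<close> in the two possible orders gives opposite signs.\<close>

lemma kdiff_kd:
  assumes "finite V" "C \<subseteq> V" "commuting_action a" "commuting_action b"
  shows "kdiff V a (kdiff V b c) C = (\<Sum>v\<in>V - C. \<Sum>u\<in>V - C.
     if v = u then 0 else if v < u then - ksign v C (ksign u C (a v (b u (c (insert u (insert v C))))))
     else ksign v C (ksign u C (a v (b u (c (insert u (insert v C)))))))"
proof -
  interpret a: commuting_action a by fact
  interpret b: commuting_action b by fact
  have fin: "finite C" using assms(1,2) finite_subset by blast
  have "ksign v C (a v (kdiff V b c (insert v C))) = (\<Sum>u\<in>V - C.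
     if v = u then 0 else if v < u then - ksign v C (ksign u C (a v (b u (c (insert u (insert v C))))))
     else ksign v C (ksign u C (a v (b u (c (insert u (insert v C)))))))" (is "_ = sum ?f _") if v: "v \<in> V - C" for v
  proof -
    have "sum ?f (V - C) = sum ?f (V - insert v C)"
      by (rule sum.mono_neutral_right) (use assms(1) in auto)
    also have "\<dots> = (\<Sum>u\<in>V - insert v C. ksign v C (a v (ksign u (insert v C) (b u (c (insert u (insert v C)))))))"
      by (rule sum.cong) (use v in \<open>auto simp: ksign_insert[OF fin] a.a_sg a.a_minus ksign_minus\<close>)
    finally show ?thesis by (simp add: kdiff_def a.a_sum ksign_sum)
  qed
  then show ?thesis unfolding kdiff_def[of V a] by (rule sum.cong[OF refl])
qed

lemma kdiff_anticommute:
  assumes "finite V" "C \<subseteq> V" "commuting_action a" "commuting_action b"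
    "\<And>u v x. a u (b v x) = b v (a u x)"
  shows "kdiff V a (kdiff V b c) C = - kdiff V b (kdiff V a c) C"
proof -
  define f where "f v u = (if v = u then 0 else if v < u then - ksign v C (ksign u C (a v (b u (c (insert u (insert v C))))))
     else ksign v C (ksign u C (a v (b u (c (insert u (insert v C)))))))" for v u
  define g where "g v u = (if v = u then 0 else if v < u then - ksign v C (ksign u C (b v (a u (c (insert u (insert v C))))))
     else ksign v C (ksign u C (b v (a u (c (insert u (insert v C)))))))" for v u
  have fg: "f v u = - g u v" for u v
    by (auto simp: f_def g_def assms(5) insert_commute ksign_commute[of v])
  have "kdiff V a (kdiff V b c) C = (\<Sum>v\<in>V - C. \<Sum>u\<in>V - C. f v u)"
    unfolding f_def by (rule kdiff_kd) fact+
  also have "\<dots> = (\<Sum>u\<in>V - C. \<Sum>v\<in>V - C. f v u)" by (rule sum.swap)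
  also have "\<dots> = - (\<Sum>u\<in>V - C. \<Sum>v\<in>V - C. g u v)" by (simp add: fg sum_negf)
  also have "(\<Sum>u\<in>V - C. \<Sum>v\<in>V - C. g u v) = kdiff V b (kdiff V a c) C"
    unfolding g_def by (rule kdiff_kd[symmetric]) fact+
  finally show ?thesis .
qed

context commuting_action
begin

text \<open>\<open>kdiff_anticommute\<close> with equal actions would only give that twice the value
  is 0, too little in an arbitrary abelian group. The terms with \<open>v < u\<close> and
  \<open>u < v\<close> are cancelled in pairs instead.\<close>

lemma kdiff_kd_0:
  assumes "finite V" "C \<subseteq> V"
  shows "kdiff V a (kdiff V a c) C = 0"
proof -
  define f where "f = (\<lambda>(v, u). if v = u then 0 else if v < u then - ksign v C (ksign u C (a v (a u (c (insert u (insert v C))))))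
     else ksign v C (ksign u C (a v (a u (c (insert u (insert v C)))))))"
  let ?X = "(V - C) \<times> (V - C)"
  let ?L = "{p \<in> ?X. fst p < snd p}" and ?G = "{p \<in> ?X. snd p < fst p}"
  have fin: "finite ?X" using assms(1) by simp
  have "kdiff V a (kdiff V a c) C = (\<Sum>v\<in>V - C. \<Sum>u\<in>V - C. f (v, u))"
    unfolding f_def split_conv
    by (rule kdiff_kd) (use assms commuting_action_axioms in auto)
  also have "\<dots> = sum f ?X" by (simp add: sum.cartesian_product)
  also have "\<dots> = sum f (?L \<union> ?G)"
    by (rule sum.mono_neutral_right) (use fin in \<open>auto simp: f_def not_less split: if_splits\<close>)
  also have "\<dots> = sum f ?L + sum f ?G"
    by (rule sum.union_disjoint) (use fin in auto)
  also have "sum f ?G = sum (\<lambda>p. - f p) ?L"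
  proof (rule sum.reindex_bij_witness[of _ prod.swap prod.swap])
    fix p assume "p \<in> ?G"
    then obtain v u where p: "p = (v, u)" "u < v" "\<not> v < u" by (cases p) (auto simp: less_not_sym)
    then show "- f (prod.swap p) = f p"
      by (simp add: f_def insert_commute[of u v] a_comm[of u v] ksign_commute[of u C v])
  qed auto
  finally show ?thesis by (simp add: sum_negf)
qed


text \<open>\<open>c\<close> encodes \<open>x + e_z \<and> y\<close>. The factor
  \<open>ksign z A\<close> moves \<open>e_z\<close> from its sorted position to the front, so the
  formulas hold wherever \<open>z\<close> stands in the order.\<close>

lemma kdiff_glue:
  assumes "finite V" "z \<notin> V" "C \<subseteq> V"
    "\<And>A. A \<subseteq> V \<Longrightarrow> c A = x A" "\<And>A. A \<subseteq> V \<Longrightarrow> c (insert z A) = ksign z A (y A)"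
  shows "kdiff (insert z V) a c C = kdiff V a x C + a z (y C)"
    and "kdiff (insert z V) a c (insert z C) = - ksign z C (kdiff V a y C)"
proof -
  have fC: "finite C" using assms finite_subset by blast
  have zC: "z \<notin> C" using assms by blast
  have *: "insert z V - C = insert z (V - C)" using zC by blast
  have eq: "ksign v C (a v (c (insert v C))) = ksign v C (a v (x (insert v C)))" if "v \<in> V - C" for v
    using that assms(3,4) by auto
  have "kdiff (insert z V) a c C = ksign z C (a z (c (insert z C))) + (\<Sum>v\<in>V - C. ksign v C (a v (c (insert v C))))"
    unfolding kdiff_def * using assms by (subst sum.insert) auto
  also have "ksign z C (a z (c (insert z C))) = a z (y C)" using assms(3,5) by (simp add: a_sg)
  also have "(\<Sum>v\<in>V - C. ksign v C (a v (c (insert v C)))) = kdiff V a x C"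
    unfolding kdiff_def by (rule sum.cong[OF refl eq])
  finally show "kdiff (insert z V) a c C = kdiff V a x C + a z (y C)" by (simp add: add.commute)
  have **: "insert z V - insert z C = V - C" using assms by blast
  have "ksign v (insert z C) (a v (c (insert v (insert z C)))) = - ksign z C (ksign v C (a v (y (insert v C))))"
    if v: "v \<in> V - C" for v
  proof -
    have vz: "v \<noteq> z" using v assms by blast
    have "c (insert v (insert z C)) = ksign z (insert v C) (y (insert v C))"
      using assms(5)[of "insert v C"] v assms(3) by (auto simp: insert_commute)
    then show ?thesis
      using vz v by (auto simp: ksign_insert[OF fC zC] ksign_insert[OF fC, of v] a_sg a_minus ksign_minus ksign_commute[of v] not_less
          dest: less_not_sym)
  qed
  then show "kdiff (insert z V) a c (insert z C) = - ksign z C (kdiff V a y C)"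
    unfolding kdiff_def ** by (simp add: sum_negf ksign_sum)
qed

text \<open>
  Chains over \<open>insert z V\<close> are pairs \<open>x + e\<^sub>z \<and> y\<close> of chains over \<open>V\<close>, with differential
  \<open>(\<partial>x + z y) - e\<^sub>z \<and> \<partial>y\<close>; if \<open>z\<close> is regular modulo \<open>I\<close>, the component \<open>y\<close> is determined by \<open>x\<close> modulo \<open>I\<close>.
\<close>

lemma koszul_regular:
  assumes fin: "finite V" and zV: "z \<notin> V"
    and P: "graded_sub (insert z V) a P" and I: "graded_sub (insert z V) a I"
    and reg: "\<And>t x. x \<in> P t \<Longrightarrow> a z x \<in> I (t + 1) \<Longrightarrow> x \<in> I t"
    and J: "\<And>t. J t = {x + a z y | x y. x \<in> I t \<and> y \<in> P (t - 1)}"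
  shows "kexact (insert z V) a P I n t \<longleftrightarrow> kexact V a P J n t"
proof
  let ?W = "insert z V"
  note Pd = graded_subD[OF P] and Id = graded_subD[OF I]
  have PV: "graded_sub V a P" and IV: "graded_sub V a I"
    using P I graded_sub_mono by blast+
  have fW: "finite ?W" using fin by simp
  {
    assume L: "kexact V a P J n t"
    show "kexact ?W a P I n t"
      unfolding kexact_def
    proof (intro ballI impI)
      fix c assume c: "c \<in> chains ?W (P t) n" and cI: "\<forall>C. kdiff ?W a c C \<in> I (t + 1)"
      define x where "x A = (if A \<subseteq> V then c A else 0)" for A
      define y where "y A = (if A \<subseteq> V then ksign z A (c (insert z A)) else 0)" for A
      have xP: "x \<in> chains V (P t) n"
        by (rule chainsI) (use chainsD[OF c] in \<open>auto simp: x_def\<close>)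
      have yP: "y A \<in> P t" for A
        using chains_mem[OF c Pd(1)] by (auto simp: y_def Pd(1) ksign_mem[OF P])
      have k1: "kdiff ?W a c C = kdiff V a x C + a z (y C)" if "C \<subseteq> V" for C
        by (rule kdiff_glue[OF fin zV that]; simp add: x_def y_def)
      have "kdiff V a x C \<in> J (t + 1)" for C
      proof (cases "C \<subseteq> V")
        case True
        have "kdiff V a x C = kdiff ?W a c C + a z (- y C)" using k1[OF True] by (simp add: a_minus)
        then show ?thesis unfolding J using cI Pd(3)[OF yP[of C]] by auto
      next
        case False
        then have "kdiff V a x C = 0 + a z 0" unfolding kdiff_def x_def by (auto intro!: sum.neutral)
        then show ?thesis unfolding J using Id(1) Pd(1) by blast
      qed
      with L xP obtain b where b: "b \<in> chains V (P (t - 1)) (Suc n)" and "\<forall>C. x C - kdiff V a b C \<in> J t"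
        unfolding kexact_def by blast
      then have "\<forall>C. \<exists>i e. x C - kdiff V a b C = i + a z e \<and> i \<in> I t \<and> e \<in> P (t - 1)"
        unfolding J by blast
      then obtain i0 e0 where ie: "\<And>C. x C - kdiff V a b C = i0 C + a z (e0 C)" "\<And>C. i0 C \<in> I t" "\<And>C. e0 C \<in> P (t - 1)"
        by metis
      \<comment> \<open>The chosen \<open>i0\<close> and \<open>e0\<close> are arbitrary outside the
        range of chains, so both are cut off there.\<close>
      define e where "e C = (if C \<subseteq> V \<and> card C = n then e0 C else 0)" for C
      define i where "i C = (if C \<subseteq> V \<and> card C = n then i0 C else 0)" for C
      have eP: "e \<in> chains V (P (t - 1)) n" by (rule chainsI) (auto simp: e_def ie)
      have iI: "i \<in> chains V (I t) n" by (rule chainsI) (auto simp: i_def ie)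
      have xe: "x C = kdiff V a b C + i C + a z (e C)" for C
      proof (cases "C \<subseteq> V \<and> card C = n")
        case True
        then show ?thesis using ie(1)[of C] by (simp add: i_def e_def algebra_simps)
      next
        case False
        moreover have "i C = 0" "e C = 0" using False by (simp_all only: i_def e_def if_False)
        ultimately show ?thesis using chainsD(2)[OF xP] kdiff_outside[OF fin b] by simp
      qed
      have xfun: "x = (\<lambda>C. kdiff V a b C + i C + a z (e C))" using xe by blast
      have kx: "kdiff V a x C = kdiff V a i C + a z (kdiff V a e C)" if "C \<subseteq> V" for C
      proof -
        have "kdiff V a (\<lambda>C. a z (e C)) C = a z (kdiff V a e C)"
          unfolding kdiff_def a_sum by (rule sum.cong) (auto simp: a_sg a_comm[of _ z])
        then show ?thesis
          unfolding xfun kdiff_add[of _ "\<lambda>C. kdiff V a b C + i C"] kdiff_add[of _ "kdiff V a b" i] using kdiff_kd_0[OF fin that] by simp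
      qed
      \<comment> \<open>Applying the differential to \<open>x = db + i + z e\<close> and comparing
        with the cycle condition leaves \<open>z (de + y)\<close> in \<open>I\<close>; regularity
        cancels \<open>z\<close>.\<close>
      have key: "kdiff V a e C + y C \<in> I t" if C: "C \<subseteq> V" for C
      proof (rule reg)
        have kdeP: "kdiff V a e C \<in> P (t - 1 + 1)"
          by (rule kdiff_mem[OF PV])
            (use chains_mem[OF eP Pd(1)] chainsD(2)[OF eP] in blast)+
        then show "kdiff V a e C + y C \<in> P t" using yP Pd(4) by simp
        have "a z (kdiff V a e C + y C) = kdiff ?W a c C - kdiff V a i C"
          using k1[OF C] kx[OF C] by (simp add: a_add)
        moreover have "kdiff V a i C \<in> I (t + 1)"
          by (rule kdiff_mem[OF IV])
            (use chains_mem[OF iI Id(1)] chainsD(2)[OF iI] in blast)+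
        ultimately show "a z (kdiff V a e C + y C) \<in> I (t + 1)" using cI Id(2) by metis
      qed
      \<comment> \<open>\<open>g\<close> encodes \<open>b + e_z \<and> e\<close>. It bounds
        \<open>c\<close> modulo \<open>I\<close> because \<open>y = - de\<close> modulo
        \<open>I\<close>.\<close>
      define g where "g A = (if z \<in> A then ksign z (A - {z}) (e (A - {z})) else b A)" for A
      have gP: "g \<in> chains ?W (P (t - 1)) (Suc n)"
      proof (rule chainsI)
        fix A assume A: "A \<subseteq> ?W" "card A = Suc n"
        show "g A \<in> P (t - 1)"
          using chains_mem[OF eP Pd(1)] chains_mem[OF b Pd(1)] by (auto simp: g_def ksign_mem[OF P])
      next
        fix A assume A: "\<not> (A \<subseteq> ?W \<and> card A = Suc n)"
        show "g A = 0"
        proof (cases "z \<in> A")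
          case True
          then have "A = insert z (A - {z})" by blast
          have "\<not> (A - {z} \<subseteq> V \<and> card (A - {z}) = n)"
          proof
            assume *: "A - {z} \<subseteq> V \<and> card (A - {z}) = n"
            then have "finite (A - {z})" using finite_subset[OF _ fin] by blast
            then have "finite A" by simp
            then have "card A = Suc n" using * True card_Suc_Diff1 by fastforce
            then show False using A * by auto
          qed
          then have "e (A - {z}) = 0" by (rule chainsD(2)[OF eP])
          then show ?thesis using True by (simp add: g_def)
        next
          case False
          then have "\<not> (A \<subseteq> V \<and> card A = Suc n)" using A by auto
          then have "b A = 0" by (rule chainsD(2)[OF b])
          then show ?thesis using False by (simp add: g_def)
        qed
      qed
      have g1: "kdiff ?W a g C = kdiff V a b C + a z (e C)"
        and g2: "kdiff ?W a g (insert z C) = - ksign z C (kdiff V a e C)" if "C \<subseteq> V" for C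
        by (rule kdiff_glue[OF fin zV that]; use zV in \<open>force simp: g_def\<close>)+
      have "c C - kdiff ?W a g C \<in> I t" for C
      proof -
        consider "C \<subseteq> V" | D where "C = insert z D" "D \<subseteq> V" | "\<not> C \<subseteq> ?W"
          by (metis subset_insert_iff mk_disjoint_insert insert_Diff)
        then show ?thesis
        proof cases
          case 1
          have "c C - kdiff ?W a g C = i C" using g1[OF 1] xe[of C] 1 by (simp add: x_def)
          then show ?thesis using chains_mem[OF iI Id(1)] by simp
        next
          case 2
          have "c C - kdiff ?W a g C = ksign z D (y D + kdiff V a e D)"
            using g2[OF 2(2)] 2 by (simp add: y_def ksign_add)
          then show ?thesis using key[OF 2(2)] by (simp add: ksign_mem[OF I] add.commute)
        next
          case 3
          then have "c C = 0" "kdiff ?W a g C = 0"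
            using chainsD(2)[OF c, of C] kdiff_outside[OF fW gP, of C] by simp_all
          then show ?thesis using Id(1) by simp
        qed
      qed
      then show "\<exists>b\<in>chains ?W (P (t - 1)) (Suc n). \<forall>C. c C - kdiff ?W a b C \<in> I t"
        using gP by blast
    qed
  next
    assume L: "kexact ?W a P I n t"
    show "kexact V a P J n t"
      unfolding kexact_def
    proof (intro ballI impI)
      fix x assume x: "x \<in> chains V (P t) n" and xJ: "\<forall>C. kdiff V a x C \<in> J (t + 1)"
      have "\<forall>C. \<exists>i y. kdiff V a x C = i + a z y \<and> i \<in> I (t + 1) \<and> y \<in> P t"
        using xJ unfolding J by auto
      then obtain i y0 where iy: "\<And>C. kdiff V a x C = i C + a z (y0 C)" "\<And>C. i C \<in> I (t + 1)" "\<And>C. y0 C \<in> P t"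
        by metis
      \<comment> \<open>The minus sign turns \<open>dx = i + z y0\<close> into the cycle condition
        for \<open>x + e_z \<and> y\<close>. Writing \<open>Suc (card C) = n\<close> makes
        \<open>y\<close> zero for \<open>n = 0\<close>.\<close>
      define y where "y C = (if C \<subseteq> V \<and> Suc (card C) = n then - y0 C else 0)" for C
      have yP: "y C \<in> P t" for C using iy(3) Pd(1,3) by (auto simp: y_def)
      have xy: "kdiff V a x C + a z (y C) \<in> I (t + 1)" for C
      proof (cases "C \<subseteq> V \<and> Suc (card C) = n")
        case True
        then show ?thesis using iy(1,2)[of C] by (simp add: y_def a_minus)
      next
        case False
        then have "kdiff V a x C = 0"
          using kdiff_outside[OF fin, of x "P t" "n - 1" C] kdiff_0_chain[OF fin, of x "P t" C] x
          by (cases n) auto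
        then show ?thesis using False Id(1) by (auto simp: y_def)
      qed
      define c where "c A = (if z \<in> A then ksign z (A - {z}) (y (A - {z})) else x A)" for A
      have cP: "c \<in> chains ?W (P t) n"
      proof (rule chainsI)
        fix A assume A: "A \<subseteq> ?W" "card A = n"
        show "c A \<in> P t"
          using yP chains_mem[OF x Pd(1)] by (auto simp: c_def ksign_mem[OF P])
      next
        fix A assume A: "\<not> (A \<subseteq> ?W \<and> card A = n)"
        show "c A = 0"
        proof (cases "z \<in> A")
          case True
          have "\<not> (A - {z} \<subseteq> V \<and> Suc (card (A - {z})) = n)"
          proof
            assume *: "A - {z} \<subseteq> V \<and> Suc (card (A - {z})) = n"
            then have "finite (A - {z})" using finite_subset[OF _ fin] by blast
            then have "finite A" by simp
            then have "card A = n" using * True card_Suc_Diff1 by fastforce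
            then show False using A * by auto
          qed
          then show ?thesis using True by (auto simp: c_def y_def)
        next
          case False
          then have "\<not> (A \<subseteq> V \<and> card A = n)" using A by auto
          then have "x A = 0" by (rule chainsD(2)[OF x])
          then show ?thesis using False by (simp add: c_def)
        qed
      qed
      have c1: "kdiff ?W a c C = kdiff V a x C + a z (y C)"
        and c2: "kdiff ?W a c (insert z C) = - ksign z C (kdiff V a y C)" if "C \<subseteq> V" for C
        by (rule kdiff_glue[OF fin zV that]; use zV in \<open>force simp: c_def\<close>)+
      \<comment> \<open>Since \<open>d d = 0\<close>, \<open>z dy\<close> is the differential of
        \<open>dx + z y\<close>, whose values lie in \<open>I\<close>; again \<open>z\<close> is
        cancelled.\<close>
      have ky: "kdiff V a y C \<in> I (t + 1)" if C: "C \<subseteq> V" for C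
      proof (rule reg)
        show "kdiff V a y C \<in> P (t + 1)"
          by (rule kdiff_mem[OF PV]) (rule yP, simp only: y_def simp_thms if_False)
        have "a z (kdiff V a y C) = kdiff V a (\<lambda>C. a z (y C)) C"
          unfolding kdiff_def a_sum by (rule sum.cong) (auto simp: a_sg a_comm[of _ z])
        also have "\<dots> = kdiff V a (\<lambda>C. kdiff V a x C + a z (y C)) C"
          using kdiff_add[of V "kdiff V a x" "\<lambda>C. a z (y C)" C] kdiff_kd_0[OF fin C] by simp
        also have "\<dots> \<in> I (t + 1 + 1)"
        proof (rule kdiff_mem[OF IV])
          show "kdiff V a x A + a z (y A) \<in> I (t + 1)" for A by (rule xy)
          show "kdiff V a x A + a z (y A) = 0" if "\<not> A \<subseteq> V" for A
          proof -
            have "kdiff V a x A = 0" unfolding kdiff_def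
              by (rule sum.neutral) (use that chainsD(2)[OF x] in auto)
            then show ?thesis using that by (simp add: y_def)
          qed
        qed
        finally show "a z (kdiff V a y C) \<in> I (t + 1 + 1)" .
      qed
      have "kdiff ?W a c C \<in> I (t + 1)" for C
      proof -
        consider "C \<subseteq> V" | D where "C = insert z D" "D \<subseteq> V" | "\<not> C \<subseteq> ?W"
          by (metis subset_insert_iff mk_disjoint_insert insert_Diff)
        then show ?thesis
        proof cases
          case 1
          then show ?thesis using c1 xy by simp
        next
          case 2
          show ?thesis unfolding 2(1) c2[OF 2(2)] by (intro Id(3) ksign_mem[OF I] ky 2(2))
        next
          case 3
          then have "kdiff ?W a c C = 0"
            unfolding kdiff_def by (intro sum.neutral) (use chainsD(2)[OF cP] in auto)
          then show ?thesis using Id(1) by simp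
        qed
      qed
      with L cP obtain g where g: "g \<in> chains ?W (P (t - 1)) (Suc n)" and gI: "\<forall>C. c C - kdiff ?W a g C \<in> I t"
        unfolding kexact_def by blast
      define b where "b A = (if A \<subseteq> V then g A else 0)" for A
      define e where "e A = (if A \<subseteq> V then ksign z A (g (insert z A)) else 0)" for A
      have bP: "b \<in> chains V (P (t - 1)) (Suc n)"
        by (rule chainsI) (use chainsD[OF g] in \<open>auto simp: b_def\<close>)
      have eP: "e A \<in> P (t - 1)" for A
        using chains_mem[OF g Pd(1)] by (auto simp: e_def Pd(1) ksign_mem[OF P])
      have g1: "kdiff ?W a g C = kdiff V a b C + a z (e C)" if "C \<subseteq> V" for C
        by (rule kdiff_glue[OF fin zV that]; simp add: b_def e_def)
      have "x C - kdiff V a b C \<in> J t" for C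
      proof (cases "C \<subseteq> V")
        case True
        then have "c C = x C" using zV by (auto simp: c_def)
        then have "x C - kdiff V a b C = (c C - kdiff ?W a g C) + a z (e C)"
          using g1[OF True] by simp
        then show ?thesis unfolding J using gI eP by blast
      next
        case False
        then have "x C = 0" "kdiff V a b C = 0"
          using chainsD(2)[OF x, of C] kdiff_outside[OF fin bP, of C] by simp_all
        then have "x C - kdiff V a b C = 0 + a z 0" by simp
        then show ?thesis unfolding J using Id(1) Pd(1) by blast
      qed
      then show "\<exists>b\<in>chains V (P (t - 1)) (Suc n). \<forall>C. x C - kdiff V a b C \<in> J t"
        using bP by blast
    qed
  }
qed

end


section \<open>The connecting map of a graded surjection\<close>

abbreviation Z0 :: "int \<Rightarrow> 'm::zero set" where "Z0 \<equiv> \<lambda>_. {0}"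

text \<open>Additivity and linearity are demanded on homogeneous elements only: the maps of an
  arbitrary resolution may do anything outside the sums of homogeneous elements.\<close>

locale graded_surjection = F: commuting_action aF + M: commuting_action aM
  for aF :: "'v::linorder \<Rightarrow> 'f::ab_group_add \<Rightarrow> 'f" and aM :: "'v \<Rightarrow> 'm::ab_group_add \<Rightarrow> 'm" +
  fixes V :: "'v set" and PF :: "int \<Rightarrow> 'f set" and PM :: "int \<Rightarrow> 'm set" and f :: "'f \<Rightarrow> 'm"
  assumes fin: "finite V"
    and PF: "graded_sub V aF PF"
    and PM: "graded_sub V aM PM"
    and f_add: "x \<in> PF t \<Longrightarrow> y \<in> PF t \<Longrightarrow> f (x + y) = f x + f y"
    and f_act: "v \<in> V \<Longrightarrow> x \<in> PF t \<Longrightarrow> f (aF v x) = aM v (f x)"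
    and f_surj: "f ` PF t = PM t"
begin

definition ker :: "int \<Rightarrow> 'f set" where
  "ker t = {x \<in> PF t. f x = 0}"

lemma f_0 [simp]: "f 0 = 0"
  using f_add[OF graded_subD(1)[OF PF] graded_subD(1)[OF PF]] by simp

lemma f_minus: "x \<in> PF t \<Longrightarrow> f (- x) = - f x"
  using f_add[of x t "- x"] graded_subD(3)[OF PF, of x t] by (simp add: eq_neg_iff_add_eq_0 add.commute)

lemma f_diff: "x \<in> PF t \<Longrightarrow> y \<in> PF t \<Longrightarrow> f (x - y) = f x - f y"
  using f_add[of x t "- y"] graded_subD(3)[OF PF, of y t] by (simp add: f_minus)

lemma f_sum: "(\<And>i. i \<in> S \<Longrightarrow> g i \<in> PF t) \<Longrightarrow> f (sum g S) = (\<Sum>i\<in>S. f (g i))"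
proof (induction S rule: infinite_finite_induct)
  case (insert i S)
  have "sum g S \<in> PF t" by (rule graded_sub_sum[OF PF]) (use insert in auto)
  then show ?case using insert by (simp add: f_add[of _ t])
qed auto

lemma f_sg: "x \<in> PF t \<Longrightarrow> f (ksign v C x) = ksign v C (f x)"
  by (simp add: ksign_def f_minus)

lemma f_kd:
  assumes "\<And>A. c A \<in> PF t"
  shows "f (kdiff V aF c C) = kdiff V aM (\<lambda>A. f (c A)) C"
proof -
  have "f (kdiff V aF c C) = (\<Sum>v\<in>V - C. f (ksign v C (aF v (c (insert v C)))))"
    unfolding kdiff_def by (rule f_sum[of _ _ "t + 1"]) (auto intro!: ksign_mem[OF PF] graded_subD[OF PF] assms)
  also have "\<dots> = (\<Sum>v\<in>V - C. ksign v C (aM v (f (c (insert v C)))))"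
  proof (rule sum.cong[OF refl])
    fix v assume v: "v \<in> V - C"
    then have "aF v (c (insert v C)) \<in> PF (t + 1)" by (intro graded_subD[OF PF] assms) auto
    then show "f (ksign v C (aF v (c (insert v C)))) = ksign v C (aM v (f (c (insert v C))))"
      using v by (metis DiffD1 f_sg f_act assms)
  qed
  finally show ?thesis by (simp add: kdiff_def)
qed

lemma lift_chain:
  assumes "m \<in> chains V (PM t) n"
  obtains c where "c \<in> chains V (PF t) n" "\<And>A. f (c A) = m A"
proof -
  have "\<forall>A. \<exists>x. A \<subseteq> V \<and> card A = n \<longrightarrow> x \<in> PF t \<and> f x = m A"
    using chainsD(1)[OF assms] f_surj[of t] by (metis imageE)
  then obtain x where x: "\<And>A. A \<subseteq> V \<Longrightarrow> card A = n \<Longrightarrow> x A \<in> PF t \<and> f (x A) = m A"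
    by metis
  define c where "c A = (if A \<subseteq> V \<and> card A = n then x A else 0)" for A
  have "c \<in> chains V (PF t) n" by (rule chainsI) (use x in \<open>auto simp: c_def\<close>)
  moreover have "f (c A) = m A" for A
    using x chainsD(2)[OF assms, of A] by (auto simp: c_def)
  ultimately show ?thesis using that by blast
qed

lemma ker_graded_sub: "graded_sub V aF ker"
  unfolding graded_sub_def ker_def
proof (intro allI conjI ballI)
  fix t x assume x: "x \<in> {x \<in> PF t. f x = 0}"
  show "x - y \<in> {x \<in> PF t. f x = 0}" if "y \<in> {x \<in> PF t. f x = 0}" for y
    using x that graded_subD(2)[OF PF, of x t y] f_diff[of x t y] by simp
  show "aF v x \<in> {x \<in> PF (t + 1). f x = 0}" if "v \<in> V" for v
    using x that graded_subD(5)[OF PF, of v x t] f_act[of v x t] by simp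
qed (use graded_subD(1)[OF PF] in auto)

lemma ker_subset: "ker t \<subseteq> PF t" by (auto simp: ker_def)

text \<open>Injectivity of the connecting map from \<open>H_(n+1)(M)_t\<close> to
  \<open>H_n(ker)_(t+1)\<close>: the boundary of a lifted cycle is a cycle in the kernel, and
  subtracting a kernel chain with the same boundary makes the lift a cycle of
  \<open>F\<close>.\<close>

lemma kexact_image:
  assumes F: "kexact V aF PF Z0 (Suc n) t" and K: "kexact V aF ker Z0 n (t + 1)"
  shows "kexact V aM PM Z0 (Suc n) t"
  unfolding kexact_def
proof (intro ballI impI)
  fix m assume m: "m \<in> chains V (PM t) (Suc n)" and dm: "\<forall>C. kdiff V aM m C \<in> {0}"
  obtain c where c: "c \<in> chains V (PF t) (Suc n)" and fc: "\<And>A. f (c A) = m A"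
    using lift_chain[OF m] by blast
  have cP: "c A \<in> PF t" for A using chains_mem[OF c graded_subD(1)[OF PF]] .
  have mf: "m = (\<lambda>A. f (c A))" using fc by auto
  have d: "kdiff V aF c \<in> chains V (PF (t + 1)) n" by (rule F.kdiff_chains[OF fin PF c])
  have "kdiff V aF c \<in> chains V (ker (t + 1)) n"
    by (rule chains_change[OF d]) (use f_kd[of c t, OF cP] dm chainsD(1)[OF d] in \<open>auto simp: ker_def mf\<close>)
  moreover have "kdiff V aF (kdiff V aF c) C = 0" for C
  proof (cases "C \<subseteq> V")
    case True
    then show ?thesis by (rule F.kdiff_kd_0[OF fin])
  next
    case False
    then show ?thesis unfolding kdiff_def[of V aF "kdiff V aF c"]
      by (intro sum.neutral) (use chainsD(2)[OF d] in auto)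
  qed
  ultimately obtain b where b: "b \<in> chains V (ker t) (Suc n)" and cb: "\<And>C. kdiff V aF c C = kdiff V aF b C"
    using K unfolding kexact_def by (force simp: algebra_simps)
  have bF: "b \<in> chains V (PF t) (Suc n)" by (rule chains_mono[OF b ker_subset])
  have "(\<lambda>A. c A - b A) \<in> chains V (PF t) (Suc n)" by (rule chains_diff[OF PF c bF])
  moreover have "\<forall>C. kdiff V aF (\<lambda>A. c A - b A) C \<in> {0}" by (simp add: F.kdiff_diff cb)
  ultimately obtain e where e: "e \<in> chains V (PF (t - 1)) (Suc (Suc n))" and ce: "\<And>C. c C - b C = kdiff V aF e C"
    using F unfolding kexact_def by force
  have eP: "e A \<in> PF (t - 1)" for A using chains_mem[OF e graded_subD(1)[OF PF]] .
  have fb: "f (b A) = 0" for A using chains_mem[OF b, of A] graded_subD(1)[OF ker_graded_sub] by (auto simp: ker_def)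
  have "m C = kdiff V aM (\<lambda>A. f (e A)) C" for C
    using f_kd[of e "t - 1" C, OF eP] ce[of C] f_diff[OF cP[of C] chains_mem[OF bF graded_subD(1)[OF PF], of C]] fb fc by simp
  moreover have "(\<lambda>A. f (e A)) \<in> chains V (PM (t - 1)) (Suc (Suc n))"
    by (rule chainsI) (use chainsD[OF e] f_surj[symmetric] in auto)
  ultimately show "\<exists>b\<in>chains V (PM (t - 1)) (Suc (Suc n)). \<forall>C. m C - kdiff V aM b C \<in> {0}"
    by (intro bexI[of _ "\<lambda>A. f (e A)"]) auto
qed

text \<open>Surjectivity of the same connecting map. The first assumption concerns only cycles with
  values in the kernel and is weaker than exactness of \<open>F\<close> at \<open>n\<close>. It can
  therefore hold for \<open>n = 0\<close>, where \<open>F\<close> fails to be exact in the degrees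
  of its generators but the kernel of a minimal cover avoids them.\<close>

lemma kexact_ker:
  assumes F: "\<And>c. c \<in> chains V (ker (t + 1)) n \<Longrightarrow> (\<And>C. kdiff V aF c C = 0) \<Longrightarrow>
      \<exists>b\<in>chains V (PF t) (Suc n). \<forall>C. c C = kdiff V aF b C"
    and M: "kexact V aM PM Z0 (Suc n) t"
  shows "kexact V aF ker Z0 n (t + 1)"
  unfolding kexact_def
proof (intro ballI impI)
  fix z assume z: "z \<in> chains V (ker (t + 1)) n" and dz: "\<forall>C. kdiff V aF z C \<in> {0}"
  obtain c where c: "c \<in> chains V (PF t) (Suc n)" and zc: "\<And>C. z C = kdiff V aF c C"
    using F[OF z] dz by auto
  have cP: "c A \<in> PF t" for A using chains_mem[OF c graded_subD(1)[OF PF]] .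
  have "(\<lambda>A. f (c A)) \<in> chains V (PM t) (Suc n)"
    by (rule chainsI) (use chainsD[OF c] f_surj[symmetric] in auto)
  moreover have "\<forall>C. kdiff V aM (\<lambda>A. f (c A)) C \<in> {0}"
  proof
    fix C
    have "z C \<in> ker (t + 1)" by (rule chains_mem[OF z graded_subD(1)[OF ker_graded_sub]])
    then show "kdiff V aM (\<lambda>A. f (c A)) C \<in> {0}" using f_kd[of c t C, OF cP] zc[of C] by (auto simp: ker_def)
  qed
  ultimately obtain e where e: "e \<in> chains V (PM (t - 1)) (Suc (Suc n))" and fe: "\<And>C. f (c C) = kdiff V aM e C"
    using M unfolding kexact_def by force
  obtain g where g: "g \<in> chains V (PF (t - 1)) (Suc (Suc n))" and ge: "\<And>A. f (g A) = e A"
    using lift_chain[OF e] by blast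
  have gP: "g A \<in> PF (t - 1)" for A using chains_mem[OF g graded_subD(1)[OF PF]] .
  have ee: "e = (\<lambda>A. f (g A))" using ge by auto
  have dg: "kdiff V aF g \<in> chains V (PF (t - 1 + 1)) (Suc n)" by (rule F.kdiff_chains[OF fin PF g])
  then have dg: "kdiff V aF g \<in> chains V (PF t) (Suc n)" by simp
  \<comment> \<open>Subtracting \<open>dg\<close> leaves the boundary \<open>z\<close> unchanged and
    moves \<open>c\<close> into the kernel.\<close>
  let ?b = "\<lambda>A. c A - kdiff V aF g A"
  have b: "?b \<in> chains V (PF t) (Suc n)" by (rule chains_diff[OF PF c dg])
  have "f (?b A) = 0" for A
    using f_diff[OF cP[of A] chains_mem[OF dg graded_subD(1)[OF PF], of A]] f_kd[of g "t - 1" A, OF gP] fe[of A] by (simp add: ee)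
  then have "?b \<in> chains V (ker t) (Suc n)"
    using chains_change[OF b] chainsD(1)[OF b] by (auto simp: ker_def)
  moreover have "z C - kdiff V aF ?b C \<in> {0}" for C
  proof (cases "C \<subseteq> V")
    case True
    then show ?thesis using F.kdiff_kd_0[OF fin True] by (simp add: F.kdiff_diff zc)
  next
    case False
    then have "z C = 0" "kdiff V aF ?b C = 0"
      using chainsD(2)[OF z, of C] F.kdiff_outside[OF fin b, of C] by simp_all
    then show ?thesis by simp
  qed
  ultimately show "\<exists>b\<in>chains V (ker (t + 1 - 1)) (Suc n). \<forall>C. z C - kdiff V aF b C \<in> {0}"
    by (intro bexI[of _ ?b]) auto
qed

end

section \<open>Monomial modules and reduction by pure powers\<close>

abbreviation lk where "lk \<equiv> Poly_Mapping.lookup"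
abbreviation monomial :: "'a \<Rightarrow> 'a \<Rightarrow>\<^sub>0 'k::zero_neq_one" where "monomial u \<equiv> Poly_Mapping.single u 1"

definition mdiv :: "('x \<Rightarrow>\<^sub>0 nat) \<Rightarrow> ('x \<Rightarrow>\<^sub>0 nat) \<Rightarrow> bool" where
  "mdiv w u \<longleftrightarrow> (\<forall>x. lk w x \<le> lk u x)"

lemma mdiv_diff: "mdiv w u \<Longrightarrow> w + (u - w) = u"
  by (rule poly_mapping_eqI) (simp add: mdiv_def lookup_add lookup_minus)

lemma mdiv_add [simp]: "mdiv w (w + u)" "mdiv w (u + w)"
  by (simp_all add: mdiv_def lookup_add)

lemma lookup_single_mult:
  fixes p :: "('x, 'k::comm_semiring_1) mpoly"
  shows "lk (Poly_Mapping.single w c * p) u = (if mdiv w u then c * lk p (u - w) else 0)"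
proof -
  have "lk (Poly_Mapping.single w c * p) u = (\<Sum>l. c * (\<Sum>q. lk p q when u = l + q) when w = l)"
    by (simp add: lookup_mult lookup_single when_mult)
  also have "\<dots> = c * (\<Sum>q. lk p q when u = w + q)" by simp
  also have "(\<Sum>q. lk p q when u = w + q) = (if mdiv w u then lk p (u - w) else 0)"
  proof (cases "mdiv w u")
    case True
    then have "u = w + q \<longleftrightarrow> q = u - w" for q using mdiv_diff[OF True] by (metis add_diff_cancel_left')
    then show ?thesis using True by simp
  next
    case False
    then have "u \<noteq> w + q" for q by (metis mdiv_add(1))
    then show ?thesis using False by simp
  qed
  finally show ?thesis by simp
qed

lemma lookup_mono_mult_add [simp]:
  fixes p :: "('x, 'k::comm_semiring_1) mpoly"
  shows "lk (monomial w * p) (w + u) = lk p u"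
  by (simp add: lookup_single_mult)

lemma lookup_const_mult [simp]:
  fixes p :: "('x, 'k::comm_semiring_1) mpoly"
  shows "lk (Poly_Mapping.single 0 c * p) u = c * lk p u"
  by (simp add: lookup_single_mult mdiv_def)

lemma mdeg_superset: "finite X \<Longrightarrow> Poly_Mapping.keys m \<subseteq> X \<Longrightarrow> mdeg m = (\<Sum>x\<in>X. lk m x)"
  unfolding mdeg_def by (rule sum.mono_neutral_left) (auto simp: in_keys_iff)

lemma keys_add_nat: "Poly_Mapping.keys (u + w) = Poly_Mapping.keys u \<union> Poly_Mapping.keys (w :: 'x \<Rightarrow>\<^sub>0 nat)"
  by (auto simp: in_keys_iff lookup_add)

lemma mdeg_add [simp]: "mdeg (u + w) = mdeg u + mdeg w"
proof -
  let ?X = "Poly_Mapping.keys u \<union> Poly_Mapping.keys w"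
  show ?thesis
    using mdeg_superset[of ?X u] mdeg_superset[of ?X w] mdeg_superset[of ?X "u + w"]
    by (simp add: keys_add_nat lookup_add sum.distrib)
qed

lemma mdeg_0 [simp]: "mdeg 0 = 0" by (simp add: mdeg_def)

lemma mdeg_single [simp]: "mdeg (Poly_Mapping.single x k) = k"
  by (simp add: mdeg_def)

lemma mdeg_eq_0_iff: "mdeg u = 0 \<longleftrightarrow> u = 0"
proof
  assume "mdeg u = 0"
  then have "\<forall>x\<in>Poly_Mapping.keys u. lk u x = 0" by (simp add: mdeg_def)
  then show "u = 0" by (intro poly_mapping_eqI) (auto simp: in_keys_iff)
qed simp

lemma mdeg_diff: "mdiv w u \<Longrightarrow> mdeg w + mdeg (u - w) = mdeg u"
  by (metis mdiv_diff mdeg_add)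

lemma forms_iff: "p \<in> forms X t \<longleftrightarrow> (\<forall>u. lk p u \<noteq> 0 \<longrightarrow> Poly_Mapping.keys u \<subseteq> X \<and> int (mdeg u) = t)"
  by (auto simp: forms_def polys_def in_keys_iff)

lemma finite_monomials:
  assumes "finite X"
  shows "finite {u::'x \<Rightarrow>\<^sub>0 nat. Poly_Mapping.keys u \<subseteq> X \<and> mdeg u = n}"
proof -
  let ?M = "{u::'x \<Rightarrow>\<^sub>0 nat. Poly_Mapping.keys u \<subseteq> X \<and> mdeg u = n}"
  let ?F = "{f. \<forall>x. (x \<in> X \<longrightarrow> f x \<in> {..n}) \<and> (x \<notin> X \<longrightarrow> f x = 0)}"
  have "lk u x \<le> n" if "u \<in> ?M" "x \<in> X" for u x
    using that mdeg_superset[OF assms, of u] member_le_sum[of x X "lk u"] assms by auto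
  then have "lk ` ?M \<subseteq> ?F" by (auto simp: in_keys_iff)
  moreover have "finite ?F" by (rule finite_set_of_finite_funs[OF assms]) simp
  ultimately have "finite (lk ` ?M)" by (rule finite_subset)
  then show ?thesis by (rule finite_imageD) (simp add: inj_on_def)
qed

lemma exists_restriction:
  fixes p :: "'a \<Rightarrow>\<^sub>0 'k::zero"
  obtains q where "\<And>u. lk q u = (if Q u then lk p u else 0)"
proof
  have "finite {u. (if Q u then lk p u else 0) \<noteq> 0}"
    by (rule finite_subset[OF _ finite_lookup[of p]]) auto
  then show "lk (Abs_poly_mapping (\<lambda>u. if Q u then lk p u else 0)) u = (if Q u then lk p u else 0)" for u
    by simp
qed

lemma exists_quotient:
  fixes p :: "('x, 'k::comm_semiring_1) mpoly"
  assumes "\<And>u. lk p u \<noteq> 0 \<Longrightarrow> mdiv w u"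
  obtains q where "p = monomial w * q" "\<And>u. lk q u = lk p (w + u)"
proof -
  have "finite ((\<lambda>u. w + u) -` {u. lk p u \<noteq> 0})"
    by (rule finite_vimageI) (auto simp: inj_on_def)
  then have "finite {u. lk p (w + u) \<noteq> 0}" by (simp add: vimage_def)
  then have q: "lk (Abs_poly_mapping (\<lambda>u. lk p (w + u))) u = lk p (w + u)" for u by simp
  show thesis
  proof (rule that[OF _ q])
    show "p = monomial w * Abs_poly_mapping (\<lambda>u. lk p (w + u))"
    proof (rule poly_mapping_eqI)
      fix u show "lk p u = lk (monomial w * Abs_poly_mapping (\<lambda>u. lk p (w + u))) u"
        using assms[of u] by (auto simp: lookup_single_mult q mdiv_diff)
    qed
  qed
qed

section \<open>Modules on which the variables act by monomials\<close>

definition mact :: "('v \<Rightarrow> ('x \<Rightarrow>\<^sub>0 nat)) \<Rightarrow> 'v \<Rightarrow> ('x, 'k::comm_ring_1) mpoly \<Rightarrow> ('x, 'k) mpoly" where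
  "mact \<mu> v p = monomial (\<mu> v) * p"

lemma commuting_mact: "commuting_action (mact \<mu> :: 'v::linorder \<Rightarrow> ('x, 'k::comm_ring_1) mpoly \<Rightarrow> _)"
  by unfold_locales (simp_all add: mact_def algebra_simps)

text \<open>Three modules are instances: the Veronese ring with \<open>s = 0\<close>, the canonical
  module with \<open>s = d - 3\<close>, and a polynomial ring over itself, where
  \<open>\<mu> v\<close> is the variable \<open>v\<close> and \<open>d = 1\<close>.\<close>

locale monomial_action =
  fixes V :: "'v::linorder set" and \<mu> :: "'v \<Rightarrow> ('x \<Rightarrow>\<^sub>0 nat)" and X :: "'x set" and d :: nat and s :: int
  assumes finV: "finite V"
    and keys_\<mu>: "v \<in> V \<Longrightarrow> Poly_Mapping.keys (\<mu> v) \<subseteq> X"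
    and mdeg_\<mu>: "v \<in> V \<Longrightarrow> mdeg (\<mu> v) = d"
begin

definition mP :: "int \<Rightarrow> ('x, 'k::comm_ring_1) mpoly set" where
  "mP t = forms X (s + t * int d)"

text \<open>For \<open>T \<subseteq> V\<close> this is the submodule generated by the
  \<open>\<mu> z\<close> with \<open>z \<in> T\<close>. Describing it by supports makes membership a
  condition on each monomial separately.\<close>

definition mI :: "'v set \<Rightarrow> int \<Rightarrow> ('x, 'k::comm_ring_1) mpoly set" where
  "mI T t = {p \<in> mP t. \<forall>u. lk p u \<noteq> 0 \<longrightarrow> (\<exists>z\<in>T. mdiv (\<mu> z) u)}"

lemma mact_mP:
  fixes p :: "('x, 'k::comm_ring_1) mpoly"
  assumes "v \<in> V" "p \<in> mP t"
  shows "mact \<mu> v p \<in> mP (t + 1)"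
  unfolding mP_def forms_iff
proof (intro allI impI)
  fix u assume "lk (mact \<mu> v p) u \<noteq> 0"
  then have u: "mdiv (\<mu> v) u" "lk p (u - \<mu> v) \<noteq> 0" by (auto simp: mact_def lookup_single_mult split: if_splits)
  then have "Poly_Mapping.keys (u - \<mu> v) \<subseteq> X" "int (mdeg (u - \<mu> v)) = s + t * int d"
    using assms(2) by (auto simp: mP_def forms_iff)
  moreover have "Poly_Mapping.keys u = Poly_Mapping.keys (\<mu> v) \<union> Poly_Mapping.keys (u - \<mu> v)"
    using mdiv_diff[OF u(1)] by (metis keys_add_nat)
  ultimately show "Poly_Mapping.keys u \<subseteq> X \<and> int (mdeg u) = s + (t + 1) * int d"
    using keys_\<mu>[OF assms(1)] mdeg_\<mu>[OF assms(1)] mdeg_diff[OF u(1)] by (auto simp: algebra_simps)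
qed

lemma mP_graded_sub: "graded_sub V (mact \<mu>) (mP :: int \<Rightarrow> ('x, 'k::comm_ring_1) mpoly set)"
  unfolding graded_sub_def
proof (intro allI conjI ballI)
  fix t and x y :: "('x, 'k) mpoly" assume "x \<in> mP t" "y \<in> mP t"
  then show "x - y \<in> mP t" unfolding mP_def forms_iff by (metis diff_0_right lookup_minus)
qed (auto simp: mact_mP, simp add: mP_def forms_iff)

lemma mI_graded_sub: "graded_sub V (mact \<mu>) (mI T :: int \<Rightarrow> ('x, 'k::comm_ring_1) mpoly set)"
  unfolding graded_sub_def
proof (intro allI conjI ballI)
  fix t show "0 \<in> (mI T t :: ('x, 'k) mpoly set)" using graded_subD(1)[OF mP_graded_sub] by (auto simp: mI_def)
  fix x :: "('x, 'k) mpoly" assume x: "x \<in> mI T t"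
  show "x - y \<in> mI T t" if "y \<in> mI T t" for y
    using x that graded_subD(2)[OF mP_graded_sub, of x t y] unfolding mI_def
    by (auto simp: lookup_minus) (metis diff_0_right)
  show "mact \<mu> v x \<in> mI T (t + 1)" if v: "v \<in> V" for v
    unfolding mI_def
  proof (intro CollectI conjI allI impI)
    show "mact \<mu> v x \<in> mP (t + 1)" using x v mact_mP by (auto simp: mI_def)
    fix u assume "lk (mact \<mu> v x) u \<noteq> 0"
    then have u: "mdiv (\<mu> v) u" "lk x (u - \<mu> v) \<noteq> 0" by (auto simp: mact_def lookup_single_mult split: if_splits)
    then obtain z where "z \<in> T" "mdiv (\<mu> z) (u - \<mu> v)" using x by (auto simp: mI_def)
    moreover have "mdiv (u - \<mu> v) u" using mdiv_diff[OF u(1)] by (metis mdiv_add(2))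
    ultimately show "\<exists>z\<in>T. mdiv (\<mu> z) u" unfolding mdiv_def by (meson order_trans)
  qed
qed

text \<open>The monomials divisible by some \<open>\<mu> w\<close> with \<open>w \<in> T\<close> are
  collected in \<open>x\<close>; all the remaining ones are divisible by
  \<open>\<mu> z\<close>.\<close>

lemma mI_insert:
  assumes "z \<in> V"
  shows "(mI (insert z T) t :: ('x, 'k::comm_ring_1) mpoly set) = {x + mact \<mu> z y | x y. x \<in> mI T t \<and> y \<in> mP (t - 1)}"
proof (intro set_eqI iffI)
  fix p :: "('x, 'k) mpoly" assume p: "p \<in> mI (insert z T) t"
  obtain x where x: "\<And>u. lk x u = (if \<exists>w\<in>T. mdiv (\<mu> w) u then lk p u else 0)"
    using exists_restriction[of "\<lambda>u. \<exists>w\<in>T. mdiv (\<mu> w) u" p] by blast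
  have r: "mdiv (\<mu> z) u" if "lk (p - x) u \<noteq> 0" for u
    using p that by (auto simp: lookup_minus x mI_def split: if_splits)
  obtain y where y: "p - x = monomial (\<mu> z) * y" "\<And>u. lk y u = lk (p - x) (\<mu> z + u)"
    using exists_quotient[of "p - x" "\<mu> z"] r by blast
  have "x \<in> mI T t"
    using p unfolding mI_def mP_def forms_iff by (auto simp: x split: if_splits)
  moreover have "y \<in> mP (t - 1)"
    unfolding mP_def forms_iff
  proof (intro allI impI)
    fix u assume "lk y u \<noteq> 0"
    then have "lk p (\<mu> z + u) \<noteq> 0" by (auto simp: y(2) lookup_minus x split: if_splits)
    then have "Poly_Mapping.keys (\<mu> z + u) \<subseteq> X" "int (mdeg (\<mu> z + u)) = s + t * int d"
      using p unfolding mI_def mP_def forms_iff by auto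
    then show "Poly_Mapping.keys u \<subseteq> X \<and> int (mdeg u) = s + (t - 1) * int d"
      using mdeg_\<mu>[OF assms] by (auto simp: keys_add_nat algebra_simps)
  qed
  moreover have "p = x + mact \<mu> z y" using y(1) by (simp add: mact_def algebra_simps)
  ultimately show "p \<in> {x + mact \<mu> z y | x y. x \<in> mI T t \<and> y \<in> mP (t - 1)}" by blast
next
  fix p :: "('x, 'k) mpoly" assume "p \<in> {x + mact \<mu> z y | x y. x \<in> mI T t \<and> y \<in> mP (t - 1)}"
  then obtain x y where p: "p = x + mact \<mu> z y" and x: "x \<in> mI T t" and y: "y \<in> mP (t - 1)" by blast
  have "mact \<mu> z y \<in> mP t" using mact_mP[OF assms y] by simp
  then have "mact \<mu> z y \<in> mI (insert z T) t" by (auto simp: mI_def mact_def lookup_single_mult)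
  moreover have "x \<in> mI (insert z T) t" using x by (auto simp: mI_def)
  ultimately show "p \<in> mI (insert z T) t"
    unfolding p by (rule graded_subD(4)[OF mI_graded_sub, rotated])
qed

text \<open>A monomial coprime to \<open>\<mu> z\<close> divides the product of
  \<open>\<mu> z\<close> and \<open>u\<close> only if it divides \<open>u\<close>.\<close>

lemma mI_regular:
  fixes x :: "('x, 'k::comm_ring_1) mpoly"
  assumes "\<And>w. w \<in> T \<Longrightarrow> Poly_Mapping.keys (\<mu> z) \<inter> Poly_Mapping.keys (\<mu> w) = {}"
    "x \<in> mP t" "mact \<mu> z x \<in> mI T (t + 1)"
  shows "x \<in> mI T t"
  unfolding mI_def
proof (intro CollectI conjI allI impI assms(2))
  fix u assume "lk x u \<noteq> 0"
  then have "lk (mact \<mu> z x) (\<mu> z + u) \<noteq> 0" by (simp add: mact_def)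
  then obtain w where w: "w \<in> T" "mdiv (\<mu> w) (\<mu> z + u)" using assms(3) by (auto simp: mI_def)
  have "lk (\<mu> w) i \<le> lk u i" for i
  proof (cases "i \<in> Poly_Mapping.keys (\<mu> w)")
    case True
    then have "lk (\<mu> z) i = 0" using assms(1)[OF w(1)] by (auto simp: in_keys_iff)
    then show ?thesis using w(2) unfolding mdiv_def lookup_add by (metis add_0)
  qed (simp add: in_keys_iff)
  then show "\<exists>z\<in>T. mdiv (\<mu> z) u" using w(1) by (auto simp: mdiv_def)
qed

text \<open>Monomials with pairwise disjoint supports form a regular sequence, so
  \<open>koszul_regular\<close> trades them one at a time for a larger ideal.\<close>

lemma kexact_reduce:
  assumes T: "T \<subseteq> V" and disj: "\<And>z w. z \<in> T \<Longrightarrow> w \<in> T \<Longrightarrow> z \<noteq> w \<Longrightarrow> Poly_Mapping.keys (\<mu> z) \<inter> Poly_Mapping.keys (\<mu> w) = {}"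
  shows "kexact V (mact \<mu>) (mP :: int \<Rightarrow> ('x, 'k::comm_ring_1) mpoly set) Z0 n t \<longleftrightarrow> kexact (V - T) (mact \<mu>) (mP :: int \<Rightarrow> ('x, 'k) mpoly set) (mI T) n t"
proof -
  have "finite T" using T finV finite_subset by blast
  then show ?thesis using T disj
  proof (induction T)
    case empty
    have "mI {} = (Z0 :: int \<Rightarrow> ('x, 'k) mpoly set)"
      by (auto simp: mI_def fun_eq_iff mP_def forms_iff intro!: poly_mapping_eqI)
    then show ?case by (simp only: Diff_empty)
  next
    case (insert z T)
    have eq: "insert z (V - insert z T) = V - T" using insert by blast
    have "kexact (insert z (V - insert z T)) (mact \<mu>) (mP :: int \<Rightarrow> ('x, 'k) mpoly set) (mI T) n t
       \<longleftrightarrow> kexact (V - insert z T) (mact \<mu>) (mP :: int \<Rightarrow> ('x, 'k) mpoly set) (mI (insert z T)) n t"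
    proof (rule commuting_action.koszul_regular[OF commuting_mact])
      show "x \<in> mI T t" if "x \<in> mP t" "mact \<mu> z x \<in> mI T (t + 1)" for x :: "('x, 'k) mpoly" and t
        by (rule mI_regular[OF _ that]) (use insert in auto)
      show "mI (insert z T) t = {x + mact \<mu> z y |x y. x \<in> mI T t \<and> y \<in> (mP (t - 1) :: ('x, 'k) mpoly set)}" for t
        by (rule mI_insert) (use insert in auto)
    qed (use finV insert.prems in \<open>auto simp: mI_def eq intro: graded_sub_mono[OF mP_graded_sub] graded_sub_mono[OF mI_graded_sub]\<close>)
    then show ?case using insert by (simp add: eq)
  qed
qed

end

section \<open>Green's vanishing theorem\<close>

definition pact :: "('v \<Rightarrow> nat) \<Rightarrow> 'v \<Rightarrow> 'k::field poly \<Rightarrow> 'k poly" where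
  "pact \<kappa> v p = monom 1 (\<kappa> v) * p"

text \<open>Each variable acts by its value at the point with parameter \<open>t\<close>, so the
  Koszul differential of this action is the contraction with the evaluation at that point.\<close>

definition eact :: "('v \<Rightarrow> nat) \<Rightarrow> 'k \<Rightarrow> 'v \<Rightarrow> 'k::field poly \<Rightarrow> 'k poly" where
  "eact \<kappa> t v p = smult (t ^ \<kappa> v) p"

lemma commuting_pact: "commuting_action (pact \<kappa> :: 'v::linorder \<Rightarrow> 'k::field poly \<Rightarrow> _)"
  by unfold_locales (simp_all add: pact_def algebra_simps)

lemma commuting_eact: "commuting_action (eact \<kappa> t :: 'v::linorder \<Rightarrow> 'k::field poly \<Rightarrow> _)"
  by unfold_locales (simp_all add: eact_def algebra_simps smult_add_right)

lemma coeff_sg: "coeff (ksign v C p) i = ksign v C (coeff p i)" for p :: "'k::ab_group_add poly"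
  by (simp add: ksign_def)

lemma poly_sg: "poly (ksign v C p) t = ksign v C (poly p t)" for p :: "'k::comm_ring poly"
  by (simp add: ksign_def)

lemma exists_nonroot:
  fixes p :: "'k::field_char_0 poly"
  assumes "p \<noteq> 0"
  obtains t where "poly p t \<noteq> 0"
  using poly_roots_finite[OF assms] infinite_UNIV_char_0[where 'a='k]
  by (metis (mono_tags, lifting) UNIV_I finite_subset mem_Collect_eq subsetI)

text \<open>
  Induction on \<open>q\<close>: contract with the evaluation at a point \<open>t\<close>. The contraction is again a cycle, its
  coefficients vanish at \<open>t\<close> because \<open>c\<close> is a cycle, and for all but finitely many \<open>t\<close> it is nonzero
  while the subspace of \<open>U\<close> vanishing at \<open>t\<close> is determined by one coordinate less. The set \<open>X\<close> of
  coordinates detecting the elements of \<open>U\<close> replaces the dimension of \<open>U\<close>.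
\<close>

lemma green_univariate:
  fixes c :: "'v::linorder set \<Rightarrow> 'k::field_char_0 poly"
  assumes "finite V" "inj_on \<kappa> V"
    and "\<And>p r. p \<in> U \<Longrightarrow> r \<in> U \<Longrightarrow> p - r \<in> U" "\<And>p a. p \<in> U \<Longrightarrow> smult a p \<in> U"
    and "c \<in> chains V U q" "finite X" "card X \<le> q"
    and "\<And>p. p \<in> U \<Longrightarrow> (\<And>i. i \<in> X \<Longrightarrow> coeff p i = 0) \<Longrightarrow> p = 0"
    and "\<And>C. kdiff V (pact \<kappa>) c C = 0"
  shows "c A = 0"
  using assms(3-)
proof (induction q arbitrary: c U X A)
  case 0
  then have "X = {}" by simp
  then show ?case using "0.prems"(6)[of "c A"] chainsD[OF "0.prems"(3), of A] by (metis empty_iff)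
next
  case (Suc q)
  note chD = chainsD[OF Suc.prems(3)]
  show ?case
  proof (rule ccontr)
    assume nz: "c A \<noteq> 0"
    then have A: "A \<subseteq> V" "card A = Suc q" using chD(2)[of A] by blast+
    obtain v0 where v0: "v0 \<in> A" using A(2) by fastforce
    define C where "C = A - {v0}"
    have AC: "A = insert v0 C" "v0 \<in> V - C" "C \<subseteq> V" using v0 A by (auto simp: C_def)
    obtain i where i: "coeff (c A) i \<noteq> 0" using nz by (metis leading_coeff_neq_0)
    \<comment> \<open>The coefficient at \<open>i\<close> of the contraction, taken at
      \<open>C\<close>, as a polynomial in the parameter of the point. The exponents
      \<open>\<kappa> v\<close> are distinct, so its terms cannot cancel.\<close>
    define g where "g = (\<Sum>v\<in>V - C. monom (ksign v C (coeff (c (insert v C)) i)) (\<kappa> v))"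
    have "coeff g (\<kappa> v0) = (\<Sum>v\<in>V - C. if v = v0 then ksign v C (coeff (c (insert v C)) i) else 0)"
      unfolding g_def coeff_sum
      by (rule sum.cong) (use AC(2) assms(2) in \<open>auto dest: inj_onD\<close>)
    also have "\<dots> = ksign v0 C (coeff (c A) i)" using AC assms(1) by simp
    finally have g0: "g \<noteq> 0" using i by auto
    have gt: "poly g t = coeff (kdiff V (eact \<kappa> t) c C) i" for t
      unfolding g_def kdiff_def poly_sum coeff_sum
      by (rule sum.cong) (auto simp: poly_monom coeff_sg eact_def ksign_def)
    have "X \<noteq> {}" using Suc.prems(6)[of "c A"] chD(1)[OF A] nz by blast
    then obtain x where x: "x \<in> X" by blast
    \<comment> \<open>Up to scalars there is at most one nonzero element of \<open>U\<close> that
      the coordinates other than \<open>x\<close> fail to detect. The point must avoid its zeros;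
      the default 1, which has none, serves when no such element exists.\<close>
    define s where "s = (if \<exists>s\<in>U. s \<noteq> 0 \<and> (\<forall>j\<in>X - {x}. coeff s j = 0)
      then SOME s. s \<in> U \<and> s \<noteq> 0 \<and> (\<forall>j\<in>X - {x}. coeff s j = 0) else 1)"
    have sU: "s \<in> U \<and> s \<noteq> 0 \<and> (\<forall>j\<in>X - {x}. coeff s j = 0)"
      if "\<exists>s\<in>U. s \<noteq> 0 \<and> (\<forall>j\<in>X - {x}. coeff s j = 0)"
      using that someI_ex[of "\<lambda>s. s \<in> U \<and> s \<noteq> 0 \<and> (\<forall>j\<in>X - {x}. coeff s j = 0)"] unfolding s_def by auto
    have "s \<noteq> 0"
    proof (cases "\<exists>s\<in>U. s \<noteq> 0 \<and> (\<forall>j\<in>X - {x}. coeff s j = 0)")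
      case True then show ?thesis using sU by blast
    next
      case False then show ?thesis by (simp only: s_def if_False) simp
    qed
    then obtain t where "poly (g * s) t \<noteq> 0" using g0 exists_nonroot[of "g * s"] by auto
    then have t: "poly g t \<noteq> 0" "poly s t \<noteq> 0" by auto
    define U' where "U' = {p \<in> U. poly p t = 0}"
    define c' where "c' = kdiff V (eact \<kappa> t) c"
    interpret e: commuting_action "eact \<kappa> t" by (rule commuting_eact)
    interpret p: commuting_action "pact \<kappa>" by (rule commuting_pact)
    have U0: "0 \<in> U" using chD(1)[OF A] Suc.prems(1) by (metis diff_self)
    have Usub: "graded_sub V (eact \<kappa> t) (\<lambda>_. U)"
      unfolding graded_sub_def using U0 Suc.prems(1,2) by (auto simp: eact_def)
    have c'U: "c' \<in> chains V U q"
      unfolding c'_def using e.kdiff_chains[OF assms(1) Usub Suc.prems(3)] by simp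
    \<comment> \<open>At the point itself contraction and Koszul differential agree, so the cycle
      condition on \<open>c\<close> makes all values of \<open>c'\<close> vanish at
      \<open>t\<close>.\<close>
    have ev: "poly (c' D) t = poly (kdiff V (pact \<kappa>) c D) t" for D
      unfolding c'_def kdiff_def poly_sum
      by (rule sum.cong) (auto simp: poly_sg eact_def pact_def poly_monom)
    have "c' A' = 0" for A'
    proof (rule Suc.IH)
      show "c' \<in> chains V U' q"
        by (rule chains_change[OF c'U]) (use chainsD(1)[OF c'U] ev Suc.prems(7) in \<open>auto simp: U'_def\<close>)
      show "p - r \<in> U'" if "p \<in> U'" "r \<in> U'" for p r using that Suc.prems(1) by (auto simp: U'_def)
      show "smult a p \<in> U'" if "p \<in> U'" for p a using that Suc.prems(2) by (auto simp: U'_def)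
      show "finite (X - {x})" using Suc.prems(4) by simp
      show "card (X - {x}) \<le> q" using Suc.prems(4,5) x by simp
      show "kdiff V (pact \<kappa>) c' D = 0" for D
      proof (cases "D \<subseteq> V")
        case True
        have "kdiff V (pact \<kappa>) c' D = - kdiff V (eact \<kappa> t) (kdiff V (pact \<kappa>) c) D"
          unfolding c'_def by (rule kdiff_anticommute[OF assms(1) True commuting_pact commuting_eact])
            (simp add: pact_def eact_def)
        also have "kdiff V (pact \<kappa>) c = (\<lambda>_. 0)" using Suc.prems(7) by blast
        finally show ?thesis by simp
      next
        case False
        then show ?thesis unfolding kdiff_def[of V "pact \<kappa>" c']
          by (intro sum.neutral) (use chainsD(2)[OF c'U] in auto)
      qed
      fix p assume p: "p \<in> U'" "\<And>i. i \<in> X - {x} \<Longrightarrow> coeff p i = 0"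
      show "p = 0"
      proof (rule ccontr)
        assume "p \<noteq> 0"
        then have ex: "\<exists>s\<in>U. s \<noteq> 0 \<and> (\<forall>j\<in>X - {x}. coeff s j = 0)"
          using p by (auto simp: U'_def)
        note s = sU[OF ex]
        have sx: "coeff s x \<noteq> 0" using s Suc.prems(6)[of s] by (metis DiffI singletonD)
        let ?l = "coeff p x / coeff s x"
        have "p - smult ?l s = 0"
        proof (rule Suc.prems(6))
          show "p - smult ?l s \<in> U" using p(1) s Suc.prems(1,2) by (auto simp: U'_def)
          show "coeff (p - smult ?l s) j = 0" if "j \<in> X" for j
            using that p(2) s sx by (cases "j = x") auto
        qed
        then have ps: "p = smult ?l s" by simp
        then have "poly p t = ?l * poly s t" by (metis poly_smult)
        then have "?l = 0" using p(1) t(2) by (auto simp: U'_def)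
        then show False using ps \<open>p \<noteq> 0\<close> by auto
      qed
    qed
    then show False using t(1) gt by (simp add: c'_def)
  qed
qed

section \<open>The Veronese module and its Artinian reduction\<close>

lemma mdeg3: "Poly_Mapping.keys u \<subseteq> {0..2::nat} \<Longrightarrow> mdeg u = lk u 0 + lk u 1 + lk u 2"
  using mdeg_superset[of "{0..2}" u] by (simp add: numeral_2_eq_2)

lemma eq3:
  assumes "Poly_Mapping.keys u \<subseteq> {0..2::nat}" "Poly_Mapping.keys w \<subseteq> {0..2}"
    "lk u 0 = lk w 0" "lk u 1 = lk w 1" "lk u 2 = lk w 2"
  shows "u = w"
proof (rule poly_mapping_eqI)
  fix i show "lk u i = lk w i"
  proof (cases "i \<in> {0..2}")
    case True
    then have "i = 0 \<or> i = 1 \<or> i = 2" by auto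
    then show ?thesis using assms by auto
  next
    case False
    then have "lk u i = 0" "lk w i = 0" using assms(1,2) by (auto simp: in_keys_iff)
    then show ?thesis by simp
  qed
qed

text \<open>
  Kronecker substitution: the points \<open>(1, t, t\<^sup>M)\<close> separate forms of degree less than \<open>M\<close>, so the general
  points of Green's argument can be taken on this curve.
\<close>

definition kron :: "nat \<Rightarrow> (nat \<Rightarrow>\<^sub>0 nat) \<Rightarrow> nat" where
  "kron M u = lk u 1 + M * lk u 2"

text \<open>The exponents of \<open>x1\<close> and \<open>x2\<close> are digits in base
  \<open>M\<close>; the degree then determines the exponent of \<open>x0\<close>.\<close>

lemma kron_inj:
  assumes "Poly_Mapping.keys u \<subseteq> {0..2}" "Poly_Mapping.keys w \<subseteq> {0..2}" "mdeg u = mdeg w" "mdeg w < M"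
    "kron M u = kron M w"
  shows "u = w"
proof -
  have lt: "lk u 1 < M" "lk w 1 < M" using assms mdeg3 by fastforce+
  have "lk u 1 = kron M u mod M" "lk u 2 = kron M u div M" using lt by (simp_all add: kron_def)
  moreover have "lk w 1 = kron M w mod M" "lk w 2 = kron M w div M" using lt by (simp_all add: kron_def)
  ultimately have "lk u 1 = lk w 1" "lk u 2 = lk w 2" using assms(5) by simp_all
  then show ?thesis using assms mdeg3[OF assms(1)] mdeg3[OF assms(2)] by (intro eq3) auto
qed

text \<open>The restriction of a form to the curve \<open>(1, t, t^M)\<close>.\<close>

definition kron_poly :: "nat \<Rightarrow> (nat, 'k::comm_ring_1) mpoly \<Rightarrow> 'k poly" where
  "kron_poly M p = (\<Sum>u\<in>Poly_Mapping.keys p. monom (lk p u) (kron M u))"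

lemma kron_poly_superset:
  "finite S \<Longrightarrow> Poly_Mapping.keys p \<subseteq> S \<Longrightarrow> kron_poly M p = (\<Sum>u\<in>S. monom (lk p u) (kron M u))"
  unfolding kron_poly_def by (rule sum.mono_neutral_left) (auto simp: in_keys_iff)

lemma kron_poly_add: "kron_poly M (p + q) = kron_poly M p + kron_poly M q"
proof -
  let ?S = "Poly_Mapping.keys p \<union> Poly_Mapping.keys q"
  show ?thesis
    using kron_poly_superset[of ?S p M] kron_poly_superset[of ?S q M] kron_poly_superset[of ?S "p + q" M]
    by (simp add: Poly_Mapping.keys_add lookup_add flip: add_monom sum.distrib)
qed

lemma kron_poly_0 [simp]: "kron_poly M 0 = 0" by (simp add: kron_poly_def)

lemma kron_poly_minus: "kron_poly M (- p) = - kron_poly M p"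
  using kron_poly_add[of M p "- p"] by (simp add: eq_neg_iff_add_eq_0 add.commute)

lemma kron_poly_sum: "kron_poly M (sum f S) = (\<Sum>i\<in>S. kron_poly M (f i))"
  by (induction S rule: infinite_finite_induct) (simp_all add: kron_poly_add)

lemma kron_poly_sg: "kron_poly M (ksign v C p) = ksign v C (kron_poly M p)"
  by (simp add: ksign_def kron_poly_minus)

lemma kron_poly_mult: "kron_poly M (monomial w * p) = monom 1 (kron M w) * kron_poly M p"
proof -
  have "kron_poly M (monomial w * p) = (\<Sum>u\<in>(+) w ` Poly_Mapping.keys p. monom (lk (monomial w * p) u) (kron M u))"
  proof (rule kron_poly_superset)
    show "Poly_Mapping.keys (monomial w * p) \<subseteq> (+) w ` Poly_Mapping.keys p"
    proof
      fix u assume "u \<in> Poly_Mapping.keys (monomial w * p)"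
      then have "mdiv w u" "u - w \<in> Poly_Mapping.keys p" by (auto simp: in_keys_iff lookup_single_mult split: if_splits)
      then show "u \<in> (+) w ` Poly_Mapping.keys p" using mdiv_diff by (metis imageI)
    qed
  qed simp
  also have "\<dots> = (\<Sum>u\<in>Poly_Mapping.keys p. monom (lk p u) (kron M (w + u)))"
    by (subst sum.reindex) (auto simp: inj_on_def)
  also have "\<dots> = (\<Sum>u\<in>Poly_Mapping.keys p. monom 1 (kron M w) * monom (lk p u) (kron M u))"
    by (rule sum.cong) (auto simp: mult_monom kron_def lookup_add algebra_simps)
  finally show ?thesis by (simp add: kron_poly_def sum_distrib_left)
qed

lemma coeff_kron_poly:
  assumes "p \<in> forms {0..2} e" "Poly_Mapping.keys u \<subseteq> {0..2}" "int (mdeg u) = e" "mdeg u < M"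
  shows "coeff (kron_poly M p) (kron M u) = lk p u"
proof -
  have "coeff (kron_poly M p) (kron M u) = (\<Sum>w\<in>Poly_Mapping.keys p. if w = u then lk p u else 0)"
    unfolding kron_poly_def coeff_sum
  proof (rule sum.cong[OF refl])
    fix w assume "w \<in> Poly_Mapping.keys p"
    then have "Poly_Mapping.keys w \<subseteq> {0..2}" "int (mdeg w) = e" using assms(1) by (auto simp: forms_iff in_keys_iff)
    then have "kron M w = kron M u \<longleftrightarrow> w = u" using kron_inj[of w u M] assms by auto
    then show "coeff (monom (lk p w) (kron M w)) (kron M u) = (if w = u then lk p u else 0)" by auto
  qed
  also have "\<dots> = lk p u" by (auto simp: in_keys_iff)
  finally show ?thesis .
qed

lemma finite_veronese_vars: "finite (veronese_vars n d)"
  unfolding veronese_vars_def by (rule finite_monomials) simp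

text \<open>The univariate statement applies to the space \<open>U\<close> of polynomials supported
  on the images of the monomials of degree \<open>e\<close>. These images serve as detecting
  coordinates, at most as many as there are monomials.\<close>

lemma green_forms:
  fixes c :: "(nat \<Rightarrow>\<^sub>0 nat) set \<Rightarrow> (nat, 'k::field_char_0) mpoly"
  assumes c: "c \<in> chains (veronese_vars 2 d) (forms {0..2} (int e)) q"
    and q: "card (veronese_vars 2 e) \<le> q"
    and kdiff: "\<And>C. kdiff (veronese_vars 2 d) (mact (\<lambda>m. m)) c C = 0"
  shows "c A = 0"
proof -
  \<comment> \<open>Larger than both degrees, so that \<open>kron M\<close> is injective on the
    variables and on the monomials of the coefficients.\<close>
  define M where "M = d + e + 1"
  define W where "W = veronese_vars 2 e"
  define U :: "'k poly set" where "U = {p. \<forall>i. coeff p i \<noteq> 0 \<longrightarrow> i \<in> kron M ` W}"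
  have forms: "c B \<in> forms {0..2} (int e)" for B
    by (rule chains_mem[OF c]) (simp add: forms_iff)
  have kp: "kron_poly M p \<in> U" if "p \<in> forms {0..2} (int e)" for p :: "(nat, 'k) mpoly"
    unfolding U_def
  proof (intro CollectI allI impI)
    fix i assume "coeff (kron_poly M p) i \<noteq> 0"
    then obtain u where "u \<in> Poly_Mapping.keys p" "coeff (monom (lk p u) (kron M u)) i \<noteq> 0"
      unfolding kron_poly_def coeff_sum by (meson sum.neutral)
    then have "lk p u \<noteq> 0" "i = kron M u" by (auto split: if_splits)
    moreover from this have "u \<in> W" using that by (auto simp: W_def veronese_vars_def forms_iff)
    ultimately show "i \<in> kron M ` W" by blast
  qed
  have "kron_poly M (c A) = 0" for A
  proof (rule green_univariate)
    show "finite (veronese_vars 2 d)" by (rule finite_veronese_vars)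
    show "inj_on (kron M) (veronese_vars 2 d)"
      by (rule inj_onI, rule kron_inj[of _ _ M]) (auto simp: veronese_vars_def M_def)
    show "p - r \<in> U" if "p \<in> U" "r \<in> U" for p r using that unfolding U_def by (auto, metis diff_0_right)
    show "smult a p \<in> U" if "p \<in> U" for p a using that unfolding U_def by auto
    show "(\<lambda>A. kron_poly M (c A)) \<in> chains (veronese_vars 2 d) U q"
      by (rule chainsI) (use chainsD(2)[OF c] kp[OF forms] in auto)
    show "finite (kron M ` W)" unfolding W_def by (simp add: finite_veronese_vars)
    show "card (kron M ` W) \<le> q"
      using q card_image_le[OF finite_veronese_vars, of "kron M" 2 e] unfolding W_def by linarith
    show "p = 0" if p: "p \<in> U" "\<And>i. i \<in> kron M ` W \<Longrightarrow> coeff p i = 0" for p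
      by (rule poly_eqI) (use p in \<open>auto simp: U_def\<close>)
    show "kdiff (veronese_vars 2 d) (pact (kron M)) (\<lambda>A. kron_poly M (c A)) C = 0" for C
    proof -
      have "kdiff (veronese_vars 2 d) (pact (kron M)) (\<lambda>A. kron_poly M (c A)) C
          = kron_poly M (kdiff (veronese_vars 2 d) (mact (\<lambda>m. m)) c C)"
        unfolding kdiff_def kron_poly_sum by (rule sum.cong) (simp_all add: kron_poly_sg mact_def pact_def kron_poly_mult)
      then show ?thesis using kdiff by simp
    qed
  qed
  then have *: "kron_poly M (c A) = 0" .
  show "c A = 0"
  proof (rule poly_mapping_eqI)
    fix u show "lk (c A) u = lk 0 u"
    proof (rule ccontr)
      assume "lk (c A) u \<noteq> lk 0 u"
      then have u: "Poly_Mapping.keys u \<subseteq> {0..2}" "mdeg u = e" "lk (c A) u \<noteq> 0" using forms[of A] by (auto simp: forms_iff)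
      have "coeff (kron_poly M (c A)) (kron M u) = lk (c A) u"
        by (rule coeff_kron_poly[OF forms]) (use u in \<open>auto simp: M_def\<close>)
      then show False using * u(3) by simp
    qed
  qed
qed

lemma kexact_trivial:
  assumes "commuting_action a" "P t \<subseteq> I t" "0 \<in> I t" "0 \<in> P (t - 1)" "0 \<in> P t"
  shows "kexact V a P I n t"
  unfolding kexact_def
proof (intro ballI impI bexI)
  fix c assume "c \<in> chains V (P t) n"
  then show "\<forall>C. c C - kdiff V a (\<lambda>_. 0) C \<in> I t"
    using chains_mem[of c V "P t" n] assms commuting_action.kdiff_0[OF assms(1)] by auto
  show "(\<lambda>_. 0) \<in> chains V (P (t - 1)) (Suc n)" by (rule chainsI) (use assms in auto)
qed

lemma kexact_large:
  assumes "commuting_action a" "finite V" "card V < n" "0 \<in> I t" "0 \<in> P (t - 1)"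
  shows "kexact V a P I n t"
  unfolding kexact_def
proof (intro ballI impI bexI)
  fix c assume c: "c \<in> chains V (P t) n"
  have "c C = 0" for C
    using chainsD(2)[OF c, of C] card_mono[OF assms(2), of C] assms(3) by (metis not_le)
  then show "\<forall>C. c C - kdiff V a (\<lambda>_. 0) C \<in> I t"
    using assms commuting_action.kdiff_0[OF assms(1)] by auto
  show "(\<lambda>_. 0) \<in> chains V (P (t - 1)) (Suc n)" by (rule chainsI) (use assms in auto)
qed

section \<open>The Veronese ring in the easy degrees\<close>

definition pure_powers :: "nat \<Rightarrow> (nat \<Rightarrow>\<^sub>0 nat) set" where
  "pure_powers d = (\<lambda>i. Poly_Mapping.single i d) ` {0..2}"

locale veronese =
  fixes d :: nat
  assumes d2: "2 \<le> d"
begin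

abbreviation "V \<equiv> veronese_vars 2 d"
abbreviation "V' \<equiv> veronese_vars 2 d - pure_powers d"

sublocale R: monomial_action "veronese_vars 2 d" "\<lambda>m. m" "{0..2}" d 0
  by unfold_locales (auto simp: finite_veronese_vars, auto simp: veronese_vars_def)

text \<open>The canonical module, the direct sum of the \<open>H^0(O(k d - 3))\<close>, shifted so
  that \<open>t = 0\<close> holds the forms of degree \<open>d - 3\<close>.\<close>

sublocale W: monomial_action "veronese_vars 2 d" "\<lambda>m. m" "{0..2}" d "int d - 3"
  by unfold_locales (auto simp: finite_veronese_vars, auto simp: veronese_vars_def)

lemma pure_powers_subset: "pure_powers d \<subseteq> V"
  by (auto simp: pure_powers_def veronese_vars_def split: if_splits)

lemma pure_powers_disjoint:
  "z \<in> pure_powers d \<Longrightarrow> w \<in> pure_powers d \<Longrightarrow> z \<noteq> w \<Longrightarrow> Poly_Mapping.keys z \<inter> Poly_Mapping.keys w = {}"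
  by (auto simp: pure_powers_def split: if_splits)

lemma pure_powers_mdiv: "(\<exists>z\<in>pure_powers d. mdiv z u) \<longleftrightarrow> (\<exists>i\<in>{0..2}. d \<le> lk u i)"
  by (auto simp: pure_powers_def mdiv_def lookup_single when_def)

lemma mdeg_bounded:
  fixes u :: "nat \<Rightarrow>\<^sub>0 nat"
  assumes "Poly_Mapping.keys u \<subseteq> {0..2}" "\<And>i. i \<in> {0..2} \<Longrightarrow> lk u i < d"
  shows "mdeg u + 3 \<le> 3 * d"
  using mdeg3[OF assms(1)] assms(2)[of 0] assms(2)[of 1] assms(2)[of 2] by auto

lemmas R_reduce = R.kexact_reduce[OF pure_powers_subset pure_powers_disjoint]
lemmas W_reduce = W.kexact_reduce[OF pure_powers_subset pure_powers_disjoint]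

lemma finV': "finite V'" using R.finV by simp

abbreviation "I \<equiv> R.mI (pure_powers d)"

lemma mP_0 [simp]: "0 \<in> R.mP t" "0 \<in> W.mP t" "0 \<in> R.mI T t" "0 \<in> W.mI T t"
  by (simp_all add: R.mP_def W.mP_def R.mI_def W.mI_def forms_iff)

lemma I_eq: "I t = {p \<in> R.mP t. \<forall>u. lk p u \<noteq> 0 \<longrightarrow> (\<exists>i\<in>{0..2}. d \<le> lk u i)}"
  unfolding R.mI_def pure_powers_mdiv ..

text \<open>A monomial with all exponents below \<open>d\<close> has degree at most
  \<open>3 * d - 3\<close>. The assumption holds for every \<open>t \<ge> 3\<close>, and for
  \<open>d = 2\<close> also at \<open>t = 2\<close>.\<close>

lemma mP_subset_I:
  fixes t :: int
  assumes "t < 0 \<or> 3 * int d < 3 + t * int d"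
  shows "(R.mP t :: (nat, 'k::comm_ring_1) mpoly set) \<subseteq> I t"
proof
  fix p :: "(nat, 'k) mpoly" assume p: "p \<in> R.mP t"
  have "\<exists>i\<in>{0..2}. d \<le> lk u i" if "lk p u \<noteq> 0" for u
  proof (rule ccontr)
    assume "\<not> (\<exists>i\<in>{0..2}. d \<le> lk u i)"
    moreover have u: "Poly_Mapping.keys u \<subseteq> {0..2}" "int (mdeg u) = t * int d"
      using p that by (auto simp: R.mP_def forms_iff)
    ultimately have le: "mdeg u + 3 \<le> 3 * d" using mdeg_bounded by (meson not_le)
    have "0 \<le> t"
    proof (rule ccontr)
      assume "\<not> 0 \<le> t"
      then have "t * int d < 0" using d2 by (intro mult_neg_pos) auto
      then show False using u(2) by linarith
    qed
    then show False using assms le u(2) by linarith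
  qed
  then show "p \<in> I t" using p by (simp add: I_eq)
qed

lemma R_exact_outside:
  assumes "t < 0 \<or> 3 * int d < 3 + t * int d"
  shows "kexact V (mact (\<lambda>m. m)) (R.mP :: int \<Rightarrow> (nat, 'k::comm_ring_1) mpoly set) Z0 n t"
  by (rule R_reduce[THEN iffD2], assumption+, rule kexact_trivial[OF commuting_mact])
    (simp_all add: mP_subset_I[OF assms])

text \<open>The coefficients are constants, and the variables multiply them into distinct monomials
  outside the ideal; hence a cycle is already zero as a chain. In terms of Betti numbers, step
  \<open>n\<close> has nothing in degree \<open>n\<close>.\<close>

lemma R_exact_degree_0:
  assumes "1 \<le> n"
  shows "kexact V (mact (\<lambda>m. m)) (R.mP :: int \<Rightarrow> (nat, 'k::comm_ring_1) mpoly set) Z0 n 0"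
proof (rule R_reduce[THEN iffD2], assumption+)
  show "kexact V' (mact (\<lambda>m. m)) (R.mP :: int \<Rightarrow> (nat, 'k) mpoly set) I n 0"
    unfolding kexact_def
  proof (intro ballI impI bexI)
    fix c :: "(nat \<Rightarrow>\<^sub>0 nat) set \<Rightarrow> (nat, 'k) mpoly"
    assume c: "c \<in> chains V' (R.mP 0) n" and kc: "\<forall>C. kdiff V' (mact (\<lambda>m. m)) c C \<in> I (0 + 1)"
    have const: "u = 0" if "lk (c A) u \<noteq> 0" for A u
      using chains_mem[OF c mP_0(1), of A] that by (simp add: R.mP_def forms_iff mdeg_eq_0_iff)
    have "c A = 0" for A
    proof (cases "A \<subseteq> V' \<and> card A = n")
      case True
      then obtain v where v: "v \<in> A" using assms by fastforce
      define C where "C = A - {v}"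
      have vC: "v \<in> V' - C" "insert v C = A" "v \<in> V'" using v True by (auto simp: C_def)
      \<comment> \<open>The monomial \<open>v\<close> can come only from the term of the variable
        \<open>v\<close>, since all coefficients are constants.\<close>
      have "lk (kdiff V' (mact (\<lambda>m. m)) c C) v = (\<Sum>w\<in>V' - C. if w = v then ksign v C (lk (c A) 0) else 0)"
        unfolding kdiff_def lookup_sum
      proof (rule sum.cong[OF refl])
        fix w assume w: "w \<in> V' - C"
        have "lk (ksign w C (mact (\<lambda>m. m) w (c (insert w C)))) v = ksign w C (lk (mact (\<lambda>m. m) w (c (insert w C))) v)"
          by (simp add: ksign_def)
        also have "lk (mact (\<lambda>m. m) w (c (insert w C))) v = (if w = v then lk (c A) 0 else 0)"
        proof (cases "w = v")
          case True
          then show ?thesis using vC by (simp add: mact_def lookup_single_mult mdiv_def)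
        next
          case False
          have "lk (c (insert w C)) (v - w) = 0" if "mdiv w v"
            using const[of "insert w C" "v - w"] mdiv_diff[OF that] False by fastforce
          then show ?thesis using False by (simp add: mact_def lookup_single_mult)
        qed
        finally show "lk (ksign w C (mact (\<lambda>m. m) w (c (insert w C)))) v = (if w = v then ksign v C (lk (c A) 0) else 0)"
          by simp
      qed
      also have "\<dots> = ksign v C (lk (c A) 0)" using vC finV' by simp
      finally have eq: "lk (kdiff V' (mact (\<lambda>m. m)) c C) v = ksign v C (lk (c A) 0)" .
      \<comment> \<open>Among monomials of equal degree divisibility is equality, so the ideal does
        not hide the coefficient at \<open>v\<close>.\<close>
      have "\<not> (\<exists>z\<in>pure_powers d. mdiv z v)"
      proof
        assume "\<exists>z\<in>pure_powers d. mdiv z v"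
        then obtain z where z: "z \<in> pure_powers d" "mdiv z v" by blast
        then have "mdeg z = d" "mdeg v = d" using vC pure_powers_subset by (auto simp: veronese_vars_def)
        then have "v - z = 0" using mdeg_diff[OF z(2)] by (simp add: mdeg_eq_0_iff)
        then have "v = z" using mdiv_diff[OF z(2)] by simp
        then show False using vC z by blast
      qed
      then have "lk (kdiff V' (mact (\<lambda>m. m)) c C) v = 0" using kc unfolding R.mI_def by blast
      then have "lk (c A) 0 = 0" using eq by simp
      then show ?thesis using const by (metis lookup_zero poly_mapping_eqI)
    qed (use chainsD(2)[OF c] in blast)
    then show "\<forall>C. c C - kdiff V' (mact (\<lambda>m. m)) (\<lambda>_. 0) C \<in> I 0"
      by (simp add: commuting_action.kdiff_0[OF commuting_mact])
    show "(\<lambda>_. 0) \<in> chains V' (R.mP (0 - 1)) (Suc n)" by (rule chainsI) simp_all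
  qed
qed

text \<open>A form of degree \<open>d\<close> is a combination of the monomials in \<open>V\<close>:
  those in \<open>V'\<close> are variables applied to constants, and the pure powers lie in the
  ideal.\<close>

lemma R_exact_generators:
  "kexact V (mact (\<lambda>m. m)) (R.mP :: int \<Rightarrow> (nat, 'k::comm_ring_1) mpoly set) Z0 0 1"
proof (rule R_reduce[THEN iffD2], assumption+)
  show "kexact V' (mact (\<lambda>m. m)) (R.mP :: int \<Rightarrow> (nat, 'k) mpoly set) I 0 1"
    unfolding kexact_def
  proof (intro ballI impI)
    fix c :: "(nat \<Rightarrow>\<^sub>0 nat) set \<Rightarrow> (nat, 'k) mpoly"
    assume c: "c \<in> chains V' (R.mP 1) 0"
    define b :: "(nat \<Rightarrow>\<^sub>0 nat) set \<Rightarrow> (nat, 'k) mpoly" where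
      "b A = (if A \<subseteq> V' \<and> card A = 1 then Poly_Mapping.single 0 (lk (c {}) (THE v. A = {v})) else 0)" for A
    have b: "b \<in> chains V' (R.mP (1 - 1)) (Suc 0)"
      by (rule chainsI) (auto simp: b_def R.mP_def forms_iff lookup_single when_def split: if_splits)
    have bv: "b {v} = Poly_Mapping.single 0 (lk (c {}) v)" if "v \<in> V'" for v
      using that by (simp add: b_def)
    have "kdiff V' (mact (\<lambda>m. m)) b {} = (\<Sum>v\<in>V'. Poly_Mapping.single v (lk (c {}) v))"
      unfolding kdiff_def by (rule sum.cong) (simp_all add: bv ksign_def mact_def mult_single)
    then have kb: "lk (kdiff V' (mact (\<lambda>m. m)) b {}) u = (if u \<in> V' then lk (c {}) u else 0)" for u
      using finV' by (simp add: lookup_sum lookup_single when_def)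
    have c0: "c {} \<in> R.mP 1" using chains_mem[OF c] by simp
    have "c C - kdiff V' (mact (\<lambda>m. m)) b C \<in> I 1" for C
    proof (cases "C = {}")
      case True
      have "lk (c {}) u \<noteq> 0 \<and> u \<in> pure_powers d" if "lk (c {} - kdiff V' (mact (\<lambda>m. m)) b {}) u \<noteq> 0" for u
      proof -
        have "lk (c {}) u \<noteq> 0" "u \<notin> V'" using that by (simp_all add: lookup_minus kb split: if_splits)
        moreover from this(1) have "u \<in> V" using c0 by (auto simp: R.mP_def forms_iff veronese_vars_def)
        ultimately show ?thesis by blast
      qed
      then show ?thesis using c0 unfolding True R.mI_def R.mP_def forms_iff by (auto simp: mdiv_def)
    next
      case False
      then have "\<not> (C \<subseteq> V' \<and> card C = 0)" using finite_subset[OF _ finV', of C] by (metis card_eq_0_iff)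
      then have "c C = 0" "kdiff V' (mact (\<lambda>m. m)) b C = 0"
        using chainsD(2)[OF c, of C] commuting_action.kdiff_outside[OF commuting_mact finV' b, of C] by simp_all
      then show ?thesis by simp
    qed
    then show "\<exists>b\<in>chains V' (R.mP (1 - 1)) (Suc 0). \<forall>C. c C - kdiff V' (mact (\<lambda>m. m)) b C \<in> I 1"
      using b by blast
  qed
qed

end

section \<open>Duality for the Artinian reduction\<close>

text \<open>Elimination of one coordinate at a time. With a pivot \<open>g0\<close> at
  \<open>z\<close>, the members of \<open>S\<close> vanishing at \<open>z\<close> and the
  correspondingly corrected \<open>f\<close> fall under the induction hypothesis; the value of the
  functional at \<open>z\<close> is then chosen so that it kills \<open>g0\<close>.\<close>

lemma separating_functional:
  fixes S :: "('y \<Rightarrow> 'k::field) set"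
  assumes "finite Y" "S \<noteq> {}" "\<And>g h a. g \<in> S \<Longrightarrow> h \<in> S \<Longrightarrow> (\<lambda>y. g y + a * h y) \<in> S"
  shows "(\<exists>g\<in>S. \<forall>y\<in>Y. g y = f y) \<or> (\<exists>\<phi>. (\<forall>g\<in>S. (\<Sum>y\<in>Y. \<phi> y * g y) = 0) \<and> (\<Sum>y\<in>Y. \<phi> y * f y) \<noteq> 0)"
  using assms
proof (induction Y arbitrary: S f rule: finite_induct)
  case empty
  then show ?case by blast
next
  case (insert z Y)
  have eq: "(\<Sum>y\<in>Y. (if y = z then a else \<phi> y) * g y) = (\<Sum>y\<in>Y. \<phi> y * g y)" for a :: 'k and \<phi> g
    by (rule sum.cong) (use insert.hyps in auto)
  show ?case
  proof (cases "\<exists>g0\<in>S. g0 z \<noteq> 0")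
    case False
    show ?thesis
    proof (cases "f z = 0")
      case True
      have "(\<exists>g\<in>S. \<forall>y\<in>Y. g y = f y) \<or> (\<exists>\<phi>. (\<forall>g\<in>S. (\<Sum>y\<in>Y. \<phi> y * g y) = 0) \<and> (\<Sum>y\<in>Y. \<phi> y * f y) \<noteq> 0)"
        by (rule insert.IH[OF insert.prems])
      then show ?thesis
      proof
        assume "\<exists>g\<in>S. \<forall>y\<in>Y. g y = f y"
        then show ?thesis using False True by auto
      next
        assume "\<exists>\<phi>. (\<forall>g\<in>S. (\<Sum>y\<in>Y. \<phi> y * g y) = 0) \<and> (\<Sum>y\<in>Y. \<phi> y * f y) \<noteq> 0"
        then obtain \<phi> where "\<forall>g\<in>S. (\<Sum>y\<in>Y. \<phi> y * g y) = 0" "(\<Sum>y\<in>Y. \<phi> y * f y) \<noteq> 0" by blast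
        then show ?thesis using insert.hyps False True by (intro disjI2 exI[of _ \<phi>]) auto
      qed
    next
      case fz: False
      have 0: "(\<Sum>y\<in>Y. (if y = z then 1 else 0) * g y) = 0" for g :: "'y \<Rightarrow> 'k"
        by (rule sum.neutral) (use insert.hyps in auto)
      show ?thesis
        by (rule disjI2, rule exI[of _ "\<lambda>y. if y = z then 1 else 0"]) (use insert.hyps fz False 0 in auto)
    qed
  next
    case True
    then obtain g0 where g0: "g0 \<in> S" "g0 z \<noteq> 0" by blast
    define S' where "S' = {g \<in> S. g z = 0}"
    define f' where "f' y = f y - (f z / g0 z) * g0 y" for y
    have proj: "(\<lambda>y. g y - (g z / g0 z) * g0 y) \<in> S'" if "g \<in> S" for g
      using insert.prems(2)[OF that g0(1), of "- (g z / g0 z)"] g0(2) by (simp add: S'_def)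
    have "(\<exists>g\<in>S'. \<forall>y\<in>Y. g y = f' y) \<or> (\<exists>\<phi>. (\<forall>g\<in>S'. (\<Sum>y\<in>Y. \<phi> y * g y) = 0) \<and> (\<Sum>y\<in>Y. \<phi> y * f' y) \<noteq> 0)"
    proof (rule insert.IH)
      show "S' \<noteq> {}" using proj[OF g0(1)] by blast
      show "(\<lambda>y. g y + a * h y) \<in> S'" if "g \<in> S'" "h \<in> S'" for g h a
        using that insert.prems(2) by (auto simp: S'_def)
    qed
    then show ?thesis
    proof
      assume "\<exists>g\<in>S'. \<forall>y\<in>Y. g y = f' y"
      then obtain g where g: "g \<in> S'" "\<And>y. y \<in> Y \<Longrightarrow> g y = f' y" by blast
      have "(\<lambda>y. g y + (f z / g0 z) * g0 y) \<in> S" by (rule insert.prems(2)) (use g(1) g0(1) in \<open>simp_all add: S'_def\<close>)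
      moreover have "\<forall>y\<in>insert z Y. g y + (f z / g0 z) * g0 y = f y"
        using g g0(2) by (auto simp: S'_def f'_def)
      ultimately show ?thesis by (intro disjI1 bexI)
    next
      assume "\<exists>\<phi>. (\<forall>g\<in>S'. (\<Sum>y\<in>Y. \<phi> y * g y) = 0) \<and> (\<Sum>y\<in>Y. \<phi> y * f' y) \<noteq> 0"
      then obtain \<phi> where \<phi>: "\<And>g. g \<in> S' \<Longrightarrow> (\<Sum>y\<in>Y. \<phi> y * g y) = 0" "(\<Sum>y\<in>Y. \<phi> y * f' y) \<noteq> 0" by blast
      let ?s = "\<Sum>y\<in>Y. \<phi> y * g0 y"
      let ?\<psi> = "\<lambda>y. if y = z then - ?s / g0 z else \<phi> y"
      have split: "(\<Sum>y\<in>Y. \<phi> y * (g y - r * g0 y)) = (\<Sum>y\<in>Y. \<phi> y * g y) - r * ?s" for g r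
        by (simp add: algebra_simps sum_subtractf sum_distrib_left)
      have tot: "(\<Sum>y\<in>insert z Y. ?\<psi> y * g y) = (\<Sum>y\<in>Y. \<phi> y * g y) - (g z / g0 z) * ?s" for g
        using insert.hyps eq[of "- ?s / g0 z" \<phi> g] by (simp add: field_simps)
      have "(\<Sum>y\<in>insert z Y. ?\<psi> y * g y) = 0" if "g \<in> S" for g
        using \<phi>(1)[OF proj[OF that]] unfolding tot split .
      moreover have "(\<Sum>y\<in>insert z Y. ?\<psi> y * f y) \<noteq> 0"
        using \<phi>(2) unfolding tot f'_def split .
      ultimately show ?thesis by (intro disjI2 exI[of _ ?\<psi>] conjI ballI)
    qed
  qed
qed

section \<open>Signs and monomials under complements\<close>

lemma ksign_one_square [simp]: "ksign v C 1 * ksign v C 1 = (1 :: 'k::ring_1)"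
  by (simp add: ksign_def)

lemma ksign_union:
  assumes "finite A" "finite B" "A \<inter> B = {}"
  shows "ksign v (A \<union> B) (1::'k::ring_1) = ksign v A 1 * ksign v B 1"
proof -
  have "{u \<in> A \<union> B. u < v} = {u \<in> A. u < v} \<union> {u \<in> B. u < v}" by auto
  then have "card {u \<in> A \<union> B. u < v} = card {u \<in> A. u < v} + card {u \<in> B. u < v}"
    using assms by (simp add: card_Un_disjoint disjoint_iff)
  then show ?thesis by (simp add: ksign_def)
qed

lemma ksign_Diff_self: "ksign v (A - {v}) x = ksign v A x"
proof -
  have "{u \<in> A - {v}. u < v} = {u \<in> A. u < v}" by auto
  then show ?thesis by (simp add: ksign_def)
qed

text \<open>These monomials are a basis of the polynomial ring modulo the three
  \<open>x_i^d\<close>.\<close>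

definition bounded_monomial :: "nat \<Rightarrow> (nat \<Rightarrow>\<^sub>0 nat) \<Rightarrow> bool" where
  "bounded_monomial d u \<longleftrightarrow> Poly_Mapping.keys u \<subseteq> {0..2} \<and> (\<forall>i\<in>{0..2}. lk u i < d)"

text \<open>\<open>box 1\<close> is \<open>x0 x1 x2\<close>, and \<open>box (d - 1)\<close> is the
  socle monomial of the quotient by the \<open>x_i^d\<close>.\<close>

definition box :: "nat \<Rightarrow> (nat \<Rightarrow>\<^sub>0 nat)" where
  "box k = Poly_Mapping.single 0 k + Poly_Mapping.single 1 k + Poly_Mapping.single 2 k"

lemma lookup_box: "lk (box k) i = (if i \<in> {0..2} then k else 0)"
  by (auto simp: box_def lookup_add lookup_single when_def)

lemma mdeg_box [simp]: "mdeg (box k) = 3 * k"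
  by (simp add: box_def)

lemma keys_box: "Poly_Mapping.keys (box k) \<subseteq> {0..2}"
  by (auto simp: in_keys_iff lookup_box split: if_splits)

lemma keys_minus_subset: "Poly_Mapping.keys (u - w) \<subseteq> Poly_Mapping.keys (u :: 'x \<Rightarrow>\<^sub>0 nat)"
  by (auto simp: in_keys_iff lookup_minus)

text \<open>As divisors of the socle monomial, the basis monomials are permuted by
  \<open>u \<mapsto> soc - u\<close>, which is the source of the duality.\<close>

lemma bounded_iff_mdiv:
  assumes "1 \<le> d"
  shows "bounded_monomial d u \<longleftrightarrow> mdiv u (box (d - 1))"
proof
  assume b: "bounded_monomial d u"
  show "mdiv u (box (d - 1))" unfolding mdiv_def
  proof
    fix i show "lk u i \<le> lk (box (d - 1)) i"
    proof (cases "i \<in> {0..2}")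
      case True
      then show ?thesis using b unfolding bounded_monomial_def lookup_box by fastforce
    next
      case False
      then have "i \<notin> Poly_Mapping.keys u" using b unfolding bounded_monomial_def by blast
      then show ?thesis by (simp add: in_keys_iff)
    qed
  qed
next
  assume "mdiv u (box (d - 1))"
  then have le: "lk u i \<le> (if i \<in> {0..2} then d - 1 else 0)" for i unfolding mdiv_def lookup_box by blast
  have "i \<in> {0..2}" if "i \<in> Poly_Mapping.keys u" for i using le[of i] that by (auto simp: in_keys_iff split: if_splits)
  moreover have "lk u i < d" if "i \<in> {0..2}" for i using le[of i] that assms by auto
  ultimately show "bounded_monomial d u" unfolding bounded_monomial_def by blast
qed

lemma lookup_le_mdeg: "lk u i \<le> mdeg u"
  unfolding mdeg_def by (cases "i \<in> Poly_Mapping.keys u") (auto simp: in_keys_iff intro: member_le_sum)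

lemma mdiv_diff_diff: "mdiv u w \<Longrightarrow> w - (w - u) = u"
  by (rule poly_mapping_eqI) (simp add: mdiv_def lookup_minus)

lemma mdiv_minus [simp]: "mdiv (w - u) w"
  by (simp add: mdiv_def lookup_minus)

locale veronese3 = veronese +
  assumes d3: "3 \<le> d"
begin

abbreviation "W0 \<equiv> veronese_vars 2 (d - 3)"
abbreviation "soc \<equiv> box (d - 1)"

text \<open>No exponent of a monomial of degree \<open>d - 3\<close> exceeds \<open>d - 1\<close>,
  so all of \<open>W0\<close> takes part in the pairing with degree \<open>2 * d\<close>.\<close>

lemma W0_dvd_soc: "e \<in> W0 \<Longrightarrow> mdiv e soc"
  using d3 by (subst bounded_iff_mdiv[symmetric])
    (auto simp: veronese_vars_def bounded_monomial_def, metis diff_less le_eq_less_or_eq lookup_le_mdeg le_trans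
      less_le_trans not_less zero_less_numeral)

lemma mdeg_soc: "mdeg soc = 3 * d - 3"
  by (simp add: diff_mult_distrib2)

lemma mdeg_compl: "mdiv u soc \<Longrightarrow> mdeg (soc - u) = 3 * d - 3 - mdeg u"
  using mdeg_diff[of u soc] mdeg_soc by simp

lemma I_bounded: "p \<in> I t \<longleftrightarrow> p \<in> R.mP t \<and> (\<forall>u. lk p u \<noteq> 0 \<longrightarrow> \<not> bounded_monomial d u)"
proof -
  have "Poly_Mapping.keys u \<subseteq> {0..2}" if "p \<in> R.mP t" "lk p u \<noteq> 0" for u
    using that by (auto simp: R.mP_def forms_iff)
  then show ?thesis unfolding I_eq bounded_monomial_def mem_Collect_eq using not_le by blast
qed

section \<open>Lattice points of the triangle of exponents\<close>

abbreviation "c0 \<equiv> box 1"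
abbreviation "cW \<equiv> (+) c0 ` W0"

text \<open>\<open>cW\<close> consists of the degree \<open>d\<close> monomials divisible by
  \<open>x0 x1 x2\<close>, the interior points of the triangle, so none is a vertex.\<close>

lemma cW_subset: "cW \<subseteq> V'"
proof
  fix u assume "u \<in> cW"
  then obtain e where e: "u = c0 + e" "e \<in> W0" by blast
  have "u \<in> V" using e d3 keys_box[of 1] by (auto simp: veronese_vars_def keys_add_nat)
  moreover have "u \<notin> pure_powers d"
  proof
    assume "u \<in> pure_powers d"
    then obtain i where i: "i \<in> {0..2}" "u = Poly_Mapping.single i d" by (auto simp: pure_powers_def)
    have "lk u j \<noteq> 0" if "j \<in> {0..2}" for j using that by (simp add: e lookup_add lookup_box)
    from this[of 0] this[of 1] show False unfolding i(2) by (simp add: lookup_single when_def split: if_splits)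
  qed
  ultimately show "u \<in> V'" by blast
qed

lemma card_cW: "card cW = card W0"
  by (rule card_image) (simp add: inj_on_def)

text \<open>The points on the side joining the vertices \<open>i\<close> and \<open>j\<close>; the
  range \<open>1 \<le> k < d\<close> leaves out both ends.\<close>

definition edge :: "nat \<Rightarrow> nat \<Rightarrow> nat \<Rightarrow> (nat \<Rightarrow>\<^sub>0 nat)" where
  "edge i j k = Poly_Mapping.single i k + Poly_Mapping.single j (d - k)"

text \<open>A monomial that \<open>x0 x1 x2\<close> does not divide misses a variable and lies on a
  side; not being a pure power, it is no end of that side.\<close>

lemma boundary_eq: "V' - cW = edge 0 1 ` {1..<d} \<union> edge 0 2 ` {1..<d} \<union> edge 1 2 ` {1..<d}"
proof (intro set_eqI iffI)
  fix u assume u: "u \<in> V' - cW"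
  then have k: "Poly_Mapping.keys u \<subseteq> {0..2}" and dg: "lk u 0 + lk u 1 + lk u 2 = d"
    using mdeg3[of u] by (auto simp: veronese_vars_def)
  have out: "lk u i = 0" if "i \<notin> {0..2}" for i :: nat using k that by (auto simp: in_keys_iff)
  have "\<not> mdiv c0 u"
  proof
    assume m: "mdiv c0 u"
    then have "u - c0 \<in> W0"
      using u mdeg_diff[OF m] keys_minus_subset[of u c0] by (auto simp: veronese_vars_def)
    then show False using u mdiv_diff[OF m] by (metis DiffD2 imageI)
  qed
  then obtain i where "\<not> lk c0 i \<le> lk u i" unfolding mdiv_def by blast
  then have i: "i \<in> {0..2}" "lk u i = 0" by (auto simp: lookup_box split: if_splits)
  have npure: "u \<noteq> Poly_Mapping.single j d" if "j \<in> {0..2}" for j using u that by (auto simp: pure_powers_def)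
  have E: "u \<in> edge a b ` {1..<d}"
    if "lk u a + lk u b = d" "lk u a \<noteq> 0" "lk u b \<noteq> 0" "a \<noteq> b" "\<And>j. j \<noteq> a \<Longrightarrow> j \<noteq> b \<Longrightarrow> lk u j = 0" for a b
  proof
    show "u = edge a b (lk u a)"
      by (rule poly_mapping_eqI) (use that in \<open>auto simp: edge_def lookup_add lookup_single when_def\<close>)
    show "lk u a \<in> {1..<d}" using that by auto
  qed
  have S: "lk u a \<noteq> d" if "a \<in> {0..2}" for a :: nat
  proof
    assume a: "lk u a = d"
    have "u = Poly_Mapping.single a d"
    proof (rule poly_mapping_eqI)
      fix j :: nat have "a = 0 \<or> a = 1 \<or> a = 2" "j = 0 \<or> j = 1 \<or> j = 2 \<or> j \<notin> {0..2}" using that by auto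
      then show "lk u j = lk (Poly_Mapping.single a d) j"
        using a dg out[of j] that by (auto simp: lookup_single when_def)
    qed
    then show False using npure that by blast
  qed
  have S3: "lk u 0 \<noteq> d" "lk u 1 \<noteq> d" "lk u 2 \<noteq> d" using S by simp_all
  have "i = 0 \<or> i = 1 \<or> i = 2" using i by auto
  then show "u \<in> edge 0 1 ` {1..<d} \<union> edge 0 2 ` {1..<d} \<union> edge 1 2 ` {1..<d}"
  proof (elim disjE)
    assume i0: "i = 0"
    have "u \<in> edge 1 2 ` {1..<d}"
    proof (rule E)
      fix j assume "j \<noteq> 1" "j \<noteq> (2::nat)"
      then have "j = 0 \<or> j \<notin> {0..2}" by auto
      then show "lk u j = 0" using i i0 out by auto
    qed (use i i0 dg S3 in auto)
    then show ?thesis by blast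
  next
    assume i0: "i = 1"
    have "u \<in> edge 0 2 ` {1..<d}"
    proof (rule E)
      fix j assume "j \<noteq> 0" "j \<noteq> (2::nat)"
      then have "j = 1 \<or> j \<notin> {0..2}" by auto
      then show "lk u j = 0" using i i0 out by auto
    qed (use i i0 dg S3 in auto)
    then show ?thesis by blast
  next
    assume i0: "i = 2"
    have "u \<in> edge 0 1 ` {1..<d}"
    proof (rule E)
      fix j assume "j \<noteq> 0" "j \<noteq> (1::nat)"
      then have "j = 2 \<or> j \<notin> {0..2}" by auto
      then show "lk u j = 0" using i i0 out by auto
    qed (use i i0 dg S3 in auto)
    then show ?thesis by blast
  qed
next
  have E: "u \<in> V' - cW" if u: "u \<in> edge i j ` {1..<d}" and ij: "i \<in> {0..2}" "j \<in> {0..2}" "i \<noteq> j"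
    and l: "l \<in> {0..2}" "l \<noteq> i" "l \<noteq> j" for u i j l
  proof -
    obtain k where k: "u = edge i j k" "1 \<le> k" "k < d" using u by auto
    have "u \<in> V" using ij k by (auto simp: veronese_vars_def edge_def keys_add_nat split: if_splits)
    moreover have "u \<notin> pure_powers d"
    proof
      assume "u \<in> pure_powers d"
      then obtain m where "u = Poly_Mapping.single m d" by (auto simp: pure_powers_def)
      then have "lk u i = 0 \<or> lk u i = d" by (simp add: lookup_single when_def)
      then show False using k ij by (auto simp: edge_def lookup_add lookup_single when_def)
    qed
    moreover have "u \<notin> cW"
    proof
      assume "u \<in> cW"
      then have "lk u l \<noteq> 0" using l by (auto simp: lookup_add lookup_box)
      then show False using k l by (auto simp: edge_def lookup_add lookup_single when_def)
    qed
    ultimately show ?thesis by blast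
  qed
  fix u assume "u \<in> edge 0 1 ` {1..<d} \<union> edge 0 2 ` {1..<d} \<union> edge 1 2 ` {1..<d}"
  then show "u \<in> V' - cW" using E[of u 0 1 2] E[of u 0 2 1] E[of u 1 2 0] by auto
qed

text \<open>Each side has \<open>d - 1\<close> points apart from its ends, and two sides meet only
  in a vertex. This is the origin of the bound in the theorem.\<close>

lemma card_boundary: "card (V' - cW) = 3 * d - 3"
proof -
  have inj: "inj_on (edge i j) {1..<d}" if "i \<noteq> j" for i j
  proof (rule inj_onI)
    fix k l assume "edge i j k = edge i j l"
    then have "lk (edge i j k) i = lk (edge i j l) i" by simp
    then show "k = l" using that by (simp add: edge_def lookup_add lookup_single when_def)
  qed
  have c: "card (edge i j ` {1..<d}) = d - 1" if "i \<noteq> j" for i j using card_image[OF inj[OF that]] by simp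
  have nz: "lk u l = 0 \<longleftrightarrow> l \<noteq> i \<and> l \<noteq> j" if "u \<in> edge i j ` {1..<d}" "i \<noteq> j" for u i j l
    using that by (auto simp: edge_def lookup_add lookup_single when_def split: if_splits)
  have d1: "edge 0 1 ` {1..<d} \<inter> edge 0 2 ` {1..<d} = {}"
  proof (rule equals0I)
    fix u assume u: "u \<in> edge 0 1 ` {1..<d} \<inter> edge 0 2 ` {1..<d}"
    show False using nz[OF IntD1[OF u], of 1] nz[OF IntD2[OF u], of 1] by simp
  qed
  have d2: "(edge 0 1 ` {1..<d} \<union> edge 0 2 ` {1..<d}) \<inter> edge 1 2 ` {1..<d} = {}"
  proof (rule equals0I)
    fix u assume u: "u \<in> (edge 0 1 ` {1..<d} \<union> edge 0 2 ` {1..<d}) \<inter> edge 1 2 ` {1..<d}"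
    have "lk u 0 = 0" using nz[OF IntD2[OF u], of 0] by simp
    moreover have "lk u 0 \<noteq> 0" using IntD1[OF u]
    proof
      assume "u \<in> edge 0 1 ` {1..<d}" then show ?thesis using nz[of u 0 1 0] by (metis zero_neq_one)
    next
      assume "u \<in> edge 0 2 ` {1..<d}" then show ?thesis using nz[of u 0 2 0] by (metis zero_neq_numeral)
    qed
    ultimately show False by blast
  qed
  have "card (V' - cW) = card (edge 0 1 ` {1..<d} \<union> edge 0 2 ` {1..<d}) + card (edge 1 2 ` {1..<d})"
    unfolding boundary_eq by (rule card_Un_disjoint[OF _ _ d2]) simp_all
  also have "card (edge 0 1 ` {1..<d} \<union> edge 0 2 ` {1..<d}) = card (edge 0 1 ` {1..<d}) + card (edge 0 2 ` {1..<d})"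
    by (rule card_Un_disjoint[OF _ _ d1]) simp_all
  finally show ?thesis using c[of 0 1] c[of 0 2] c[of 1 2] d3 by simp
qed

lemma card_V': "card V' = card W0 + (3 * d - 3)"
  using card_boundary card_cW card_Diff_subset[OF _ cW_subset] card_mono[OF finV' cW_subset] finite_veronese_vars by simp

end

section \<open>Coefficient degree two\<close>

context veronese3
begin

lemma W0_mem_forms: "e \<in> W0 \<longleftrightarrow> Poly_Mapping.keys e \<subseteq> {0..2} \<and> int (mdeg e) = int d - 3"
  using d3 by (auto simp: veronese_vars_def)

lemma compl_bounded:
  assumes "mdiv u soc"
  shows "bounded_monomial d (soc - u)"
  using d3 by (subst bounded_iff_mdiv) auto

text \<open>Green's argument needs all of \<open>V\<close>, where elements can be evaluated at
  points; \<open>W_reduce\<close> carries its result down to \<open>V'\<close>.\<close>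

lemma W_exact:
  assumes "card W0 \<le> q"
  shows "kexact V' (mact (\<lambda>m. m)) (W.mP :: int \<Rightarrow> (nat, 'k::field_char_0) mpoly set) (W.mI (pure_powers d)) q 0"
proof (rule W_reduce[THEN iffD1], assumption+)
  have e: "W.mP 0 = (forms {0..2} (int (d - 3)) :: (nat, 'k) mpoly set)"
    using d3 by (simp add: W.mP_def of_nat_diff)
  show "kexact V (mact (\<lambda>m. m)) (W.mP :: int \<Rightarrow> (nat, 'k) mpoly set) Z0 q 0"
    unfolding kexact_def
  proof (intro ballI impI bexI)
    fix c :: "(nat \<Rightarrow>\<^sub>0 nat) set \<Rightarrow> (nat, 'k) mpoly"
    assume c: "c \<in> chains V (W.mP 0) q" "\<forall>C. kdiff V (mact (\<lambda>m. m)) c C \<in> {0}"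
    have "c A = 0" for A by (rule green_forms) (use c assms in \<open>auto simp: e\<close>)
    then show "\<forall>C. c C - kdiff V (mact (\<lambda>m. m)) (\<lambda>_. 0) C \<in> {0}"
      by (simp add: commuting_action.kdiff_0[OF commuting_mact])
    show "(\<lambda>_. 0) \<in> chains V (W.mP (0 - 1)) (Suc q)" by (rule chainsI) simp_all
  qed
qed

text \<open>At \<open>t = 0\<close> exactness means that there are no cycles: the incoming
  coefficients would have degree \<open>-3\<close>, and the ideal of the \<open>x_i^d\<close>
  contains no nonzero form of degree \<open>d - 3\<close>.\<close>

lemma W_cycle_0:
  fixes \<psi> :: "(nat \<Rightarrow>\<^sub>0 nat) set \<Rightarrow> (nat, 'k::field_char_0) mpoly"
  assumes q: "card W0 \<le> q" and \<psi>: "\<psi> \<in> chains V' (W.mP 0) q"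
    and kdiff: "\<And>C. kdiff V' (mact (\<lambda>m. m)) \<psi> C \<in> W.mI (pure_powers d) 1"
  shows "\<psi> D = 0"
proof -
  obtain b where b: "b \<in> chains V' (W.mP (- 1)) (Suc q)" and eq: "\<And>C. \<psi> C - kdiff V' (mact (\<lambda>m. m)) b C \<in> W.mI (pure_powers d) 0"
    using W_exact[OF q, where 'k = 'k] \<psi> kdiff unfolding kexact_def by force
  have "b C = 0" for C
  proof (rule poly_mapping_eqI)
    fix u have "b C \<in> W.mP (- 1)" by (rule chains_mem[OF b]) simp
    then show "lk (b C) u = lk 0 u" by (auto simp: W.mP_def forms_iff)
  qed
  then have b0: "b = (\<lambda>_. 0)" by blast
  have "\<psi> D \<in> W.mI (pure_powers d) 0" using eq[of D] unfolding b0 by (simp add: commuting_action.kdiff_0[OF commuting_mact])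
  then have *: "lk (\<psi> D) u \<noteq> 0 \<Longrightarrow> int (mdeg u) = int d - 3 \<and> (\<exists>i\<in>{0..2}. d \<le> lk u i)" for u
    unfolding W.mI_def pure_powers_mdiv W.mP_def forms_iff by auto
  show ?thesis
  proof (rule poly_mapping_eqI)
    fix u
    have False if nz: "lk (\<psi> D) u \<noteq> 0"
    proof -
      obtain i where "d \<le> lk u i" "int (mdeg u) = int d - 3" using *[OF nz] by blast
      then show False using lookup_le_mdeg[of u i] by linarith
    qed
    then show "lk (\<psi> D) u = lk 0 u" by auto
  qed
qed

text \<open>
  With this sign, \<open>A \<mapsto> V' - A\<close> together with \<open>u \<mapsto> soc - u\<close> carries the transpose of the Koszul
  differential on \<open>R'\<close> to the Koszul differential on the canonical module.
\<close>

definition duality_sign :: "(nat \<Rightarrow>\<^sub>0 nat) set \<Rightarrow> 'k::comm_ring_1" where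
  "duality_sign A = (\<Prod>a\<in>A. ksign a V' 1)"

lemma duality_sign_nonzero: "duality_sign A \<noteq> (0::'k::field)"
proof (cases "finite A")
  case True
  then show ?thesis unfolding duality_sign_def by (simp add: ksign_def)
qed (simp add: duality_sign_def)

text \<open>The sign of \<open>v\<close> relative to \<open>V'\<close>, which is its factor in
  \<open>duality_sign\<close>, is the product of its signs relative to \<open>V' - B\<close> and to
  \<open>B - {v}\<close>.\<close>

lemma duality_sign_remove:
  assumes B: "B \<subseteq> V'" "v \<in> B"
  shows "ksign v (V' - B) 1 * duality_sign (B - {v}) = (ksign v (B - {v}) 1 * duality_sign B :: 'k::comm_ring_1)"
proof -
  have fB: "finite B" using finite_subset[OF B(1) finV'] .
  have "duality_sign B = (ksign v V' 1 * duality_sign (B - {v}) :: 'k)"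
    unfolding duality_sign_def using prod.remove[OF fB B(2)] .
  moreover have "ksign v V' 1 = (ksign v (V' - B) 1 * ksign v (B - {v}) 1 :: 'k)"
  proof -
    have "ksign v (V' - B) 1 * ksign v B 1 = (ksign v (V' - B \<union> B) 1 :: 'k)"
      by (rule ksign_union[symmetric]) (use fB finV' in auto)
    moreover have "V' - B \<union> B = V'" using B by blast
    ultimately show ?thesis by (simp add: ksign_Diff_self)
  qed
  ultimately have "ksign v (B - {v}) 1 * duality_sign B
     = ksign v (V' - B) 1 * (ksign v (B - {v}) 1 * ksign v (B - {v}) 1) * (duality_sign (B - {v}) :: 'k)"
    by (simp only: mult_ac)
  then show ?thesis by simp
qed

text \<open>Every chain in coefficient degree 2 is a cycle, the quotient being zero in degree 3, so
  a preimage under the incoming differential is wanted. A functional obstructing it would be a cycle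
  with values in \<open>W\<close>, indexed by sets of size \<open>card V' - n\<close>, and Green's
  argument leaves only zero.\<close>

lemma R_exact_2:
  assumes n: "n \<le> 3 * d - 3"
  shows "kexact V (mact (\<lambda>m. m)) (R.mP :: int \<Rightarrow> (nat, 'k::field_char_0) mpoly set) Z0 n 2"
proof (rule R_reduce[THEN iffD2], assumption+)
  show "kexact V' (mact (\<lambda>m. m)) (R.mP :: int \<Rightarrow> (nat, 'k) mpoly set) I n 2"
    unfolding kexact_def
  proof (intro ballI impI)
    fix c :: "(nat \<Rightarrow>\<^sub>0 nat) set \<Rightarrow> (nat, 'k) mpoly"
    assume c: "c \<in> chains V' (R.mP 2) n"
    let ?K = "kdiff V' (mact (\<lambda>m. m)) :: ((nat \<Rightarrow>\<^sub>0 nat) set \<Rightarrow> (nat, 'k) mpoly) \<Rightarrow> _"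
    interpret commuting_action "mact (\<lambda>m. m) :: _ \<Rightarrow> (nat, 'k) mpoly \<Rightarrow> _" by (rule commuting_mact)
    have Psub: "graded_sub V' (mact (\<lambda>m. m)) (R.mP :: int \<Rightarrow> (nat, 'k) mpoly set)"
      by (rule graded_sub_mono[OF R.mP_graded_sub]) blast
    \<comment> \<open>\<open>Y\<close> indexes a basis of the chains with values in the quotient,
      and \<open>S\<close> consists of the boundaries in these coordinates.\<close>
    define Y where "Y = {A. A \<subseteq> V' \<and> card A = n} \<times> {u. bounded_monomial d u \<and> mdeg u = 2 * d}"
    have finY: "finite Y"
      unfolding Y_def
    proof (rule finite_cartesian_product)
      show "finite {A. A \<subseteq> V' \<and> card A = n}" by (rule finite_subset[of _ "Pow V'"]) (use finV' in auto)
      show "finite {u. bounded_monomial d u \<and> mdeg u = 2 * d}"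
        by (rule finite_subset[OF _ finite_monomials[of "{0..2}" "2 * d"]]) (auto simp: bounded_monomial_def)
    qed
    define S where "S = (\<lambda>b (A, u). lk (?K b A) u) ` chains V' (R.mP 1) (Suc n)"
    have zc: "(\<lambda>_. 0) \<in> chains V' (R.mP 1 :: (nat, 'k) mpoly set) (Suc n)" by (rule chainsI) simp_all
    have Sclosed: "(\<lambda>y. g y + r * h y) \<in> S" if gh: "g \<in> S" "h \<in> S" for g h r
    proof -
      obtain b e where b: "b \<in> chains V' (R.mP 1) (Suc n)" and e: "e \<in> chains V' (R.mP 1) (Suc n)"
        and g: "g = (\<lambda>(A, u). lk (?K b A) u)" and h: "h = (\<lambda>(A, u). lk (?K e A) u)"
        using gh unfolding S_def by auto
      let ?f = "\<lambda>A. b A + Poly_Mapping.single 0 r * e A"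
      have "?f \<in> chains V' (R.mP 1) (Suc n)"
      proof (rule chainsI)
        fix A assume A: "A \<subseteq> V'" "card A = Suc n"
        have "Poly_Mapping.single 0 r * e A \<in> R.mP 1"
          using chainsD(1)[OF e A] by (auto simp: R.mP_def forms_iff)
        then show "?f A \<in> R.mP 1" by (rule graded_subD(4)[OF Psub chainsD(1)[OF b A]])
      next
        fix A assume "\<not> (A \<subseteq> V' \<and> card A = Suc n)"
        then show "?f A = 0" using chainsD(2)[OF b, of A] chainsD(2)[OF e, of A] by simp
      qed
      moreover have "?K ?f A = ?K b A + Poly_Mapping.single 0 r * ?K e A" for A
        unfolding kdiff_add
        by (simp add: kdiff_def sum_distrib_left mact_def ksign_def mult.left_commute if_distrib cong: if_cong)
      then have "(\<lambda>y. g y + r * h y) = (\<lambda>(A, u). lk (?K ?f A) u)"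
        unfolding g h by (auto simp: fun_eq_iff lookup_add)
      ultimately show ?thesis unfolding S_def by blast
    qed
    have "(\<exists>g\<in>S. \<forall>y\<in>Y. g y = (\<lambda>(A, u). lk (c A) u) y) \<or>
       (\<exists>\<phi>. (\<forall>g\<in>S. (\<Sum>y\<in>Y. \<phi> y * g y) = 0) \<and> (\<Sum>y\<in>Y. \<phi> y * (\<lambda>(A, u). lk (c A) u) y) \<noteq> 0)"
      by (rule separating_functional[OF finY _ Sclosed]) (use zc in \<open>auto simp: S_def\<close>)
    then show "\<exists>b\<in>chains V' (R.mP (2 - 1)) (Suc n). \<forall>C. c C - ?K b C \<in> I 2"
    proof
      assume "\<exists>g\<in>S. \<forall>y\<in>Y. g y = (\<lambda>(A, u). lk (c A) u) y"
      then obtain b where b: "b \<in> chains V' (R.mP 1) (Suc n)" and eq: "\<And>A u. (A, u) \<in> Y \<Longrightarrow> lk (?K b A) u = lk (c A) u"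
        unfolding S_def by fastforce
      have Kb: "?K b \<in> chains V' (R.mP (1 + 1)) n" by (rule kdiff_chains[OF finV' Psub b])
      have "c C - ?K b C \<in> I 2" for C
      proof (cases "C \<subseteq> V' \<and> card C = n")
        case True
        have "c C - ?K b C \<in> R.mP 2"
          using graded_subD(2)[OF Psub chains_mem[OF c mP_0(1)] chains_mem[OF Kb mP_0(1), simplified]] .
        moreover have "lk (c C - ?K b C) u = 0" if "bounded_monomial d u" for u
        proof (rule ccontr)
          assume nz: "lk (c C - ?K b C) u \<noteq> 0"
          then have "int (mdeg u) = 2 * int d" using \<open>c C - ?K b C \<in> R.mP 2\<close> by (auto simp: R.mP_def forms_iff)
          then have "mdeg u = 2 * d" by linarith
          then have "(C, u) \<in> Y" using that True by (simp add: Y_def)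
          then show False using nz eq by (simp add: lookup_minus)
        qed
        ultimately show ?thesis unfolding I_bounded by blast
      next
        case False
        then have "c C = 0" "?K b C = 0" using chainsD(2)[OF c, of C] chainsD(2)[OF Kb, of C] by simp_all
        then show ?thesis by simp
      qed
      then show ?thesis using b by auto
    next
      assume "\<exists>\<phi>. (\<forall>g\<in>S. (\<Sum>y\<in>Y. \<phi> y * g y) = 0) \<and> (\<Sum>y\<in>Y. \<phi> y * (\<lambda>(A, u). lk (c A) u) y) \<noteq> 0"
      then obtain \<phi> where \<phi>: "\<And>g. g \<in> S \<Longrightarrow> (\<Sum>y\<in>Y. \<phi> y * g y) = 0"
        and \<phi>c: "(\<Sum>y\<in>Y. \<phi> y * (\<lambda>(A, u). lk (c A) u) y) \<noteq> 0" by blast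
      define q where "q = card V' - n"
      \<comment> \<open>The bound on \<open>n\<close> enters here.\<close>
      have q: "card W0 \<le> q" "q + n = card V'" using n card_V' by (simp_all add: q_def)
      \<comment> \<open>The functional transported by complements: the coefficient at
        \<open>D\<close> and \<open>e\<close> is its value at \<open>V' - D\<close> and
        \<open>soc - e\<close>, up to sign.\<close>
      define \<psi> :: "(nat \<Rightarrow>\<^sub>0 nat) set \<Rightarrow> (nat, 'k) mpoly" where "\<psi> D = (if D \<subseteq> V' \<and> card D = q
        then (\<Sum>e\<in>W0. Poly_Mapping.single e (duality_sign (V' - D) * \<phi> (V' - D, soc - e))) else 0)" for D
      have lk\<psi>: "lk (\<psi> D) e = (if e \<in> W0 then duality_sign (V' - D) * \<phi> (V' - D, soc - e) else 0)"
        if "D \<subseteq> V'" "card D = q" for D e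
        using that by (simp add: \<psi>_def lookup_sum lookup_single when_def finite_veronese_vars)
      have \<psi>: "\<psi> \<in> chains V' (W.mP 0) q"
      proof (rule chainsI)
        fix D assume D: "D \<subseteq> V'" "card D = q"
        show "\<psi> D \<in> W.mP 0" unfolding W.mP_def forms_iff lk\<psi>[OF D] by (auto simp: W0_mem_forms)
      qed (simp only: \<psi>_def if_False)
      have Wsub: "graded_sub V' (mact (\<lambda>m. m)) (W.mP :: int \<Rightarrow> (nat, 'k) mpoly set)"
        by (rule graded_sub_mono[OF W.mP_graded_sub]) blast
      have "?K \<psi> C \<in> W.mI (pure_powers d) 1" for C
      proof -
        have KW: "?K \<psi> C \<in> W.mP (0 + 1)"
          by (rule kdiff_mem[OF Wsub]) (use chains_mem[OF \<psi>] chainsD(2)[OF \<psi>] in \<open>auto simp: mP_0\<close>)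
        have "lk (?K \<psi> C) u = 0" if u: "bounded_monomial d u" for u
        proof (rule ccontr)
          assume nz: "lk (?K \<psi> C) u \<noteq> 0"
          have C: "C \<subseteq> V'" "Suc (card C) = q"
          proof -
            have "C \<subseteq> V' \<and> Suc (card C) = q"
            proof (rule ccontr)
              assume "\<not> ?thesis"
              then have "?K \<psi> C = 0"
                using kdiff_0_chain[OF finV', of \<psi> _ C] kdiff_outside[OF finV', of \<psi> _ "q - 1" C] \<psi> by (cases q) auto
              then show False using nz by simp
            qed
            then show "C \<subseteq> V'" "Suc (card C) = q" by auto
          qed
          have "int (mdeg u) = int d - 3 + int d" using KW nz by (simp add: W.mP_def forms_iff)
          then have du: "mdeg u = 2 * d - 3" using d3 by linarith
          have us: "mdiv u soc" using u bounded_iff_mdiv d3 by auto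
          \<comment> \<open>The coefficient at \<open>u\<close> is tested against the boundary of
            the single term \<open>e_B\<close> with coefficient \<open>x^m\<close>. The degree of
            \<open>m\<close> is \<open>3 * d - 3 - (2 * d - 3) = d\<close>, so this is a chain in
            coefficient degree 1.\<close>
          define m where "m = soc - u"
          define B where "B = V' - C"
          have BC: "V' - B = C" "B \<subseteq> V'" using C by (auto simp: B_def)
          have cB: "card B = Suc n"
            using card_Diff_subset[OF finite_subset[OF C(1) finV'] C(1)] C(2) q(2) by (simp add: B_def)
          have dm: "mdeg m = d" unfolding m_def using mdeg_compl[OF us] du d3 by simp
          have km: "Poly_Mapping.keys m \<subseteq> {0..2}"
            using keys_minus_subset[of soc u] keys_box[of "d - 1"] by (auto simp: m_def)
          define b :: "(nat \<Rightarrow>\<^sub>0 nat) set \<Rightarrow> (nat, 'k) mpoly" where "b A = (if A = B then monomial m else 0)" for A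
          have b: "b \<in> chains V' (R.mP 1) (Suc n)"
            by (rule chainsI) (use BC cB dm km in \<open>auto simp: b_def R.mP_def forms_iff lookup_single when_def\<close>)
          have lkb: "lk (?K b A) w = (\<Sum>v\<in>B. if (A, w) = (B - {v}, v + m) then ksign v (B - {v}) 1 else 0)" if "A \<subseteq> V'" for A w
          proof -
            have "lk (?K b A) w = (\<Sum>v\<in>V' - A. ksign v A (if insert v A = B \<and> w = v + m then 1 else 0))"
              unfolding kdiff_def lookup_sum
              by (rule sum.cong) (auto simp: b_def ksign_def mact_def mult_single lookup_single when_def)
            also have "\<dots> = (\<Sum>v\<in>V' - A. if v \<in> B \<and> (A, w) = (B - {v}, v + m) then ksign v (B - {v}) 1 else 0)"
            proof (rule sum.cong[OF refl])
              fix v assume v: "v \<in> V' - A"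
              then have "insert v A = B \<longleftrightarrow> v \<in> B \<and> A = B - {v}" by auto
              then show "ksign v A (if insert v A = B \<and> w = v + m then 1 else 0)
                = (if v \<in> B \<and> (A, w) = (B - {v}, v + m) then ksign v (B - {v}) 1 else 0)" by auto
            qed
            also have "\<dots> = (\<Sum>v\<in>V'. if v \<in> B \<and> (A, w) = (B - {v}, v + m) then ksign v (B - {v}) 1 else 0)"
              by (rule sum.mono_neutral_left) (use finV' in auto)
            also have "\<dots> = (\<Sum>v\<in>B. if v \<in> B \<and> (A, w) = (B - {v}, v + m) then ksign v (B - {v}) 1 else 0)"
              by (rule sum.mono_neutral_right) (use finV' BC in auto)
            also have "\<dots> = (\<Sum>v\<in>B. if (A, w) = (B - {v}, v + m) then ksign v (B - {v}) 1 else 0)"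
              by (rule sum.cong) auto
            finally show ?thesis .
          qed
          \<comment> \<open>The product of \<open>v\<close> and \<open>x^m\<close> survives in the
            quotient precisely when \<open>v\<close> divides \<open>u\<close>, which is also when
            \<open>v\<close> contributes to the coefficient of the differential of
            \<open>\<psi>\<close> at \<open>u\<close>.\<close>
          have YB: "(B - {v}, v + m) \<in> Y \<longleftrightarrow> mdiv v u" if v: "v \<in> B" for v
          proof -
            have "bounded_monomial d (v + m) \<longleftrightarrow> mdiv v u"
            proof -
              have le: "lk u i \<le> lk soc i" for i using us unfolding mdiv_def by blast
              have "lk v i + (lk soc i - lk u i) \<le> lk soc i \<longleftrightarrow> lk v i \<le> lk u i" for i using le[of i] by linarith
              then have "mdiv (v + m) soc \<longleftrightarrow> mdiv v u"
                unfolding mdiv_def m_def lookup_add lookup_minus by blast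
              then show ?thesis using bounded_iff_mdiv[of d "v + m"] d3 by simp
            qed
            moreover have "mdeg v = d" using v BC by (auto simp: veronese_vars_def)
            moreover have "card (B - {v}) = n" using v cB by simp
            ultimately show ?thesis using BC by (auto simp: Y_def dm)
          qed
          have "0 = (\<Sum>y\<in>Y. \<phi> y * (\<lambda>(A, w). lk (?K b A) w) y)"
            using \<phi>[of "\<lambda>(A, w). lk (?K b A) w"] b unfolding S_def by auto
          also have "\<dots> = (\<Sum>y\<in>Y. \<Sum>v\<in>B. if y = (B - {v}, v + m) then \<phi> y * ksign v (B - {v}) 1 else 0)"
          proof (rule sum.cong[OF refl])
            fix y assume y: "y \<in> Y"
            obtain A w where yA: "y = (A, w)" "A \<subseteq> V'" using y by (auto simp: Y_def)
            show "\<phi> y * (\<lambda>(A, w). lk (?K b A) w) y = (\<Sum>v\<in>B. if y = (B - {v}, v + m) then \<phi> y * ksign v (B - {v}) 1 else 0)"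
              unfolding yA(1) split_conv lkb[OF yA(2)] sum_distrib_left by (rule sum.cong) auto
          qed
          also have "\<dots> = (\<Sum>v\<in>B. \<Sum>y\<in>Y. if y = (B - {v}, v + m) then \<phi> y * ksign v (B - {v}) 1 else 0)"
            by (rule sum.swap)
          also have "\<dots> = (\<Sum>v\<in>B. if mdiv v u then \<phi> (B - {v}, v + m) * ksign v (B - {v}) 1 else 0)"
            by (rule sum.cong[OF refl]) (simp add: sum.delta[OF finY] YB)
          finally have zero: "(\<Sum>v\<in>B. if mdiv v u then \<phi> (B - {v}, v + m) * ksign v (B - {v}) 1 else 0) = 0" by simp
          have "lk (?K \<psi> C) u = (\<Sum>v\<in>B. duality_sign B * (if mdiv v u then \<phi> (B - {v}, v + m) * ksign v (B - {v}) 1 else 0))"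
            unfolding kdiff_def lookup_sum B_def[symmetric]
          proof (rule sum.cong[OF refl])
            fix v assume v: "v \<in> B"
            have "lk (ksign v C (mact (\<lambda>m. m) v (\<psi> (insert v C)))) u = ksign v C 1 * (if mdiv v u then lk (\<psi> (insert v C)) (u - v) else 0)"
              by (simp add: ksign_def mact_def lookup_single_mult)
            also have "\<dots> = duality_sign B * (if mdiv v u then \<phi> (B - {v}, v + m) * ksign v (B - {v}) 1 else 0)"
            proof (cases "mdiv v u")
              case True
              have iC: "insert v C \<subseteq> V'" "card (insert v C) = q" "V' - insert v C = B - {v}"
                using v C BC finite_subset[OF C(1) finV'] by (auto simp: B_def)
              have "mdeg v = d" using v BC by (auto simp: veronese_vars_def)
              then have "u - v \<in> W0"
                using mdeg_diff[OF True] du keys_minus_subset[of u v] u d3 by (auto simp: veronese_vars_def bounded_monomial_def)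
              moreover have "soc - (u - v) = v + m"
              proof (rule poly_mapping_eqI)
                fix i
                have "lk u i \<le> lk soc i" "lk v i \<le> lk u i" using us True unfolding mdiv_def by blast+
                then show "lk (soc - (u - v)) i = lk (v + m) i" unfolding m_def lookup_minus lookup_add by linarith
              qed
              ultimately have "lk (\<psi> (insert v C)) (u - v) = duality_sign (B - {v}) * \<phi> (B - {v}, v + m)"
                using lk\<psi>[OF iC(1,2)] iC(3) by simp
              then show ?thesis
                using True duality_sign_remove[OF BC(2) v, where 'k = 'k] unfolding BC(1) by (simp add: mult_ac)
            qed simp
            finally show "lk (ksign v C (mact (\<lambda>m. m) v (\<psi> (insert v C)))) u = duality_sign B * (if mdiv v u then \<phi> (B - {v}, v + m) * ksign v (B - {v}) 1 else 0)" .
          qed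
          then show False using zero nz by (simp flip: sum_distrib_left)
        qed
        then have "\<exists>z\<in>pure_powers d. mdiv z u" if "lk (?K \<psi> C) u \<noteq> 0" for u
          using that KW not_le unfolding pure_powers_mdiv bounded_monomial_def W.mP_def forms_iff by blast
        then show ?thesis using KW unfolding W.mI_def by simp
      qed
      then have \<psi>0: "\<psi> D = 0" for D by (rule W_cycle_0[OF q(1) \<psi>])
      \<comment> \<open>\<open>\<psi>\<close> records every value of \<open>\<phi>\<close> on
        \<open>Y\<close> up to a nonzero sign, because \<open>w \<mapsto> soc - w\<close> takes the
        basis monomials of degree \<open>2 * d\<close> into \<open>W0\<close>.\<close>
      have "\<phi> y = 0" if y: "y \<in> Y" for y
      proof -
        obtain A w where A: "y = (A, w)" "A \<subseteq> V'" "card A = n" "bounded_monomial d w" "mdeg w = 2 * d"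
          using y by (auto simp: Y_def)
        have ws: "mdiv w soc" using A(4) bounded_iff_mdiv d3 by auto
        let ?D = "V' - A" and ?e = "soc - w"
        have D: "?D \<subseteq> V'" "card ?D = q" "V' - ?D = A"
          using A card_Diff_subset[OF finite_subset[OF A(2) finV'] A(2)] by (auto simp: q_def)
        have "?e \<in> W0"
          using mdeg_compl[OF ws] A(5) keys_minus_subset[of soc w] keys_box[of "d - 1"] by (auto simp: veronese_vars_def)
        then have "0 = duality_sign A * \<phi> (A, w)"
          using lk\<psi>[OF D(1,2), of ?e] \<psi>0 D(3) mdiv_diff_diff[OF ws] by simp
        then show ?thesis using duality_sign_nonzero[of A, where 'k = 'k] A(1) by simp
      qed
      then have "(\<Sum>y\<in>Y. \<phi> y * (\<lambda>(A, u). lk (c A) u) y) = 0" by simp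
      then show ?thesis using \<phi>c by contradiction
    qed
  qed
qed

text \<open>
  The functional \<open>\<Phi>\<close> below is the dual of the cycle
  \<open>\<Sum>\<^sub>e \<plusminus> (\<And>\<^sub>f c0 f) \<otimes> e\<close>, where \<open>f \<noteq> e\<close>: it kills boundaries because their terms are antisymmetric in a pair \<open>(e, f)\<close>.
\<close>

lemma R_not_exact:
  "\<not> kexact V (mact (\<lambda>m. m)) (R.mP :: int \<Rightarrow> (nat, 'k::field_char_0) mpoly set) Z0 (3 * d - 2) 2"
proof
  interpret commuting_action "mact (\<lambda>m. m) :: _ \<Rightarrow> (nat, 'k) mpoly \<Rightarrow> _" by (rule commuting_mact)
  let ?K = "kdiff V' (mact (\<lambda>m. m)) :: ((nat \<Rightarrow>\<^sub>0 nat) set \<Rightarrow> (nat, 'k) mpoly) \<Rightarrow> _"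
  let ?n = "3 * d - 2"
  assume "kexact V (mact (\<lambda>m. m)) (R.mP :: int \<Rightarrow> (nat, 'k) mpoly set) Z0 ?n 2"
  then have ex: "kexact V' (mact (\<lambda>m. m)) (R.mP :: int \<Rightarrow> (nat, 'k) mpoly set) I ?n 2"
    by (rule R_reduce[THEN iffD1, rotated -1]) assumption+
  have Psub: "graded_sub V' (mact (\<lambda>m. m)) (R.mP :: int \<Rightarrow> (nat, 'k) mpoly set)"
    by (rule graded_sub_mono[OF R.mP_graded_sub]) blast
  \<comment> \<open>All \<open>3 * d - 3\<close> edge points together with one interior point form
    the index sets of size \<open>3 * d - 2\<close> that \<open>\<Phi>\<close> looks at.\<close>
  define B where "B = V' - cW"
  have fB: "finite B" using finV' by (simp add: B_def)
  have cB: "card B = 3 * d - 3" using card_boundary by (simp add: B_def)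
  have notB: "c0 + e \<notin> B" if "e \<in> W0" for e using that by (simp add: B_def)
  have A: "insert (c0 + e) B \<subseteq> V'" "card (insert (c0 + e) B) = ?n" if "e \<in> W0" for e
    using that cW_subset notB[OF that] cB fB d3 by (auto simp: B_def)
  have eW: "Poly_Mapping.single 0 (d - 3) \<in> W0" by (auto simp: veronese_vars_def split: if_splits)
  define \<Phi> :: "((nat \<Rightarrow>\<^sub>0 nat) set \<Rightarrow> (nat, 'k) mpoly) \<Rightarrow> 'k" where
    "\<Phi> x = (\<Sum>e\<in>W0. ksign (c0 + e) B (lk (x (insert (c0 + e) B)) (soc - e)))" for x
  \<comment> \<open>Any element of \<open>W0\<close> would serve: \<open>x\<close> is a single term
    on which \<open>\<Phi>\<close> is plus or minus 1, and a cycle because the quotient is zero in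
    degree 3.\<close>
  define e0 :: "nat \<Rightarrow>\<^sub>0 nat" where "e0 = Poly_Mapping.single 0 (d - 3)"
  define x :: "(nat \<Rightarrow>\<^sub>0 nat) set \<Rightarrow> (nat, 'k) mpoly" where
    "x A = (if A = insert (c0 + e0) B then monomial (soc - e0) else 0)" for A
  have e0: "e0 \<in> W0" using eW by (simp add: e0_def)
  have "mdeg e0 = d - 3" using e0 by (simp add: veronese_vars_def)
  then have de0: "mdeg (soc - e0) = 2 * d" using mdeg_compl[OF W0_dvd_soc[OF e0]] d3 by simp
  have ke0: "Poly_Mapping.keys (soc - e0) \<subseteq> {0..2}"
    using keys_minus_subset[of soc e0] keys_box[of "d - 1"] by blast
  have x: "x \<in> chains V' (R.mP 2) ?n"
    by (rule chainsI) (use A[OF e0] ke0 de0 in \<open>auto simp: x_def R.mP_def forms_iff lookup_single when_def\<close>)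
  have "?K x C \<in> I (2 + 1)" for C
  proof -
    have "?K x C \<in> R.mP (2 + 1)"
      by (rule kdiff_mem[OF Psub]) (use chains_mem[OF x] chainsD(2)[OF x] in auto)
    then show ?thesis using mP_subset_I[of "2 + 1", where 'k = 'k] by auto
  qed
  then obtain b where b: "b \<in> chains V' (R.mP (2 - 1)) (Suc ?n)" and xb: "\<And>C. x C - ?K b C \<in> I 2"
    using ex x unfolding kexact_def by blast
  have "lk (x C) (soc - e) = lk (?K b C) (soc - e)" if e: "e \<in> W0" for C e
  proof -
    have "bounded_monomial d (soc - e)" by (rule compl_bounded[OF W0_dvd_soc[OF e]])
    then have "lk (x C - ?K b C) (soc - e) = 0" using xb[of C] unfolding I_bounded by blast
    then show ?thesis by (simp add: lookup_minus)
  qed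
  then have "\<Phi> x = \<Phi> (?K b)" unfolding \<Phi>_def by (intro sum.cong) auto
  moreover have "\<Phi> x = ksign (c0 + e0) B 1"
  proof -
    have "insert (c0 + e) B = insert (c0 + e0) B \<longleftrightarrow> e = e0" if "e \<in> W0" for e
      using notB[OF that] notB[OF e0] by (metis add_left_cancel insertE insertI1)
    then have "\<Phi> x = (\<Sum>e\<in>W0. if e = e0 then ksign (c0 + e0) B 1 else 0)"
      unfolding \<Phi>_def by (intro sum.cong) (auto simp: x_def)
    then show ?thesis using e0 finite_veronese_vars by simp
  qed
  moreover have "\<Phi> (?K b) = 0"
  proof -
    \<comment> \<open>The coefficient of \<open>b\<close> that multiplication by the interior point
      of \<open>f\<close> carries to the position tested for \<open>e\<close>. It depends only on
      the unordered pair: the divisibility says that \<open>c0 + e + f\<close> divides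
      \<open>soc\<close>, and the quotient is taken by this product.\<close>
    define h where "h e f = (if e = f then 0 else if mdiv (c0 + f) (soc - e)
      then lk (b (insert (c0 + f) (insert (c0 + e) B))) (soc - e - (c0 + f)) else 0)" for e f
    define F where "F e f = ksign (c0 + e) B (ksign (c0 + f) B (if c0 + e < c0 + f then - h e f else h e f))" for e f
    have h_sym: "h e f = h f e" if ef: "e \<in> W0" "f \<in> W0" for e f
    proof -
      have le: "lk e i \<le> lk soc i" "lk f i \<le> lk soc i" for i
        using W0_dvd_soc[OF ef(1)] W0_dvd_soc[OF ef(2)] unfolding mdiv_def by blast+
      have "lk c0 i + lk f i \<le> lk soc i - lk e i \<longleftrightarrow> lk c0 i + lk e i \<le> lk soc i - lk f i" for i
        using le[of i] by linarith
      then have "mdiv (c0 + f) (soc - e) \<longleftrightarrow> mdiv (c0 + e) (soc - f)"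
        unfolding mdiv_def lookup_add lookup_minus by blast
      moreover have "soc - e - (c0 + f) = soc - f - (c0 + e)"
        by (rule poly_mapping_eqI) (simp add: lookup_minus lookup_add)
      ultimately show ?thesis by (simp add: h_def insert_commute)
    qed
    have F_anti: "F e f = - F f e" if ef: "e \<in> W0" "f \<in> W0" for e f
    proof (cases "e = f")
      case False
      then have "c0 + e < c0 + f \<longleftrightarrow> \<not> c0 + f < c0 + e" by (metis add_left_cancel less_linear less_not_sym)
      moreover have "ksign (c0 + e) B (ksign (c0 + f) B y) = ksign (c0 + f) B (ksign (c0 + e) B y)" for y :: 'k
        by (rule ksign_commute)
      ultimately show ?thesis using h_sym[OF ef] by (simp add: F_def ksign_minus del: One_nat_def)
    qed (simp add: F_def h_def)
    have "ksign (c0 + e) B (lk (?K b (insert (c0 + e) B)) (soc - e)) = (\<Sum>f\<in>W0. F e f)" if e: "e \<in> W0" for e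
    proof -
      have V: "V' - insert (c0 + e) B = (+) c0 ` (W0 - {e})"
        using cW_subset by (auto simp: B_def)
      have "lk (?K b (insert (c0 + e) B)) (soc - e) = (\<Sum>f\<in>W0 - {e}.
          lk (ksign (c0 + f) (insert (c0 + e) B) (mact (\<lambda>m. m) (c0 + f) (b (insert (c0 + f) (insert (c0 + e) B))))) (soc - e))"
        unfolding kdiff_def V by (subst sum.reindex) (auto simp: lookup_sum inj_on_def)
      also have "\<dots> = (\<Sum>f\<in>W0 - {e}. ksign (c0 + f) B (if c0 + e < c0 + f then - h e f else h e f))"
      proof (rule sum.cong[OF refl])
        fix f assume f: "f \<in> W0 - {e}"
        have "lk (ksign (c0 + f) (insert (c0 + e) B) (mact (\<lambda>m. m) (c0 + f) (b (insert (c0 + f) (insert (c0 + e) B))))) (soc - e)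
          = ksign (c0 + f) (insert (c0 + e) B) (lk (mact (\<lambda>m. m) (c0 + f) (b (insert (c0 + f) (insert (c0 + e) B)))) (soc - e))"
          by (simp add: ksign_def)
        also have "lk (mact (\<lambda>m. m) (c0 + f) (b (insert (c0 + f) (insert (c0 + e) B)))) (soc - e) = h e f"
          using f by (auto simp: h_def mact_def lookup_single_mult)
        finally show "lk (ksign (c0 + f) (insert (c0 + e) B) (mact (\<lambda>m. m) (c0 + f) (b (insert (c0 + f) (insert (c0 + e) B))))) (soc - e)
          = ksign (c0 + f) B (if c0 + e < c0 + f then - h e f else h e f)"
          unfolding ksign_insert[OF fB notB[OF e]] by (simp add: ksign_minus)
      qed
      also have "\<dots> = (\<Sum>f\<in>W0. ksign (c0 + f) B (if c0 + e < c0 + f then - h e f else h e f))"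
        by (rule sum.mono_neutral_left) (auto simp: finite_veronese_vars h_def)
      finally show ?thesis by (simp add: F_def ksign_sum)
    qed
    then have "\<Phi> (?K b) = (\<Sum>e\<in>W0. \<Sum>f\<in>W0. F e f)" unfolding \<Phi>_def by (intro sum.cong) auto
    also have "\<dots> = (\<Sum>f\<in>W0. \<Sum>e\<in>W0. F e f)" by (rule sum.swap)
    also have "\<dots> = (\<Sum>f\<in>W0. \<Sum>e\<in>W0. - F f e)" using F_anti by (intro sum.cong refl) blast
    also have "\<dots> = - (\<Sum>f\<in>W0. \<Sum>e\<in>W0. F f e)" by (simp add: sum_negf)
    finally have eq: "\<Phi> (?K b) = - (\<Sum>f\<in>W0. \<Sum>e\<in>W0. F f e)" .
    \<comment> \<open>Characteristic zero turns antisymmetry into vanishing.\<close>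
    have "\<Phi> (?K b) = - \<Phi> (?K b)" using eq \<open>\<Phi> (?K b) = (\<Sum>e\<in>W0. \<Sum>f\<in>W0. F e f)\<close> by simp
    then have "\<Phi> (?K b) + \<Phi> (?K b) = 0" by (rule eq_neg_iff_add_eq_0[THEN iffD1])
    then have "2 * \<Phi> (?K b) = 0" by (simp only: mult_2)
    then show ?thesis by simp
  qed
  ultimately show False by simp
qed

end

section \<open>Free modules and independence of graded pieces\<close>

lemma sum_fun_apply: "sum f S x = (\<Sum>i\<in>S. f i x)"
  by (induction S rule: infinite_finite_induct) auto

definition vact :: "'v \<Rightarrow> ('v, 'k::comm_ring_1) vec \<Rightarrow> ('v, 'k) vec" where
  "vact v w = (\<lambda>i. monomial (Poly_Mapping.single v (Suc 0)) * w i)"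

abbreviation fpiece :: "'v set \<Rightarrow> (int \<Rightarrow> nat) \<Rightarrow> int \<Rightarrow> ('v, 'k::comm_ring_1) vec set" where
  "fpiece V b \<equiv> piece (free_module V b)"

lemma fpiece_def:
  "fpiece V b t = {v. (\<forall>j k. k < b j \<longrightarrow> v (j, k) \<in> forms V (t - j)) \<and> (\<forall>j k. b j \<le> k \<longrightarrow> v (j, k) = 0)}"
  by (simp add: free_module_def)

lemma act_free_module: "act (free_module V b) s v = (\<lambda>i. s * v i)"
  by (simp add: free_module_def)

lemma commuting_vact: "commuting_action (vact :: 'v::linorder \<Rightarrow> ('v, 'k::comm_ring_1) vec \<Rightarrow> _)"
  by unfold_locales (simp_all add: vact_def algebra_simps fun_eq_iff)

lemma ksign_apply: "ksign v C w i = ksign v C (w i)"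
  by (simp add: ksign_def)

lemma kdiff_vact_apply: "kdiff V vact c C i = kdiff V (mact (\<lambda>v. Poly_Mapping.single v (Suc 0))) (\<lambda>A. c A i) C"
  by (simp add: kdiff_def sum_fun_apply ksign_apply vact_def mact_def)

lemma forms_diff: "p \<in> forms X t \<Longrightarrow> q \<in> forms X t \<Longrightarrow> p - q \<in> forms X t"
  for p q :: "('v, 'k::ab_group_add) mpoly"
  unfolding forms_iff by (metis diff_0_right lookup_minus)

lemma forms_0 [simp]: "0 \<in> forms X t"
  by (simp add: forms_iff)

section \<open>The Koszul complex of a free module\<close>

locale polynomial_ring =
  fixes V :: "'v::linorder set"
  assumes finV: "finite V"
begin

sublocale S: monomial_action V "\<lambda>v. Poly_Mapping.single v (Suc 0)" V "Suc 0" 0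
  by unfold_locales (auto simp: finV)

lemma S_mP: "S.mP t = forms V t"
  by (simp add: S.mP_def)

text \<open>The variables themselves are a regular sequence. Removing all of them leaves the base
  field in degree 0 with no variables, whose only homology is at \<open>n = t = 0\<close>.\<close>

lemma S_exact:
  assumes "n \<noteq> 0 \<or> t \<noteq> 0"
  shows "kexact V (mact (\<lambda>v. Poly_Mapping.single v (Suc 0))) (forms V :: int \<Rightarrow> ('v, 'k::comm_ring_1) mpoly set) Z0 n t"
proof -
  have m0: "0 \<in> S.mI V t" for t by (simp add: S.mI_def S_mP)
  have "kexact (V - V) (mact (\<lambda>v. Poly_Mapping.single v (Suc 0))) (S.mP :: int \<Rightarrow> ('v, 'k) mpoly set) (S.mI V) n t"
  proof (cases "n = 0")
    case False
    show ?thesis by (rule kexact_large[OF commuting_mact]) (use False m0 in \<open>auto simp: S_mP\<close>)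
  next
    case True
    show ?thesis
    proof (rule kexact_trivial[OF commuting_mact])
      show "(S.mP t :: ('v, 'k) mpoly set) \<subseteq> S.mI V t"
      proof
        fix p :: "('v, 'k) mpoly" assume p: "p \<in> S.mP t"
        have "\<exists>v\<in>V. mdiv (Poly_Mapping.single v (Suc 0)) u" if "lk p u \<noteq> 0" for u
        proof -
          have u: "Poly_Mapping.keys u \<subseteq> V" "int (mdeg u) = t" using p that by (auto simp: S_mP forms_iff)
          then have "u \<noteq> 0" using assms True by auto
          then obtain v where "v \<in> Poly_Mapping.keys u" by (metis all_not_in_conv keys_eq_empty poly_mapping_eqI in_keys_iff lookup_zero)
          then show ?thesis using u by (intro bexI[of _ v]) (auto simp: mdiv_def lookup_single when_def in_keys_iff)
        qed
        then show "p \<in> S.mI V t" using p by (simp add: S.mI_def)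
      qed
    qed (use m0 in \<open>auto simp: S_mP\<close>)
  qed
  then have "kexact V (mact (\<lambda>v. Poly_Mapping.single v (Suc 0))) (S.mP :: int \<Rightarrow> ('v, 'k) mpoly set) Z0 n t"
    by (rule S.kexact_reduce[THEN iffD2, rotated -1]) auto
  moreover have "S.mP = (forms V :: int \<Rightarrow> ('v, 'k) mpoly set)" using S_mP by blast
  ultimately show ?thesis by simp
qed

lemma fpiece_graded_sub: "graded_sub V vact (fpiece V b :: int \<Rightarrow> ('v, 'k::comm_ring_1) vec set)"
  unfolding graded_sub_def
proof (intro allI conjI ballI)
  fix t and x y :: "('v, 'k) vec" and v
  assume x: "x \<in> fpiece V b t"
  show "x - y \<in> fpiece V b t" if "y \<in> fpiece V b t"
    using x that by (auto simp: fpiece_def intro: forms_diff)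
  show "vact v x \<in> fpiece V b (t + 1)" if "v \<in> V"
  proof -
    have "monomial (Poly_Mapping.single v (Suc 0)) * p \<in> forms V (t + 1 - j)" if "p \<in> forms V (t - j)" for p :: "('v, 'k) mpoly" and j
      using S.mact_mP[OF \<open>v \<in> V\<close>, of p "t - j"] that by (simp add: S_mP mact_def algebra_simps)
    then show ?thesis using x by (simp add: fpiece_def vact_def)
  qed
qed (auto simp: fpiece_def)

text \<open>Coordinatewise this is \<open>S_exact\<close> in degree \<open>t - j\<close>. The
  exceptional coordinates have \<open>n = 0\<close> and \<open>j = t\<close>; their entries are
  constants, which \<open>min\<close> makes zero.\<close>

lemma free_boundary:
  fixes c :: "'v set \<Rightarrow> ('v, 'k::comm_ring_1) vec"
  assumes c: "c \<in> chains V (fpiece V b t) n" and kc: "\<And>C. kdiff V vact c C = 0"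
    and min: "n \<noteq> 0 \<or> (\<forall>A l. lk (c A l) 0 = 0)"
  shows "\<exists>e\<in>chains V (fpiece V b (t - 1)) (Suc n). \<forall>C. c C = kdiff V vact e C"
proof -
  have cP: "c A \<in> fpiece V b t" for A by (rule chains_mem[OF c graded_subD(1)[OF fpiece_graded_sub]])
  define Q where "Q j k e \<longleftrightarrow> e \<in> chains V (forms V (t - j - 1)) (Suc n) \<and>
      (\<forall>C. c C (j, k) = kdiff V (mact (\<lambda>v. Poly_Mapping.single v (Suc 0))) e C)" for j k e
  have ex: "\<exists>e. Q j k e" if k: "k < b j" for j k
  proof -
    have cl: "(\<lambda>A. c A (j, k)) \<in> chains V (forms V (t - j)) n"
      by (rule chainsI) (use cP chainsD(2)[OF c] k in \<open>auto simp: fpiece_def\<close>)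
    show ?thesis
    proof (cases "n \<noteq> 0 \<or> t - j \<noteq> 0")
      case True
      then show ?thesis
        using S_exact[OF True, where 'k = 'k] cl kc unfolding kexact_def Q_def
        by (auto simp flip: kdiff_vact_apply)
    next
      case False
      have "c A (j, k) = 0" for A
      proof (rule poly_mapping_eqI)
        fix u
        have "c A (j, k) \<in> forms V (t - j)" using cP[of A] k unfolding fpiece_def by blast
        moreover have "t - j = 0" using False by simp
        ultimately have "c A (j, k) \<in> forms V 0" by (simp only:)
        then show "lk (c A (j, k)) u = lk 0 u" using min False by (auto simp: forms_iff mdeg_eq_0_iff)
      qed
      then show ?thesis unfolding Q_def
        by (intro exI[of _ "\<lambda>_. 0"]) (auto intro: chainsI simp: commuting_action.kdiff_0[OF commuting_mact])
    qed
  qed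
  define e where "e j k = (SOME e. Q j k e)" for j k
  have "Q j k (e j k)" if "k < b j" for j k unfolding e_def by (rule someI_ex[OF ex[OF that]])
  then have e: "\<And>j k. k < b j \<Longrightarrow> e j k \<in> chains V (forms V (t - j - 1)) (Suc n)"
    "\<And>j k C. k < b j \<Longrightarrow> c C (j, k) = kdiff V (mact (\<lambda>v. Poly_Mapping.single v (Suc 0))) (e j k) C"
    unfolding Q_def by blast+
  define E where "E A = (\<lambda>(j, k). if k < b j then e j k A else 0)" for A
  have EP: "E \<in> chains V (fpiece V b (t - 1)) (Suc n)"
  proof (rule chainsI)
    fix A assume A: "A \<subseteq> V" "card A = Suc n"
    have "e j k A \<in> forms V (t - 1 - j)" if "k < b j" for j k
      using chainsD(1)[OF e(1)[OF that] A] unfolding Groups.diff_right_commute[of t j 1] .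
    then show "E A \<in> fpiece V b (t - 1)" by (auto simp: fpiece_def E_def)
  next
    fix A assume "\<not> (A \<subseteq> V \<and> card A = Suc n)"
    then show "E A = 0" using chainsD(2)[OF e(1)] by (auto simp: E_def fun_eq_iff)
  qed
  have "c C = kdiff V vact E C" for C
  proof
    fix l :: "int \<times> nat"
    obtain j k where l: "l = (j, k)" by (cases l)
    show "c C l = kdiff V vact E C l"
    proof (cases "k < b j")
      case True
      then show ?thesis unfolding l kdiff_vact_apply by (simp add: E_def e(2))
    next
      case False
      then have "c C l = 0" using cP[of C] by (simp add: fpiece_def l)
      moreover have "kdiff V vact E C l = 0" using False unfolding l kdiff_vact_apply
        by (simp add: E_def commuting_action.kdiff_0[OF commuting_mact])
      ultimately show ?thesis by simp
    qed
  qed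
  then show ?thesis using EP by blast
qed

lemma free_exact: "kexact V vact (fpiece V b :: int \<Rightarrow> ('v, 'k::comm_ring_1) vec set) Z0 (Suc n) t"
  unfolding kexact_def
proof (intro ballI impI)
  fix c :: "'v set \<Rightarrow> ('v, 'k) vec"
  assume "c \<in> chains V (fpiece V b t) (Suc n)" "\<forall>C. kdiff V vact c C \<in> {0}"
  then show "\<exists>e\<in>chains V (fpiece V b (t - 1)) (Suc (Suc n)). \<forall>C. c C - kdiff V vact e C \<in> {0}"
    using free_boundary[of c b t "Suc n"] by auto
qed

text \<open>Every chain at \<open>n = 0\<close> is a cycle, so exactness there says that degree
  \<open>t\<close> needs no new generators.\<close>

lemma kexact_0_iff:
  assumes "commuting_action a" and P: "graded_sub V a P"
  shows "kexact V a P Z0 0 t \<longleftrightarrow> (\<forall>x\<in>P t. \<exists>y. (\<forall>v\<in>V. y v \<in> P (t - 1)) \<and> x = (\<Sum>v\<in>V. a v (y v)))"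
proof -
  interpret commuting_action a by fact
  have k0: "kdiff V a b {} = (\<Sum>v\<in>V. a v (b {v}))" for b
    unfolding kdiff_def by (simp add: ksign_def)
  show ?thesis
  proof
    assume L: "kexact V a P Z0 0 t"
    show "\<forall>x\<in>P t. \<exists>y. (\<forall>v\<in>V. y v \<in> P (t - 1)) \<and> x = (\<Sum>v\<in>V. a v (y v))"
    proof
      fix x assume x: "x \<in> P t"
      define c where "c A = (if A = {} then x else 0)" for A :: "'v set"
      have c: "c \<in> chains V (P t) 0"
      proof (rule chainsI)
        show "c A \<in> P t" for A using x graded_subD(1)[OF P] by (simp add: c_def)
        show "c A = 0" if "\<not> (A \<subseteq> V \<and> card A = 0)" for A using that by (auto simp: c_def)
      qed
      then obtain b where b: "b \<in> chains V (P (t - 1)) (Suc 0)" "\<And>C. c C = kdiff V a b C"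
        using L kdiff_0_chain[OF finV c] unfolding kexact_def by force
      have "x = (\<Sum>v\<in>V. a v (b {v}))" using b(2)[of "{}"] by (simp add: k0 c_def)
      moreover have "\<forall>v\<in>V. b {v} \<in> P (t - 1)" using chainsD(1)[OF b(1)] by simp
      ultimately show "\<exists>y. (\<forall>v\<in>V. y v \<in> P (t - 1)) \<and> x = (\<Sum>v\<in>V. a v (y v))"
        by (intro exI[of _ "\<lambda>v. b {v}"]) simp
    qed
  next
    assume R: "\<forall>x\<in>P t. \<exists>y. (\<forall>v\<in>V. y v \<in> P (t - 1)) \<and> x = (\<Sum>v\<in>V. a v (y v))"
    show "kexact V a P Z0 0 t"
      unfolding kexact_def
    proof (intro ballI impI)
      fix c assume c: "c \<in> chains V (P t) 0"
      then have "c {} \<in> P t" by (intro chains_mem[OF c] graded_subD(1)[OF P])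
      then obtain y where y: "\<And>v. v \<in> V \<Longrightarrow> y v \<in> P (t - 1)" "c {} = (\<Sum>v\<in>V. a v (y v))" using R by blast
      define b where "b A = (if A \<subseteq> V \<and> card A = 1 then y (THE v. A = {v}) else 0)" for A
      have bv: "b {v} = y v" if "v \<in> V" for v using that by (simp add: b_def)
      have b: "b \<in> chains V (P (t - 1)) (Suc 0)"
      proof (rule chainsI)
        fix A assume A: "A \<subseteq> V" "card A = Suc 0"
        then obtain v where "A = {v}" "v \<in> V" using card_Suc_eq[of A 0] by auto
        then show "b A \<in> P (t - 1)" using y bv by simp
      next
        fix A assume A: "\<not> (A \<subseteq> V \<and> card A = Suc 0)"
        then show "b A = 0" by (auto simp: b_def)
      qed
      have "c C - kdiff V a b C \<in> {0}" for C
      proof (cases "C = {}")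
        case True
        then show ?thesis using y(2) bv by (simp add: k0)
      next
        case False
        then have C: "\<not> (C \<subseteq> V \<and> card C = 0)" using finite_subset[OF _ finV, of C] by (metis card_eq_0_iff)
        then show ?thesis using chainsD(2)[OF c C] kdiff_outside[OF finV b C] by simp
      qed
      then show "\<exists>b\<in>chains V (P (t - 1)) (Suc 0). \<forall>C. c C - kdiff V a b C \<in> {0}" using b by blast
    qed
  qed
qed

end

text \<open>\<open>total\<close> is merely a sum of pieces inside an ambient type; this condition
  makes it direct.\<close>

definition indep_pieces :: "(int \<Rightarrow> 'm::comm_monoid_add set) \<Rightarrow> bool" where
  "indep_pieces P \<longleftrightarrow> (\<forall>T x. finite T \<longrightarrow> (\<forall>t\<in>T. x t \<in> P t) \<longrightarrow> sum x T = 0 \<longrightarrow> (\<forall>t\<in>T. x t = 0))"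

lemma indep_piecesD: "indep_pieces P \<Longrightarrow> finite T \<Longrightarrow> (\<And>t. t \<in> T \<Longrightarrow> x t \<in> P t) \<Longrightarrow> sum x T = 0 \<Longrightarrow> t \<in> T \<Longrightarrow> x t = 0"
  unfolding indep_pieces_def by blast

lemma indep_pieces_component:
  assumes "indep_pieces P" "graded_sub V a P" "finite T" "\<And>s. s \<in> T \<Longrightarrow> x s \<in> P s" "sum x T = z" "z \<in> P t"
  shows "z = (if t \<in> T then x t else 0)"
proof -
  let ?x = "\<lambda>s. (if s \<in> T then x s else 0) - (if s = t then z else 0)"
  have "sum ?x (insert t T) = (\<Sum>s\<in>insert t T. if s \<in> T then x s else 0) - (\<Sum>s\<in>insert t T. if s = t then z else 0)"
    by (rule sum_subtractf)
  also have "(\<Sum>s\<in>insert t T. if s \<in> T then x s else 0) = sum x T"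
    by (rule sum.mono_neutral_cong_right) (use assms(3) in auto)
  also have "(\<Sum>s\<in>insert t T. if s = t then z else 0) = z" using assms(3) by simp
  finally have "sum ?x (insert t T) = 0" using assms(5) by simp
  then have "?x t = 0"
  proof (rule indep_piecesD[OF assms(1), rotated 2])
    show "?x s \<in> P s" for s
      using assms(4,6) graded_subD(1,2)[OF assms(2)] by (auto simp: graded_subD(3)[OF assms(2)])
  qed (use assms(3) in auto)
  then show ?thesis by (simp split: if_splits)
qed

lemma indep_pieces_forms: "indep_pieces (\<lambda>t. forms X (t * int d) :: ('v, 'k::comm_monoid_add) mpoly set)" if "d \<noteq> 0"
  unfolding indep_pieces_def
proof (intro allI impI ballI)
  fix T and x :: "int \<Rightarrow> ('v, 'k) mpoly" and t
  assume T: "finite T" "\<forall>t\<in>T. x t \<in> forms X (t * int d)" "sum x T = 0" "t \<in> T"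
  show "x t = 0"
  proof (rule poly_mapping_eqI, rule ccontr)
    fix u assume nz: "lk (x t) u \<noteq> lk 0 u"
    then have u: "int (mdeg u) = t * int d" using T by (auto simp: forms_iff)
    have "0 = (\<Sum>s\<in>T. lk (x s) u)" using T(3) by (metis lookup_sum lookup_zero)
    also have "\<dots> = (\<Sum>s\<in>T. if s = t then lk (x t) u else 0)"
    proof (rule sum.cong[OF refl])
      fix s assume s: "s \<in> T"
      have "lk (x s) u = 0" if "s \<noteq> t"
      proof (rule ccontr)
        assume "lk (x s) u \<noteq> 0"
        then have "int (mdeg u) = s * int d" using T(2) s by (auto simp: forms_iff)
        then show False using u that \<open>d \<noteq> 0\<close> by simp
      qed
      then show "lk (x s) u = (if s = t then lk (x t) u else 0)" by auto
    qed
    also have "\<dots> = lk (x t) u" using T by simp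
    finally show False using nz by simp
  qed
qed

lemma indep_pieces_fpiece: "indep_pieces (fpiece V b :: int \<Rightarrow> ('v, 'k::comm_ring_1) vec set)"
  unfolding indep_pieces_def
proof (intro allI impI ballI)
  fix T and x :: "int \<Rightarrow> ('v, 'k) vec" and t
  assume T: "finite T" "\<forall>t\<in>T. x t \<in> fpiece V b t" "sum x T = 0" "t \<in> T"
  show "x t = 0"
  proof
    fix l :: "int \<times> nat"
    obtain j k where l: "l = (j, k)" by (cases l)
    show "x t l = 0 l"
    proof (cases "k < b j")
      case True
      have inj: "inj_on (\<lambda>t. t - j) T" by (auto simp: inj_on_def)
      have "(\<lambda>t. x (t + j) l) (t - j) = 0"
      proof (rule indep_piecesD[OF indep_pieces_forms[of 1 V], where x = "\<lambda>t. x (t + j) l" and T = "(\<lambda>t. t - j) ` T"])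
        show "finite ((\<lambda>t. t - j) ` T)" using T by simp
        show "x (s + j) l \<in> forms V (s * int 1)" if s: "s \<in> (\<lambda>t. t - j) ` T" for s
        proof -
          obtain r where r: "r \<in> T" "s = r - j" using s by blast
          then have "x r l \<in> forms V (r - j)" using T(2) True by (auto simp: fpiece_def l)
          then show ?thesis using r by simp
        qed
        show "(\<Sum>t\<in>(\<lambda>t. t - j) ` T. x (t + j) l) = 0"
          using T(3) by (simp add: sum.reindex[OF inj] flip: sum_fun_apply)
      qed (use T in auto)
      then show ?thesis by simp
    next
      case False
      then show ?thesis using T by (simp add: fpiece_def l)
    qed
  qed
qed

lemma indep_pieces_mono: "indep_pieces P \<Longrightarrow> (\<And>t. Q t \<subseteq> P t) \<Longrightarrow> indep_pieces Q"
  unfolding indep_pieces_def by blast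

section \<open>Minimal covers\<close>

abbreviation "const c \<equiv> Poly_Mapping.single 0 c"
abbreviation "vr v \<equiv> monomial (Poly_Mapping.single v (Suc 0))"

text \<open>The last clause is minimality: homogeneous kernel elements have no constant
  terms.\<close>

definition is_cover :: "'v set \<Rightarrow> (('v, 'k::comm_ring_1) mpoly \<Rightarrow> 'm \<Rightarrow> 'm::ab_group_add) \<Rightarrow> (int \<Rightarrow> 'm set)
    \<Rightarrow> (int \<Rightarrow> nat) \<Rightarrow> (('v, 'k) vec \<Rightarrow> 'm) \<Rightarrow> bool" where
  "is_cover V sc P b f \<longleftrightarrow> finite {j. b j \<noteq> 0} \<and> (\<forall>x y. f (x + y) = f x + f y) \<and>
     (\<forall>s x. f (\<lambda>i. s * x i) = sc s (f x)) \<and> (\<forall>t. f ` fpiece V b t = P t) \<and>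
     (\<forall>t. \<forall>w\<in>fpiece V b t. f w = 0 \<longrightarrow> (\<forall>l. lk (w l) 0 = 0))"

lemma sum_single_keys: "(\<Sum>u\<in>Poly_Mapping.keys p. Poly_Mapping.single u (lk p u)) = p"
proof (rule poly_mapping_eqI)
  fix w
  have "lk (\<Sum>u\<in>Poly_Mapping.keys p. Poly_Mapping.single u (lk p u)) w = (\<Sum>u\<in>Poly_Mapping.keys p. if u = w then lk p w else 0)"
    unfolding lookup_sum by (rule sum.cong) (auto simp: lookup_single when_def)
  also have "\<dots> = lk p w" by (auto simp: in_keys_iff)
  finally show "lk (\<Sum>u\<in>Poly_Mapping.keys p. Poly_Mapping.single u (lk p u)) w = lk p w" .
qed

locale graded_mod = polynomial_ring V + module sc
  for V :: "'v::linorder set" and sc :: "('v, 'k::field) mpoly \<Rightarrow> 'm \<Rightarrow> 'm::ab_group_add" +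
  fixes P :: "int \<Rightarrow> 'm set"
  assumes sub: "graded_sub V (\<lambda>v. sc (vr v)) P"
    and const_mem: "x \<in> P t \<Longrightarrow> sc (const c) x \<in> P t"
    and indep: "indep_pieces P"
    and bounded_below: "\<exists>lb. \<forall>t<lb. P t \<subseteq> {0}"
    and findim: "\<exists>B. finite B \<and> (\<forall>x\<in>P t. \<exists>a. x = (\<Sum>y\<in>B. sc (const (a y)) y))"
begin

lemma commuting: "commuting_action (\<lambda>v. sc (vr v))"
  by unfold_locales (simp_all add: scale_right_distrib mult.commute)

abbreviation "exact n t \<equiv> kexact V (\<lambda>v. sc (vr v)) P Z0 n t"

text \<open>The degree \<open>t\<close> part of the irrelevant ideal times the module.\<close>

definition decomposable :: "int \<Rightarrow> 'm set" where
  "decomposable t = {x. \<exists>y. (\<forall>v\<in>V. y v \<in> P (t - 1)) \<and> x = (\<Sum>v\<in>V. sc (vr v) (y v))}"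

lemma kex_0_iff: "exact 0 t \<longleftrightarrow> P t \<subseteq> decomposable t"
  using kexact_0_iff[OF commuting sub, of t] unfolding decomposable_def by blast

lemma decomposable_0: "0 \<in> decomposable t"
  unfolding decomposable_def using graded_subD(1)[OF sub] by (auto intro!: exI[of _ "\<lambda>_. 0"])

lemma decomposable_add: "x \<in> decomposable t \<Longrightarrow> y \<in> decomposable t \<Longrightarrow> x + y \<in> decomposable t"
proof -
  assume "x \<in> decomposable t" "y \<in> decomposable t"
  then obtain f g where f: "\<forall>v\<in>V. f v \<in> P (t - 1)" "x = (\<Sum>v\<in>V. sc (vr v) (f v))"
    and g: "\<forall>v\<in>V. g v \<in> P (t - 1)" "y = (\<Sum>v\<in>V. sc (vr v) (g v))" unfolding decomposable_def by blast
  then have "\<forall>v\<in>V. f v + g v \<in> P (t - 1)" "x + y = (\<Sum>v\<in>V. sc (vr v) (f v + g v))"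
    using graded_subD(4)[OF sub] by (auto simp: scale_right_distrib sum.distrib)
  then show "x + y \<in> decomposable t" unfolding decomposable_def by (intro CollectI exI[of _ "\<lambda>v. f v + g v"] conjI)
qed

lemma decomposable_sum: "(\<And>i. i \<in> S \<Longrightarrow> f i \<in> decomposable t) \<Longrightarrow> sum f S \<in> decomposable t"
  by (induction S rule: infinite_finite_induct) (auto intro: decomposable_0 decomposable_add)

lemma decomposable_const: "x \<in> decomposable t \<Longrightarrow> sc (const c) x \<in> decomposable t"
proof -
  assume "x \<in> decomposable t"
  then obtain f where f: "\<forall>v\<in>V. f v \<in> P (t - 1)" "x = (\<Sum>v\<in>V. sc (vr v) (f v))" unfolding decomposable_def by blast
  then have "\<forall>v\<in>V. sc (const c) (f v) \<in> P (t - 1)" "sc (const c) x = (\<Sum>v\<in>V. sc (vr v) (sc (const c) (f v)))"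
    by (auto simp: const_mem scale_sum_right mult.commute)
  then show "sc (const c) x \<in> decomposable t" unfolding decomposable_def by (auto intro!: exI[of _ "\<lambda>v. sc (const c) (f v)"])
qed

lemma decomposable_minus: "x \<in> decomposable t \<Longrightarrow> - x \<in> decomposable t"
  using decomposable_const[of x t "- 1"] by (simp add: single_uminus)

lemma decomposable_subset: "decomposable t \<subseteq> P t"
proof
  fix x assume "x \<in> decomposable t"
  then obtain f where f: "\<And>v. v \<in> V \<Longrightarrow> f v \<in> P (t - 1)" "x = (\<Sum>v\<in>V. sc (vr v) (f v))" unfolding decomposable_def by blast
  have "sc (vr v) (f v) \<in> P t" if "v \<in> V" for v using graded_subD(5)[OF sub that f(1)[OF that]] by simp
  then show "x \<in> P t" unfolding f(2) by (rule graded_sub_sum[OF sub])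
qed

lemma decomposable_var: "v \<in> V \<Longrightarrow> x \<in> P (t - 1) \<Longrightarrow> sc (vr v) x \<in> decomposable t"
  unfolding decomposable_def
  by (intro CollectI exI[of _ "\<lambda>u. if u = v then x else 0"])
    (auto simp: finV if_distrib[of "sc _"] graded_subD(1)[OF sub] cong: if_cong)

lemma single_split:
  assumes "v \<in> Poly_Mapping.keys u"
  shows "Poly_Mapping.single u c = vr v * Poly_Mapping.single (u - Poly_Mapping.single v (Suc 0)) (c :: 'k)"
    and "mdeg u = Suc (mdeg (u - Poly_Mapping.single v (Suc 0)))"
proof -
  have "mdiv (Poly_Mapping.single v (Suc 0)) u"
    using assms by (auto simp: mdiv_def lookup_single when_def in_keys_iff)
  then have "Poly_Mapping.single v (Suc 0) + (u - Poly_Mapping.single v (Suc 0)) = u" by (rule mdiv_diff)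
  then show "Poly_Mapping.single u c = vr v * Poly_Mapping.single (u - Poly_Mapping.single v (Suc 0)) c"
    and "mdeg u = Suc (mdeg (u - Poly_Mapping.single v (Suc 0)))"
    by (simp add: mult_single, metis mdeg_add mdeg_single plus_1_eq_Suc One_nat_def)
qed

lemma monomial_mem:
  "Poly_Mapping.keys u \<subseteq> V \<Longrightarrow> x \<in> P t \<Longrightarrow> sc (Poly_Mapping.single u c) x \<in> P (t + int (mdeg u))"
proof (induction "mdeg u" arbitrary: u)
  case 0
  then have "u = 0" by (metis mdeg_eq_0_iff)
  then show ?case using 0 by (simp add: const_mem)
next
  case (Suc n)
  then have "u \<noteq> 0" by auto
  then obtain v where v: "v \<in> Poly_Mapping.keys u" by (metis all_not_in_conv keys_eq_empty poly_mapping_eqI in_keys_iff lookup_zero)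
  let ?u = "u - Poly_Mapping.single v (Suc 0)"
  have "sc (Poly_Mapping.single ?u c) x \<in> P (t + int (mdeg ?u))"
    using Suc single_split(2)[OF v] keys_minus_subset[of u "Poly_Mapping.single v (Suc 0)"] by auto
  then have "sc (vr v) (sc (Poly_Mapping.single ?u c) x) \<in> P (t + int (mdeg ?u) + 1)"
    using graded_subD(5)[OF sub] Suc.prems v by blast
  moreover have "t + int (mdeg ?u) + 1 = t + int (mdeg u)" using single_split(2)[OF v] by simp
  ultimately show ?case unfolding single_split(1)[OF v, of c] scale_scale[symmetric] by simp
qed

lemma form_mem:
  assumes "s \<in> forms V r" "x \<in> P t"
  shows "sc s x \<in> P (t + r)"
proof -
  have "sc s x = (\<Sum>u\<in>Poly_Mapping.keys s. sc (Poly_Mapping.single u (lk s u)) x)"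
    by (subst sum_single_keys[of s, symmetric]) (rule scale_sum_left)
  also have "\<dots> \<in> P (t + r)"
  proof (rule graded_sub_sum[OF sub])
    fix u assume "u \<in> Poly_Mapping.keys s"
    then have "Poly_Mapping.keys u \<subseteq> V" "int (mdeg u) = r" using assms(1) by (auto simp: forms_iff in_keys_iff)
    then show "sc (Poly_Mapping.single u (lk s u)) x \<in> P (t + r)" using monomial_mem[OF _ assms(2)] by blast
  qed
  finally show ?thesis .
qed

lemma form_dec:
  assumes "s \<in> forms V r" "r \<noteq> 0" "x \<in> P t"
  shows "sc s x \<in> decomposable (t + r)"
proof -
  have "sc s x = (\<Sum>u\<in>Poly_Mapping.keys s. sc (Poly_Mapping.single u (lk s u)) x)"
    by (subst sum_single_keys[of s, symmetric]) (rule scale_sum_left)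
  also have "\<dots> \<in> decomposable (t + r)"
  proof (rule decomposable_sum)
    fix u assume "u \<in> Poly_Mapping.keys s"
    then have u: "Poly_Mapping.keys u \<subseteq> V" "int (mdeg u) = r" using assms(1) by (auto simp: forms_iff in_keys_iff)
    then have "u \<noteq> 0" using assms(2) by auto
    then obtain v where v: "v \<in> Poly_Mapping.keys u" by (metis all_not_in_conv keys_eq_empty poly_mapping_eqI in_keys_iff lookup_zero)
    let ?u = "u - Poly_Mapping.single v (Suc 0)"
    have "sc (Poly_Mapping.single ?u (lk s u)) x \<in> P (t + int (mdeg ?u))"
      by (rule monomial_mem[OF _ assms(3)]) (use u keys_minus_subset[of u "Poly_Mapping.single v (Suc 0)"] in auto)
    moreover have "t + int (mdeg ?u) = t + r - 1" using single_split(2)[OF v] u by simp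
    ultimately have m: "sc (Poly_Mapping.single ?u (lk s u)) x \<in> P (t + r - 1)" by (simp only:)
    have "sc (vr v) (sc (Poly_Mapping.single ?u (lk s u)) x) \<in> decomposable (t + r)"
      by (intro decomposable_var m) (use u v in blast)
    then show "sc (Poly_Mapping.single u (lk s u)) x \<in> decomposable (t + r)"
      unfolding single_split(1)[OF v, of "lk s u"] scale_scale[symmetric] .
  qed
  finally show ?thesis .
qed

lemma vector_space_const: "vector_space (\<lambda>c. sc (const c))"
  by unfold_locales (simp_all add: scale_right_distrib scale_left_distrib single_add mult_single)

text \<open>A basis of \<open>decomposable j\<close> is extended to a basis of \<open>P j\<close>;
  the added vectors are the minimal generators of degree \<open>j\<close>.\<close>

lemma exists_generators:
  "\<exists>(n::nat) g. (\<forall>k<n. g k \<in> P j) \<and> (P j \<subseteq> decomposable j \<longrightarrow> n = 0) \<and>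
     (\<forall>x\<in>P j. \<exists>a. x - (\<Sum>k<n. sc (const (a k)) (g k)) \<in> decomposable j) \<and>
     (\<forall>a. (\<Sum>k<n. sc (const (a k)) (g k)) \<in> decomposable j \<longrightarrow> (\<forall>k<n. a k = 0))"
proof (cases "P j \<subseteq> decomposable j")
  case True
  then show ?thesis by (intro exI[of _ 0]) auto
next
  case False
  interpret K: vector_space "\<lambda>c. sc (const c)" by (rule vector_space_const)
  from findim[of j] obtain B where B: "finite B" "\<forall>x\<in>P j. \<exists>a. x = (\<Sum>y\<in>B. sc (const (a y)) y)" by (elim exE conjE)
  have PB: "P j \<subseteq> K.span B"
  proof
    fix x assume "x \<in> P j"
    with B(2) obtain a where "x = (\<Sum>y\<in>B. sc (const (a y)) y)" by (elim ballE exE) blast+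
    moreover have "\<dots> \<in> K.span B" by (intro K.span_sum K.span_scale K.span_base)
    ultimately show "x \<in> K.span B" by simp
  qed
  obtain D where D: "D \<subseteq> decomposable j" "K.independent D" "decomposable j \<subseteq> K.span D"
    using K.maximal_independent_subset[of "decomposable j"] by blast
  have "D \<subseteq> P j" using D(1) decomposable_subset by blast
  then obtain C where C: "D \<subseteq> C" "C \<subseteq> P j" "K.independent C" "P j \<subseteq> K.span C"
    using K.maximal_independent_subset_extend[OF _ D(2)] by blast
  have fC: "finite C" using K.independent_span_bound[OF B(1) C(3)] C(2) PB by blast
  have decsub: "K.subspace (decomposable j)"
    unfolding K.subspace_def using decomposable_0 decomposable_add decomposable_const by blast
  have spanD: "K.span D = decomposable j" using D by (intro antisym K.span_minimal decsub)
  define G where "G = C - D"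
  have fG: "finite G" using fC by (simp add: G_def)
  obtain g where g: "bij_betw g {..<card G} G" using ex_bij_betw_nat_finite[OF fG] by (auto simp: atLeast0LessThan)
  show ?thesis
  proof (intro exI[of _ "card G"] exI[of _ g] conjI allI impI ballI)
    show "g k \<in> P j" if "k < card G" for k using g that C(2) by (auto simp: bij_betw_def G_def)
    show "card G = 0" if "P j \<subseteq> decomposable j" using that False by blast
    fix x assume "x \<in> P j"
    then have "x \<in> K.span (D \<union> G)" using C by (simp add: G_def Un_absorb1 subset_iff)
    then obtain y z where yz: "x = y + z" "y \<in> K.span D" "z \<in> K.span G" unfolding K.span_Un by blast
    obtain a where a: "z = (\<Sum>y\<in>G. sc (const (a y)) y)" using yz(3) unfolding K.span_finite[OF fG] by blast
    have "z = (\<Sum>k<card G. sc (const (a (g k))) (g k))"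
      unfolding a using sum.reindex_bij_betw[OF g, of "\<lambda>y. sc (const (a y)) y"] by simp
    then have "x - (\<Sum>k<card G. sc (const (a (g k))) (g k)) \<in> decomposable j" using yz spanD by simp
    then show "\<exists>a. x - (\<Sum>k<card G. sc (const (a k)) (g k)) \<in> decomposable j" by (rule exI[of _ "\<lambda>k. a (g k)"])
  next
    fix a k0 assume s: "(\<Sum>k<card G. sc (const (a k)) (g k)) \<in> decomposable j" and k0: "k0 < card G"
    show "a k0 = 0"
    proof (rule ccontr)
      assume nz: "a k0 \<noteq> 0"
      have g0: "g k0 \<in> G" using g k0 by (auto simp: bij_betw_def)
      let ?C = "C - {g k0}"
      have DC: "D \<subseteq> ?C" using C(1) g0 by (auto simp: G_def)
      have s1: "(\<Sum>k<card G. sc (const (a k)) (g k)) \<in> K.span ?C"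
        using s K.span_mono[OF DC] by (auto simp: spanD)
      have s2: "(\<Sum>k\<in>{..<card G} - {k0}. sc (const (a k)) (g k)) \<in> K.span ?C"
      proof (intro K.span_sum K.span_scale K.span_base)
        fix k assume k: "k \<in> {..<card G} - {k0}"
        then have "g k \<noteq> g k0" "g k \<in> G" using g k0 by (auto simp: bij_betw_def inj_on_def)
        then show "g k \<in> ?C" by (auto simp: G_def)
      qed
      have "(\<Sum>k<card G. sc (const (a k)) (g k)) = sc (const (a k0)) (g k0) + (\<Sum>k\<in>{..<card G} - {k0}. sc (const (a k)) (g k))"
        using k0 by (intro sum.remove) auto
      then have "sc (const (a k0)) (g k0) \<in> K.span ?C" using K.span_diff[OF s1 s2] by simp
      then have "sc (const (1 / a k0)) (sc (const (a k0)) (g k0)) \<in> K.span ?C" by (rule K.span_scale)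
      then have "g k0 \<in> K.span ?C" using nz by (simp add: mult_single)
      then show False using C(3) g0 unfolding K.dependent_def by (auto simp: G_def)
    qed
  qed
qed

text \<open>Graded Nakayama. Surjectivity follows by induction on the degree. For minimality, an
  element of degree \<open>t\<close> has constant terms only at the generators of degree
  \<open>t\<close>; if it maps to 0, these constants give a relation modulo decomposables, and
  \<open>ind\<close> makes them zero.\<close>

lemma cover_of_generators:
  fixes g :: "int \<times> nat \<Rightarrow> 'm"
  assumes fin: "finite {j. b j \<noteq> 0}" and g: "\<And>j k. k < b j \<Longrightarrow> g (j, k) \<in> P j"
    and gen: "\<And>j x. x \<in> P j \<Longrightarrow> \<exists>a. x - (\<Sum>k<b j. sc (const (a k)) (g (j, k))) \<in> decomposable j"
    and ind: "\<And>j a k. (\<Sum>k<b j. sc (const (a k)) (g (j, k))) \<in> decomposable j \<Longrightarrow> k < b j \<Longrightarrow> a k = 0"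
  shows "is_cover V sc P b (\<lambda>w. \<Sum>l\<in>(SIGMA j:{j. b j \<noteq> 0}. {..<b j}). sc (w l) (g l))"
proof -
  define L where "L = (SIGMA j:{j. b j \<noteq> 0}. {..<b j})"
  have finL: "finite L" using fin by (simp add: L_def)
  have L_iff: "(j, k) \<in> L \<longleftrightarrow> k < b j" for j k by (auto simp: L_def)
  define f where "f w = (\<Sum>l\<in>L. sc (w l) (g l))" for w
  have f_add: "f (x + y) = f x + f y" for x y by (simp add: f_def scale_left_distrib sum.distrib)
  have f_sc: "f (\<lambda>i. s * x i) = sc s (f x)" for s x by (simp add: f_def scale_sum_right)
  have f_0: "f 0 = 0" by (simp add: f_def)
  have f_sum: "f (sum h S) = (\<Sum>i\<in>S. f (h i))" for h and S :: "'v set"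
    by (induction S rule: infinite_finite_induct) (simp_all only: f_add f_0 sum.infinite sum.empty sum.insert not_False_eq_True)
  have term_mem: "sc (w (j, k)) (g (j, k)) \<in> P t" if "w \<in> fpiece V b t" "k < b j" for w j k t
    using form_mem[of "w (j, k)" "t - j" "g (j, k)" j] g[OF that(2)] that by (auto simp: fpiece_def)
  have f_mem: "f w \<in> P t" if "w \<in> fpiece V b t" for w t
    unfolding f_def by (rule graded_sub_sum[OF sub]) (use term_mem[OF that] L_iff in auto)
  have diag: "(\<Sum>l\<in>{l \<in> L. fst l = t}. sc (w l) (g l)) = (\<Sum>k<b t. sc (w (t, k)) (g (t, k)))" for w t
    by (rule sum.reindex_bij_witness[of _ "\<lambda>k. (t, k)" snd]) (auto simp: L_iff)
  have f_surj: "P t \<subseteq> f ` fpiece V b t" for t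
  proof -
    obtain lb where lb: "\<And>t. t < lb \<Longrightarrow> P t \<subseteq> {0}" using bounded_below by blast
    have "\<forall>t. t < lb + int n \<longrightarrow> P t \<subseteq> f ` fpiece V b t" for n
    proof (induction n)
      case 0
      have "0 \<in> f ` fpiece V b t" for t using f_0 graded_subD(1)[OF fpiece_graded_sub] by (metis imageI)
      then show ?case using lb by fastforce
    next
      case (Suc n)
      show ?case
      proof (intro allI impI subsetI)
        fix t x assume t: "t < lb + int (Suc n)" and x: "x \<in> P t"
        obtain a where "x - (\<Sum>k<b t. sc (const (a k)) (g (t, k))) \<in> decomposable t" using gen[OF x] by blast
        then obtain y where y: "\<And>v. v \<in> V \<Longrightarrow> y v \<in> P (t - 1)"
          "x - (\<Sum>k<b t. sc (const (a k)) (g (t, k))) = (\<Sum>v\<in>V. sc (vr v) (y v))" unfolding decomposable_def by blast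
        have "P (t - 1) \<subseteq> f ` fpiece V b (t - 1)" using Suc t by simp
        then have "\<forall>v\<in>V. \<exists>w. w \<in> fpiece V b (t - 1) \<and> y v = f w" using y(1) by blast
        then obtain w where w: "\<And>v. v \<in> V \<Longrightarrow> w v \<in> fpiece V b (t - 1)" "\<And>v. v \<in> V \<Longrightarrow> y v = f (w v)" by metis
        define w0 :: "('v, 'k) vec" where "w0 = (\<lambda>(j, k). if j = t \<and> k < b j then const (a k) else 0)"
        have w0: "w0 \<in> fpiece V b t"
          by (auto simp: fpiece_def w0_def forms_iff lookup_single when_def)
        have "f w0 = (\<Sum>l\<in>{l \<in> L. fst l = t}. sc (w0 l) (g l))"
          unfolding f_def by (rule sum.mono_neutral_right) (use finL in \<open>auto simp: w0_def split: if_splits\<close>)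
        also have "\<dots> = (\<Sum>k<b t. sc (w0 (t, k)) (g (t, k)))" by (rule diag)
        also have "\<dots> = (\<Sum>k<b t. sc (const (a k)) (g (t, k)))" by (rule sum.cong) (auto simp: w0_def)
        finally have fw0: "f w0 = (\<Sum>k<b t. sc (const (a k)) (g (t, k)))" .
        have "(\<Sum>v\<in>V. vact v (w v)) \<in> fpiece V b t"
        proof (rule graded_sub_sum[OF fpiece_graded_sub])
          fix v assume "v \<in> V"
          then show "vact v (w v) \<in> fpiece V b t"
            using graded_subD(5)[OF fpiece_graded_sub, of v "w v" b "t - 1"] w(1) by simp
        qed
        then have "w0 + (\<Sum>v\<in>V. vact v (w v)) \<in> fpiece V b t" by (rule graded_subD(4)[OF fpiece_graded_sub w0])
        moreover have "f (w0 + (\<Sum>v\<in>V. vact v (w v))) = x"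
        proof -
          have "(\<Sum>v\<in>V. f (vact v (w v))) = (\<Sum>v\<in>V. sc (vr v) (y v))"
            by (rule sum.cong) (simp_all add: vact_def f_sc w(2))
          then show ?thesis unfolding f_add f_sum fw0 using y(2) by (simp add: algebra_simps)
        qed
        ultimately show "x \<in> f ` fpiece V b t" by blast
      qed
    qed
    from this[of "nat (t - lb + 1)"] show ?thesis by (cases "t < lb") auto
  qed
  have min: "lk (w l) 0 = 0" if w: "w \<in> fpiece V b t" and fw: "f w = 0" for w t l
  proof -
    obtain j k where l: "l = (j, k)" by (cases l)
    show ?thesis
    proof (cases "k < b j \<and> j = t")
      case False
      show ?thesis
      proof (cases "k < b j")
        case True
        then have "w (j, k) \<in> forms V (t - j)" "j \<noteq> t" using w False by (auto simp: fpiece_def)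
        then show ?thesis unfolding l forms_iff by force
      qed (use w in \<open>simp add: l fpiece_def\<close>)
    next
      case True
      have wc: "w (t, k) = const (lk (w (t, k)) 0)" if "k < b t" for k
      proof (rule poly_mapping_eqI)
        fix u
        have "w (t, k) \<in> forms V (t - t)" using w that unfolding fpiece_def by blast
        then show "lk (w (t, k)) u = lk (const (lk (w (t, k)) 0)) u"
          by (auto simp: forms_iff mdeg_eq_0_iff lookup_single when_def)
      qed
      have "f w = (\<Sum>l\<in>{l \<in> L. fst l = t} \<union> {l \<in> L. fst l \<noteq> t}. sc (w l) (g l))"
        unfolding f_def by (rule sum.cong) auto
      also have "\<dots> = (\<Sum>l\<in>{l \<in> L. fst l = t}. sc (w l) (g l)) + (\<Sum>l\<in>{l \<in> L. fst l \<noteq> t}. sc (w l) (g l))"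
        by (rule sum.union_disjoint) (use finL in auto)
      also have "(\<Sum>l\<in>{l \<in> L. fst l = t}. sc (w l) (g l)) = (\<Sum>k<b t. sc (const (lk (w (t, k)) 0)) (g (t, k)))"
        unfolding diag by (rule sum.cong) (use wc in auto)
      finally have "(\<Sum>k<b t. sc (const (lk (w (t, k)) 0)) (g (t, k))) = - (\<Sum>l\<in>{l \<in> L. fst l \<noteq> t}. sc (w l) (g l))"
        using fw by (simp add: eq_neg_iff_add_eq_0)
      also have "\<dots> \<in> decomposable t"
      proof (intro decomposable_minus decomposable_sum)
        fix l assume l: "l \<in> {l \<in> L. fst l \<noteq> t}"
        obtain j k where jk: "l = (j, k)" by (cases l)
        then have "k < b j" "j \<noteq> t" using l L_iff by auto
        then show "sc (w l) (g l) \<in> decomposable t"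
          using form_dec[of "w (j, k)" "t - j" "g (j, k)" j] g w by (auto simp: fpiece_def jk)
      qed
      finally have D: "(\<Sum>k<b t. sc (const (lk (w (t, k)) 0)) (g (t, k))) \<in> decomposable t" .
      have "k < b t" using True by auto
      then have "lk (w (t, k)) 0 = 0" by (rule ind[OF D])
      then show ?thesis using True by (simp add: l)
    qed
  qed
  have "is_cover V sc P b f"
    unfolding is_cover_def using fin f_add f_sc f_mem f_surj min by blast
  then show ?thesis by (simp add: f_def[abs_def] L_def)
qed

lemma exists_cover:
  assumes "finite {t. \<not> exact 0 t}"
  shows "\<exists>b f. is_cover V sc P b f \<and> (\<forall>j. b j \<noteq> 0 \<longrightarrow> \<not> exact 0 j)"
proof -
  define Q where "Q j n g \<longleftrightarrow> (\<forall>k<n. g k \<in> P j) \<and> (P j \<subseteq> decomposable j \<longrightarrow> n = 0) \<and>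
     (\<forall>x\<in>P j. \<exists>a. x - (\<Sum>k<n. sc (const (a k)) (g k)) \<in> decomposable j) \<and>
     (\<forall>a. (\<Sum>k<n. sc (const (a k)) (g k)) \<in> decomposable j \<longrightarrow> (\<forall>k<n. a k = 0))" for j and n :: nat and g
  have "\<exists>n g. Q j n g" for j unfolding Q_def by (rule exists_generators)
  then obtain b g where "\<And>j. Q j (b j) (g j)" by metis
  then have g: "\<And>j k. k < b j \<Longrightarrow> g j k \<in> P j" "\<And>j. P j \<subseteq> decomposable j \<Longrightarrow> b j = 0"
    "\<And>j x. x \<in> P j \<Longrightarrow> \<exists>a. x - (\<Sum>k<b j. sc (const (a k)) (g j k)) \<in> decomposable j"
    "\<And>j a k. (\<Sum>k<b j. sc (const (a k)) (g j k)) \<in> decomposable j \<Longrightarrow> k < b j \<Longrightarrow> a k = 0"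
    unfolding Q_def by blast+
  have b: "\<not> exact 0 j" if "b j \<noteq> 0" for j using g(2)[of j] that by (auto simp: kex_0_iff)
  have "finite {j. b j \<noteq> 0}" by (rule finite_subset[OF _ assms]) (use b in blast)
  then have "is_cover V sc P b (\<lambda>w. \<Sum>l\<in>(SIGMA j:{j. b j \<noteq> 0}. {..<b j}). sc (w l) ((\<lambda>(j, k). g j k) l))"
    by (rule cover_of_generators) (use g(1,3,4) in \<open>simp_all only: split_conv\<close>)
  then show ?thesis using b by blast
qed

end

section \<open>Existence of minimal resolutions\<close>

abbreviation vmod :: "('v, 'k::comm_ring_1) mpoly \<Rightarrow> ('v, 'k) vec \<Rightarrow> ('v, 'k) vec" where
  "vmod \<equiv> \<lambda>s w i. s * w i"

lemma module_vmod: "module (vmod :: ('v, 'k::comm_ring_1) mpoly \<Rightarrow> _)"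
  by unfold_locales (simp_all add: fun_eq_iff algebra_simps)

lemma vmod_vr: "(\<lambda>v. vmod (vr v)) = vact"
  by (simp add: vact_def fun_eq_iff)

definition kerp :: "'v set \<Rightarrow> (int \<Rightarrow> nat) \<Rightarrow> (('v, 'k::comm_ring_1) vec \<Rightarrow> 'm::zero) \<Rightarrow> int \<Rightarrow> ('v, 'k) vec set" where
  "kerp V b f t = {w \<in> fpiece V b t. f w = 0}"

lemma graded_mod_submodule:
  assumes "graded_mod V sc P" "\<And>t. Q t \<subseteq> P t" "graded_sub V (\<lambda>v. sc (vr v)) Q"
    "\<And>x t c. x \<in> Q t \<Longrightarrow> sc (const c) x \<in> Q t"
  shows "graded_mod V sc Q"
proof -
  interpret graded_mod V sc P by fact
  show ?thesis
  proof (intro graded_mod.intro graded_mod_axioms.intro)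
    show "polynomial_ring V" "module sc" by unfold_locales
    show "indep_pieces Q" by (rule indep_pieces_mono[OF indep assms(2)])
    show "\<exists>lb. \<forall>t<lb. Q t \<subseteq> {0}" using bounded_below assms(2) by (meson subset_trans)
    show "\<exists>B. finite B \<and> (\<forall>x\<in>Q t. \<exists>a. x = (\<Sum>y\<in>B. sc (const (a y)) y))" for t
      using findim[of t] assms(2) by (meson subsetD)
  qed (use assms in auto)
qed

context polynomial_ring
begin

lemma graded_mod_free:
  assumes fin: "finite {j. b j \<noteq> 0}"
  shows "graded_mod V vmod (fpiece V b :: int \<Rightarrow> ('v, 'k::field) vec set)"
proof (intro graded_mod.intro graded_mod_axioms.intro)
  show "polynomial_ring V" by unfold_locales
  show "module (vmod :: ('v, 'k) mpoly \<Rightarrow> _)" by (rule module_vmod)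
  show "graded_sub V (\<lambda>v. vmod (vr v)) (fpiece V b :: int \<Rightarrow> ('v, 'k) vec set)"
    unfolding vmod_vr by (rule fpiece_graded_sub)
  show "vmod (const c) x \<in> fpiece V b t" if "x \<in> fpiece V b t" for x :: "('v, 'k) vec" and t c
    using that by (auto simp: fpiece_def forms_iff)
  show "indep_pieces (fpiece V b :: int \<Rightarrow> ('v, 'k) vec set)" by (rule indep_pieces_fpiece)
  show "\<exists>lb. \<forall>t<lb. (fpiece V b t :: ('v, 'k) vec set) \<subseteq> {0}"
  proof -
    obtain lb where lb: "\<And>j. b j \<noteq> 0 \<Longrightarrow> lb \<le> j"
      using bdd_below_finite[OF fin] by (auto simp: bdd_below_def)
    have "w = 0" if t: "t < lb" and w: "w \<in> fpiece V b t" for t and w :: "('v, 'k) vec"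
    proof
      fix l :: "int \<times> nat"
      obtain j k where l: "l = (j, k)" by (cases l)
      show "w l = 0 l"
      proof (cases "k < b j")
        case True
        then have "lb \<le> j" using lb[of j] by simp
        moreover have "w (j, k) \<in> forms V (t - j)" using w True by (simp add: fpiece_def)
        ultimately show ?thesis using t unfolding l by (intro poly_mapping_eqI) (auto simp: forms_iff)
      qed (use w in \<open>simp add: fpiece_def l\<close>)
    qed
    then show ?thesis by blast
  qed
  fix t
  \<comment> \<open>Copies of \<open>S(-j)\<close> paired with monomials of degree
    \<open>t - j\<close>. For \<open>t < j\<close> the truncation by \<open>nat\<close> adds the
    constant monomial, whose coefficient is 0 throughout the piece.\<close>
  define J where "J = (SIGMA l:(SIGMA j:{j. b j \<noteq> 0}. {..<b j}). {u. Poly_Mapping.keys u \<subseteq> V \<and> mdeg u = nat (t - fst l)})"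
  have finJ: "finite J"
    unfolding J_def by (intro finite_SigmaI finite_monomials finV fin) auto
  define h :: "(int \<times> nat) \<times> ('v \<Rightarrow>\<^sub>0 nat) \<Rightarrow> ('v, 'k) vec" where "h = (\<lambda>(l, u) i. if i = l then monomial u else 0)"
  have h_lk: "lk (h (l, u) i) w = (if (l, u) = (i, w) then 1 else 0)" for l u i w
    by (auto simp: h_def lookup_single when_def)
  have inj: "inj_on h J"
  proof (rule inj_onI)
    fix p q assume "h p = h q"
    then have "lk (h (fst p, snd p) (fst q)) (snd q) = lk (h (fst q, snd q) (fst q)) (snd q)" by simp
    then show "p = q" unfolding h_lk by (simp split: if_splits)
  qed
  show "\<exists>B. finite B \<and> (\<forall>x\<in>(fpiece V b t :: ('v, 'k) vec set). \<exists>a. x = (\<Sum>y\<in>B. vmod (const (a y)) y))"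
  proof (intro exI[of _ "h ` J"] conjI ballI)
    show "finite (h ` J)" using finJ by simp
    fix x :: "('v, 'k) vec" assume x: "x \<in> fpiece V b t"
    define a where "a y = (case the_inv_into J h y of (l, u) \<Rightarrow> lk (x l) u)" for y
    have "x = (\<Sum>p\<in>J. vmod (const (a (h p))) (h p))"
    proof (intro ext poly_mapping_eqI)
      fix i w
      have "lk ((\<Sum>p\<in>J. vmod (const (a (h p))) (h p)) i) w = (\<Sum>p\<in>J. if p = (i, w) then lk (x i) w else 0)"
        unfolding sum_fun_apply lookup_sum
      proof (rule sum.cong[OF refl])
        fix p assume p: "p \<in> J"
        obtain l u where lu: "p = (l, u)" by (cases p)
        have "a (h p) = lk (x l) u" using p inj by (simp add: a_def the_inv_into_f_f lu)
        then show "lk (const (a (h p)) * h p i) w = (if p = (i, w) then lk (x i) w else 0)"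
          by (auto simp: lu h_lk)
      qed
      also have "\<dots> = lk (x i) w"
      proof (cases "lk (x i) w = 0")
        case False
        obtain j k where i: "i = (j, k)" by (cases i)
        have k: "k < b j" using x False by (metis (mono_tags, lifting) fpiece_def i lookup_zero mem_Collect_eq not_le)
        then have "x (j, k) \<in> forms V (t - j)" using x by (simp add: fpiece_def)
        then have "Poly_Mapping.keys w \<subseteq> V" "int (mdeg w) = t - j" using False by (auto simp: forms_iff i)
        then have "(i, w) \<in> J" using k by (auto simp: J_def i)
        then show ?thesis using finJ by simp
      qed (simp cong: if_cong)
      finally show "lk (x i) w = lk ((\<Sum>p\<in>J. vmod (const (a (h p))) (h p)) i) w" by simp
    qed
    also have "\<dots> = (\<Sum>y\<in>h ` J. vmod (const (a y)) y)" by (simp add: sum.reindex[OF inj])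
    finally show "\<exists>a. x = (\<Sum>y\<in>h ` J. vmod (const (a y)) y)" by blast
  qed
qed

end

lemma coverD:
  assumes "is_cover V sc P b f"
  shows "finite {j. b j \<noteq> 0}" "f (x + y) = f x + f y" "f (\<lambda>i. s * z i) = sc s (f z)" "f ` fpiece V b t = P t"
    "w \<in> fpiece V b t \<Longrightarrow> f w = 0 \<Longrightarrow> lk (w l) 0 = 0" "f 0 = 0"
proof -
  note a = assms[unfolded is_cover_def]
  show "finite {j. b j \<noteq> 0}" using a by (rule conjunct1)
  note a1 = a[THEN conjunct2, THEN conjunct1] and a2 = a[THEN conjunct2, THEN conjunct2, THEN conjunct1]
    and a3 = a[THEN conjunct2, THEN conjunct2, THEN conjunct2, THEN conjunct1]
    and a4 = a[THEN conjunct2, THEN conjunct2, THEN conjunct2, THEN conjunct2]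
  show add: "f (x + y) = f x + f y" for x y using a1[rule_format, of x y] .
  show "f (\<lambda>i. s * z i) = sc s (f z)" using a2[rule_format, of s z] .
  show "f ` fpiece V b t = P t" using a3[rule_format, of t] .
  show "lk (w l) 0 = 0" if "w \<in> fpiece V b t" "f w = 0" using a4[rule_format, OF that] .
  show "f 0 = 0" using add[of 0 0] by simp
qed

lemma graded_mod_cover_surjection:
  assumes "graded_mod V sc P" "is_cover V sc P b f"
  shows "graded_surjection vact (\<lambda>v. sc (vr v)) V (fpiece V b) P f"
proof -
  interpret graded_mod V sc P by fact
  note c = coverD[OF assms(2)]
  show ?thesis
  proof (intro graded_surjection.intro graded_surjection_axioms.intro)
    show "commuting_action vact" by (rule commuting_vact)
    show "commuting_action (\<lambda>v. sc (vr v))" by (rule commuting)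
    show "f (vact v x) = sc (vr v) (f x)" for v x by (simp add: vact_def c(3))
  qed (use c sub finV fpiece_graded_sub in auto)
qed

text \<open>Minimality puts the kernel among the vectors without constant terms, where
  \<open>free_boundary\<close> holds for every \<open>n\<close>, including 0. This is the assumption
  that \<open>kexact_ker\<close> asks for.\<close>

lemma cover_kernel:
  assumes M: "graded_mod V sc P" and C: "is_cover V sc P b f"
  shows "graded_mod V vmod (kerp V b f)"
    and "kexact V (\<lambda>v. sc (vr v)) P Z0 (Suc n) t \<Longrightarrow> kexact V (\<lambda>v. vmod (vr v)) (kerp V b f) Z0 n (t + 1)"
proof -
  interpret graded_mod V sc P by fact
  interpret g: graded_surjection vact "\<lambda>v. sc (vr v)" V "fpiece V b" P f
    by (rule graded_mod_cover_surjection) fact+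
  note c = coverD[OF C]
  have k: "g.ker = kerp V b f" by (simp add: fun_eq_iff g.ker_def kerp_def)
  have F: "graded_mod V vmod (fpiece V b)" by (rule graded_mod_free[OF c(1)])
  show "graded_mod V vmod (kerp V b f)"
  proof (rule graded_mod_submodule[OF F])
    show "graded_sub V (\<lambda>v. vmod (vr v)) (kerp V b f)" unfolding vmod_vr using g.ker_graded_sub by (simp add: k)
    show "vmod (const r) x \<in> kerp V b f t" if "x \<in> kerp V b f t" for x t r
      using that graded_mod.const_mem[OF F, of x t r] by (simp add: kerp_def c(3))
  qed (auto simp: kerp_def)
  assume E: "exact (Suc n) t"
  show "kexact V (\<lambda>v. vmod (vr v)) (kerp V b f) Z0 n (t + 1)"
    unfolding vmod_vr k[symmetric]
  proof (rule g.kexact_ker[OF _ E])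
    fix c' assume c': "c' \<in> chains V (g.ker (t + 1)) n" and kc: "\<And>C. kdiff V vact c' C = 0"
    have "c' A \<in> g.ker (t + 1)" for A by (rule chains_mem[OF c' graded_subD(1)[OF g.ker_graded_sub]])
    then have "c' A \<in> fpiece V b (t + 1)" "f (c' A) = 0" for A by (simp_all add: g.ker_def)
    then have "lk (c' A l) 0 = 0" for A l by (rule c(5))
    then show "\<exists>e\<in>chains V (fpiece V b t) (Suc n). \<forall>C. c' C = kdiff V vact e C"
      using free_boundary[OF chains_mono[OF c' g.ker_subset] kc] by simp
  qed
qed

section \<open>Exactness on totals from exactness on pieces\<close>

definition tot :: "(int \<Rightarrow> 'm::comm_monoid_add set) \<Rightarrow> 'm set" where
  "tot P = {sum x T | x T. finite T \<and> (\<forall>t\<in>T. x t \<in> P t)}"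

lemma total_eq: "total M = tot (piece M)"
  by (simp add: total_def tot_def)

lemma totI: "x \<in> P t \<Longrightarrow> x \<in> tot P"
  unfolding tot_def by (auto intro!: exI[of _ "\<lambda>_. x"] exI[of _ "{t}"])

lemma sum_additive:
  fixes f :: "'f::comm_monoid_add \<Rightarrow> 'm::comm_monoid_add"
  assumes "\<And>x y. f (x + y) = f x + f y" "f 0 = 0"
  shows "f (sum g S) = (\<Sum>i\<in>S. f (g i))"
  using assms by (induction S rule: infinite_finite_induct) auto

lemma tot_image:
  fixes f :: "'f::comm_monoid_add \<Rightarrow> 'm::comm_monoid_add"
  assumes add: "\<And>x y. f (x + y) = f x + f y" "f 0 = 0" and surj: "\<And>t. f ` F t = P t"
  shows "f ` tot F = tot P"
proof (intro set_eqI iffI)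
  fix z assume "z \<in> f ` tot F"
  then obtain x T where "finite T" "\<forall>t\<in>T. x t \<in> F t" "z = f (sum x T)" unfolding tot_def by blast
  then show "z \<in> tot P" unfolding tot_def sum_additive[of f, OF add] using surj
    by (intro CollectI exI[of _ "\<lambda>t. f (x t)"] exI[of _ T]) auto
next
  fix z assume "z \<in> tot P"
  then obtain x T where x: "finite T" "\<forall>t\<in>T. x t \<in> P t" "z = sum x T" unfolding tot_def by blast
  then have "\<forall>t\<in>T. \<exists>y. y \<in> F t \<and> x t = f y" using surj by blast
  then obtain y where y: "\<And>t. t \<in> T \<Longrightarrow> y t \<in> F t" "\<And>t. t \<in> T \<Longrightarrow> x t = f (y t)" by metis
  have "z = f (sum y T)" unfolding sum_additive[of f, OF add] x(3) by (rule sum.cong) (auto simp: y)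
  moreover have "sum y T \<in> tot F" unfolding tot_def using x(1) y(1) by blast
  ultimately show "z \<in> f ` tot F" by blast
qed

text \<open>The images of the components lie in different pieces of the target, so by independence
  each of them vanishes as soon as their sum does.\<close>

lemma tot_kernel:
  fixes f :: "'f::comm_monoid_add \<Rightarrow> 'm::comm_monoid_add"
  assumes add: "\<And>x y. f (x + y) = f x + f y" "f 0 = 0" and sub: "\<And>t. f ` F t \<subseteq> P t" and ind: "indep_pieces P"
  shows "{v \<in> tot F. f v = 0} = tot (\<lambda>t. {w \<in> F t. f w = 0})"
proof (intro set_eqI iffI)
  fix z assume "z \<in> {v \<in> tot F. f v = 0}"
  then obtain x T where x: "finite T" "\<forall>t\<in>T. x t \<in> F t" "z = sum x T" and z: "f z = 0" unfolding tot_def by blast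
  have "(\<Sum>t\<in>T. f (x t)) = 0" using z sum_additive[of f x T, OF add] x(3) by simp
  moreover have "f (x t) \<in> P t" if "t \<in> T" for t using x(2) sub that by blast
  ultimately have "f (x t) = 0" if "t \<in> T" for t using indep_piecesD[OF ind x(1), of "\<lambda>t. f (x t)"] that by blast
  then show "z \<in> tot (\<lambda>t. {w \<in> F t. f w = 0})" unfolding tot_def using x by auto
next
  fix z assume "z \<in> tot (\<lambda>t. {w \<in> F t. f w = 0})"
  then obtain x T where x: "finite T" "\<forall>t\<in>T. x t \<in> F t \<and> f (x t) = 0" "z = sum x T" unfolding tot_def by blast
  then have "f z = 0" by (simp add: sum_additive[of f, OF add])
  then show "z \<in> {v \<in> tot F. f v = 0}" unfolding tot_def using x by auto
qed

lemma irrelevant_ideal_sum: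
  assumes "\<And>i. i \<in> S \<Longrightarrow> f i \<in> irrelevant_ideal V"
  shows "sum f S \<in> irrelevant_ideal V"
  using assms
proof (induction S rule: infinite_finite_induct)
  case (insert i S)
  then have "f i \<in> irrelevant_ideal V" "sum f S \<in> irrelevant_ideal V" by auto
  then show ?case using insert(1,2) Poly_Mapping.keys_add[of "f i" "sum f S"]
    by (auto simp: irrelevant_ideal_def polys_def lookup_add)
qed (auto simp: irrelevant_ideal_def polys_def)

text \<open>The first cover is an argument because \<open>N_p\<close> prescribes \<open>b 0\<close>;
  all later covers are chosen.\<close>

lemma resolution_from_cover:
  fixes sc :: "('v::linorder, 'k::field) mpoly \<Rightarrow> 'm::ab_group_add \<Rightarrow> 'm"
  assumes M: "graded_mod V sc P" and C0: "is_cover V sc P b0 f0"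
    and finE: "\<And>n. finite {t. \<not> kexact V (\<lambda>v. sc (vr v)) P Z0 n t}"
  obtains b where "is_graded_betti_table V \<lparr>piece = P, act = sc\<rparr> b" "b 0 = b0"
    "\<And>i j. b (Suc i) j \<noteq> 0 \<Longrightarrow> \<not> kexact V (\<lambda>v. sc (vr v)) P Z0 (Suc i) (j - int (Suc i))"
proof -
  interpret graded_mod V sc P by fact
  \<comment> \<open>\<open>Q\<close> plays the part of the \<open>i\<close>-th syzygy module:
    exactness passes to it from the original module with \<open>n\<close> lowered by
    \<open>i\<close> and the total degree unchanged.\<close>
  define inv where "inv i Q \<longleftrightarrow> graded_mod V (vmod :: ('v, 'k) mpoly \<Rightarrow> _) Q \<and>
     (\<forall>n t. exact (i + n) (t - int i) \<longrightarrow> kexact V (\<lambda>v. vmod (vr v)) Q Z0 n t)" for i Q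
  define good where "good i b f Q \<longleftrightarrow> inv (Suc i) Q \<and> is_cover V vmod Q b f \<and>
     (\<forall>j. b j \<noteq> 0 \<longrightarrow> \<not> exact (Suc i) (j - int (Suc i)))" for i b f Q
  have cover: "\<exists>b f. good i b f Q" if inv: "inv (Suc i) Q" for i Q
  proof -
    interpret Q: graded_mod V "vmod :: ('v, 'k) mpoly \<Rightarrow> _" Q using inv by (simp add: inv_def)
    have sub: "{t. \<not> Q.exact 0 t} \<subseteq> (\<lambda>t. t + int (Suc i)) ` {t. \<not> exact (Suc i) t}"
    proof
      fix t assume "t \<in> {t. \<not> Q.exact 0 t}"
      then have "\<not> exact (Suc i) (t - int (Suc i))" using inv unfolding inv_def by (metis (no_types, lifting) add_0_right mem_Collect_eq)
      then show "t \<in> (\<lambda>t. t + int (Suc i)) ` {t. \<not> exact (Suc i) t}" by (intro image_eqI[of _ _ "t - int (Suc i)"]) auto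
    qed
    then have "finite {t. \<not> Q.exact 0 t}" by (rule finite_subset) (use finE in blast)
    then obtain b f where bf: "is_cover V vmod Q b f" "\<And>j. b j \<noteq> 0 \<Longrightarrow> \<not> Q.exact 0 j" using Q.exists_cover by blast
    have "\<not> exact (Suc i) (j - int (Suc i))" if "b j \<noteq> 0" for j
      using bf(2)[OF that] inv unfolding inv_def by (metis (no_types, lifting) add_0_right)
    then show ?thesis using bf(1) inv unfolding good_def by blast
  qed
  have kernel: "inv (Suc (Suc i)) (kerp V b f)" if g: "good i b f Q" for i b f Q
  proof -
    have Q: "graded_mod V vmod Q" "is_cover V vmod Q b f" and
      ex: "\<And>n t. exact (Suc i + n) (t - int (Suc i)) \<Longrightarrow> kexact V (\<lambda>v. vmod (vr v)) Q Z0 n t"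
      using g unfolding good_def inv_def by blast+
    have "kexact V (\<lambda>v. vmod (vr v)) (kerp V b f) Z0 n t" if "exact (Suc (Suc i) + n) (t - int (Suc (Suc i)))" for n t
    proof -
      have "kexact V (\<lambda>v. vmod (vr v)) Q Z0 (Suc n) (t - 1)"
        by (rule ex) (use that in \<open>simp add: algebra_simps\<close>)
      then show ?thesis using cover_kernel(2)[OF Q, of n "t - 1"] by simp
    qed
    then show ?thesis unfolding inv_def using cover_kernel(1)[OF Q] by blast
  qed
  have inv0: "inv (Suc 0) (kerp V b0 f0)"
  proof -
    have "kexact V (\<lambda>v. vmod (vr v)) (kerp V b0 f0) Z0 n t" if "exact (Suc 0 + n) (t - int (Suc 0))" for n t
      using cover_kernel(2)[OF M C0, of n "t - 1"] that by simp
    then show ?thesis unfolding inv_def using cover_kernel(1)[OF M C0] by blast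
  qed
  \<comment> \<open>A state holds a table, a cover and the module covered. The next module is the
    kernel of the cover just chosen, so the choices depend on one another.\<close>
  have "\<exists>s. \<forall>i. (case s i of (b, f, Q) \<Rightarrow> good i b f Q \<and> (i = 0 \<longrightarrow> Q = kerp V b0 f0)) \<and>
      (case s i of (b, f, Q) \<Rightarrow> case s (Suc i) of (b', f', Q') \<Rightarrow> Q' = kerp V b f)"
  proof (rule dependent_nat_choice)
    obtain b f where "good 0 b f (kerp V b0 f0)" using cover[OF inv0] by blast
    then show "\<exists>x. case x of (b, f, Q) \<Rightarrow> good 0 b f Q \<and> (0 = 0 \<longrightarrow> Q = kerp V b0 f0)" by auto
  next
    fix x and i :: nat
    assume x: "case x of (b, f, Q) \<Rightarrow> good i b f Q \<and> (i = 0 \<longrightarrow> Q = kerp V b0 f0)"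
    obtain b f Q where bf: "x = (b, f, Q)" by (cases x)
    have gx: "good i b f Q" using x bf by auto
    obtain b' f' where "good (Suc i) b' f' (kerp V b f)" using cover[OF kernel[OF gx]] by blast
    then show "\<exists>y. (case y of (b, f, Q) \<Rightarrow> good (Suc i) b f Q \<and> (Suc i = 0 \<longrightarrow> Q = kerp V b0 f0)) \<and>
       (case x of (b, f, Q) \<Rightarrow> case y of (b', f', Q') \<Rightarrow> Q' = kerp V b f)" by (auto simp: bf)
  qed
  then obtain s where s0: "\<forall>i. (case s i of (b, f, Q) \<Rightarrow> good i b f Q \<and> (i = 0 \<longrightarrow> Q = kerp V b0 f0)) \<and>
      (case s i of (b, f, Q) \<Rightarrow> case s (Suc i) of (b', f', Q') \<Rightarrow> Q' = kerp V b f)" by (rule exE)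
  define \<beta> where "\<beta> i = fst (s i)" for i
  define \<delta> where "\<delta> i = fst (snd (s i))" for i
  define Q where "Q i = snd (snd (s i))" for i
  have seq: "s i = (\<beta> i, \<delta> i, Q i)" for i by (simp add: \<beta>_def \<delta>_def Q_def)
  have good: "good i (\<beta> i) (\<delta> i) (Q i)" and Q0: "Q 0 = kerp V b0 f0" and QS: "Q (Suc i) = kerp V (\<beta> i) (\<delta> i)" for i
    using s0[rule_format, of i] s0[rule_format, of 0] by (simp_all add: seq)
  define b where "b i = (case i of 0 \<Rightarrow> b0 | Suc i \<Rightarrow> \<beta> i)" for i
  have b_simps: "b 0 = b0" "b (Suc i) = \<beta> i" "b 1 = \<beta> 0" for i by (simp_all add: b_def)
  have cov: "is_cover V vmod (Q i) (\<beta> i) (\<delta> i)" for i using good unfolding good_def by blast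
  note c = coverD[OF cov] and c0 = coverD[OF C0]
  have Qsub: "Q i t \<subseteq> fpiece V (b i) t" for i t by (cases i) (auto simp: Q0 QS b_simps kerp_def)
  have nonexact: "\<not> exact (Suc i) (j - int (Suc i))" if "b (Suc i) j \<noteq> 0" for i j
    using good that unfolding good_def b_simps by blast
  have fin: "finite {(i, j). b i j \<noteq> 0}"
  proof (rule finite_subset)
    show "{(i, j). b i j \<noteq> 0} \<subseteq> (SIGMA i:{..card V}. {j. b i j \<noteq> 0})"
    proof
      fix p assume "p \<in> {(i, j). b i j \<noteq> 0}"
      then obtain i j where p: "p = (i, j)" and nz: "b i j \<noteq> 0" by blast
      \<comment> \<open>Above \<open>card V\<close> the exterior powers are zero, so the Koszul
        complex is exact and the resolution stops.\<close>
      have "i \<in> {..card V}"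
      proof (rule ccontr)
        assume "i \<notin> {..card V}"
        then obtain i' where i: "i = Suc i'" "card V < Suc i'" by (cases i) auto
        have "exact (Suc i') (j - int (Suc i'))"
          by (rule kexact_large[OF commuting finV i(2)]) (use graded_subD(1)[OF sub] in auto)
        then show False using nonexact nz i by blast
      qed
      then show "p \<in> (SIGMA i:{..card V}. {j. b i j \<noteq> 0})" using p nz by simp
    qed
    have "finite {j. b i j \<noteq> 0}" for i using c0(1) c(1) by (cases i) (simp_all add: b_simps)
    then show "finite (SIGMA i:{..card V}. {j. b i j \<noteq> 0})" by simp
  qed
  let ?M = "\<lparr>piece = P, act = sc\<rparr>"
  have tot\<delta>: "\<delta> i ` tot (fpiece V (\<beta> i)) = tot (Q i)" for i
    by (rule tot_image[OF c(2) c(6) c(4)])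
  have "minimal_graded_free_resolution V ?M b \<delta> f0"
    unfolding minimal_graded_free_resolution_def total_eq b_simps
  proof (intro conjI allI ballI)
    show "finite {(i, j). b i j \<noteq> 0}" by (rule fin)
    show "graded_hom (polys V) (free_module V b0) ?M f0"
      unfolding graded_hom_def act_free_module using c0 by auto
    show "graded_hom (polys V) (free_module V (\<beta> i)) (free_module V (b i)) (\<delta> i)" for i
      unfolding graded_hom_def act_free_module using c(2,3,4)[of i] Qsub[of i] by auto
    show "f0 ` tot (fpiece V b0) = tot (piece ?M)"
      using tot_image[OF c0(2) c0(6) c0(4)] by simp
    show "\<delta> 0 ` tot (fpiece V (\<beta> 0)) = {v \<in> tot (fpiece V b0). f0 v = 0}"
      unfolding tot\<delta> Q0 kerp_def[abs_def]
      using tot_kernel[of f0 "fpiece V b0" P] c0(2,4,6) indep by blast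
    show "\<delta> (Suc i) ` tot (fpiece V (\<beta> (Suc i))) = {v \<in> tot (fpiece V (\<beta> i)). \<delta> i v = 0}" for i
      unfolding tot\<delta> QS kerp_def[abs_def]
      using tot_kernel[of "\<delta> i" "fpiece V (\<beta> i)" "fpiece V (b i)"] c(2,4,6)[of i] Qsub[of i] indep_pieces_fpiece by blast
    fix i l and v :: "('v, 'k) vec" assume v: "v \<in> tot (fpiece V (\<beta> i))"
    obtain x T where x: "finite T" "\<forall>t\<in>T. x t \<in> fpiece V (\<beta> i) t" "v = sum x T" using v unfolding tot_def by blast
    have "\<delta> i v l = (\<Sum>t\<in>T. \<delta> i (x t) l)" unfolding x(3) sum_additive[of "\<delta> i", OF c(2) c(6)] sum_fun_apply ..
    also have "\<dots> \<in> irrelevant_ideal V"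
    proof (rule irrelevant_ideal_sum)
      fix t assume t: "t \<in> T"
      then have m: "\<delta> i (x t) \<in> Q i t" using x(2) c(4)[of i t] by blast
      \<comment> \<open>The image lies in the kernel of the preceding cover, whose minimality
        excludes constant terms.\<close>
      have "lk (\<delta> i (x t) l) 0 = 0"
      proof (cases i)
        case 0
        then show ?thesis using m c0(5) by (cases l) (auto simp: Q0 kerp_def)
      next
        case (Suc i')
        have "\<delta> i (x t) \<in> fpiece V (\<beta> i') t" "\<delta> i' (\<delta> i (x t)) = 0" using m by (simp_all add: Suc QS kerp_def)
        then show ?thesis by (rule c(5))
      qed
      moreover have "\<delta> i (x t) l \<in> polys V"
      proof -
        obtain j k where l: "l = (j, k)" by (cases l)
        have "\<delta> i (x t) \<in> fpiece V (b i) t" using m Qsub by blast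
        then show ?thesis unfolding l by (cases "k < b i j") (auto simp: fpiece_def forms_def polys_def)
      qed
      ultimately show "\<delta> i (x t) l \<in> irrelevant_ideal V" by (simp add: irrelevant_ideal_def)
    qed
    finally show "\<delta> i v l \<in> irrelevant_ideal V" .
  qed
  then have "is_graded_betti_table V ?M b" unfolding is_graded_betti_table_def by blast
  then show ?thesis using that b_simps(1) nonexact by blast
qed

section \<open>Resolutions determine Koszul homology\<close>

text \<open>A preimage in \<open>total F\<close> may mix degrees. By independence of the pieces of
  \<open>M\<close>, its component of degree \<open>t\<close> alone maps to \<open>z\<close>.\<close>

lemma piece_preimage:
  assumes hom: "graded_hom S F M f" and F0: "\<And>t. 0 \<in> piece F t" and sub: "graded_sub V a (piece M)" and ind: "indep_pieces (piece M)"
    and Fadd: "\<And>x y t. x \<in> total F \<Longrightarrow> y \<in> total F \<Longrightarrow> x + y \<in> total F"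
    and z: "z \<in> piece M t" "z \<in> f ` total F"
  shows "z \<in> f ` piece F t"
proof -
  have add: "f (x + y) = f x + f y" if "x \<in> total F" "y \<in> total F" for x y
    using hom that unfolding graded_hom_def by blast
  have mem: "f x \<in> piece M t" if "x \<in> piece F t" for x t
    using hom that unfolding graded_hom_def by blast
  have pt: "x \<in> total F" if "x \<in> piece F t" for x t using that by (simp add: total_eq totI)
  have f0: "f 0 = 0" using add[OF pt[OF F0] pt[OF F0]] by (metis add_0 add_cancel_right_right)
  obtain x T where x: "finite T" "\<forall>t\<in>T. x t \<in> piece F t" "z = f (sum x T)"
    using z(2) unfolding total_def by blast
  have "sum x T' \<in> total F \<and> f (sum x T') = (\<Sum>t\<in>T'. f (x t))" if "finite T'" "T' \<subseteq> T" for T'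
    using that
  proof (induction T' rule: finite_induct)
    case empty
    then show ?case using f0 pt[OF F0] by simp
  next
    case (insert i T')
    then have "x i \<in> total F" using x(2) pt by blast
    then show ?case using insert add Fadd by auto
  qed
  then have "(\<Sum>t\<in>T. f (x t)) = z" using x by auto
  then have "z = (if t \<in> T then f (x t) else 0)"
    by (intro indep_pieces_component[OF ind sub x(1) _ _ z(1)]) (use x(2) mem in auto)
  then show ?thesis using x(2) F0 f0 by (metis imageI)
qed

context polynomial_ring
begin

text \<open>Without a basis element in degree \<open>j\<close>, vectors of degree \<open>j\<close>
  have no constant terms and decompose over the variables; so do their images.\<close>

lemma cover_generated:
  assumes f: "graded_surjection vact aM V (fpiece V b) PM (f :: ('v, 'k::comm_ring_1) vec \<Rightarrow> _)" and b: "b j = 0"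
  shows "kexact V aM PM Z0 0 j"
proof -
  interpret graded_surjection vact aM V "fpiece V b" PM f by fact
  have "kexact V vact (fpiece V b :: int \<Rightarrow> ('v, 'k) vec set) Z0 0 j"
    unfolding kexact_def
  proof (intro ballI impI)
    fix c :: "'v set \<Rightarrow> ('v, 'k) vec"
    assume c: "c \<in> chains V (fpiece V b j) 0" and k: "\<forall>C. kdiff V vact c C \<in> {0}"
    have "lk (c A l) 0 = 0" for A l
    proof -
      obtain i k where l: "l = (i, k)" by (cases l)
      have cA: "c A \<in> fpiece V b j" by (rule chains_mem[OF c graded_subD(1)[OF fpiece_graded_sub]])
      show ?thesis
      proof (cases "k < b i")
        case True
        then have "c A (i, k) \<in> forms V (j - i)" "i \<noteq> j" using cA b by (auto simp: fpiece_def)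
        then show ?thesis unfolding l forms_iff by force
      qed (use cA in \<open>simp add: fpiece_def l\<close>)
    qed
    then show "\<exists>e\<in>chains V (fpiece V b (j - 1)) (Suc 0). \<forall>C. c C - kdiff V vact e C \<in> {0}"
      using free_boundary[OF c] k by auto
  qed
  then have F: "\<forall>x\<in>(fpiece V b j :: ('v, 'k) vec set). \<exists>y. (\<forall>v\<in>V. y v \<in> fpiece V b (j - 1)) \<and> x = (\<Sum>v\<in>V. vact v (y v))"
    unfolding kexact_0_iff[OF commuting_vact fpiece_graded_sub] .
  have "\<exists>y. (\<forall>v\<in>V. y v \<in> PM (j - 1)) \<and> z = (\<Sum>v\<in>V. aM v (y v))" if z: "z \<in> PM j" for z
  proof -
    obtain x where x: "x \<in> fpiece V b j" "z = f x" using z f_surj[of j] by blast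
    obtain y where y0: "\<forall>v\<in>V. y v \<in> fpiece V b (j - 1)" "x = (\<Sum>v\<in>V. vact v (y v))"
      using bspec[OF F x(1)] by blast
    then have y: "\<And>v. v \<in> V \<Longrightarrow> y v \<in> fpiece V b (j - 1)" "x = (\<Sum>v\<in>V. vact v (y v))" by blast+
    have "vact v (y v) \<in> fpiece V b j" if "v \<in> V" for v
      using graded_subD(5)[OF fpiece_graded_sub that y(1)[OF that]] by simp
    then have "z = (\<Sum>v\<in>V. f (vact v (y v)))" unfolding x(2) y(2) by (rule f_sum)
    also have "\<dots> = (\<Sum>v\<in>V. aM v (f (y v)))" by (rule sum.cong) (use f_act y(1) in auto)
    finally show ?thesis using f_surj y(1) by (intro exI[of _ "\<lambda>v. f (y v)"]) auto
  qed
  then show ?thesis unfolding kexact_0_iff[OF M.commuting_action_axioms PM] by blast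
qed

end

text \<open>The homology is shifted along the syzygies down to \<open>n = 0\<close>, where a
  vanishing Betti number means that no generators are needed. The index \<open>t + 1 + int n\<close>
  is the total degree.\<close>

lemma exact_of_betti_zero:
  fixes sc :: "('v::linorder, 'k::field) mpoly \<Rightarrow> 'm::ab_group_add \<Rightarrow> 'm"
  assumes M: "graded_mod V sc P" and res: "minimal_graded_free_resolution V \<lparr>piece = P, act = sc\<rparr> b \<delta> \<epsilon>"
    and b0: "b (Suc n) (t + 1 + int n) = 0"
  shows "kexact V (\<lambda>v. sc (vr v)) P Z0 (Suc n) t"
proof -
  interpret graded_mod V sc P by fact
  let ?M = "\<lparr>piece = P, act = sc\<rparr>" and ?F = "\<lambda>i. free_module V (b i) :: (('v, 'k) mpoly, ('v, 'k) vec) graded_module"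
  note r = res[unfolded minimal_graded_free_resolution_def]
  have hom0: "graded_hom (polys V) (?F 0) ?M \<epsilon>" and hom: "\<And>i. graded_hom (polys V) (?F (Suc i)) (?F i) (\<delta> i)"
    and sur0: "\<epsilon> ` total (?F 0) = total ?M" and ex0: "\<delta> 0 ` total (?F 1) = {v \<in> total (?F 0). \<epsilon> v = 0}"
    and ex: "\<And>i. \<delta> (Suc i) ` total (?F (Suc (Suc i))) = {v \<in> total (?F (Suc i)). \<delta> i v = 0}"
    using r by simp_all
  have Fadd: "x + y \<in> total (?F i)" if xy: "x \<in> total (?F i)" "y \<in> total (?F i)" for x y i
  proof -
    obtain f S where f: "finite S" "\<forall>t\<in>S. f t \<in> fpiece V (b i) t" "x = sum f S" using xy(1) unfolding total_def by blast
    obtain g T where g: "finite T" "\<forall>t\<in>T. g t \<in> fpiece V (b i) t" "y = sum g T" using xy(2) unfolding total_def by blast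
    let ?h = "\<lambda>t. (if t \<in> S then f t else 0) + (if t \<in> T then g t else 0)"
    have "sum ?h (S \<union> T) = (\<Sum>t\<in>S \<union> T. if t \<in> S then f t else 0) + (\<Sum>t\<in>S \<union> T. if t \<in> T then g t else 0)"
      by (rule sum.distrib)
    also have "(\<Sum>t\<in>S \<union> T. if t \<in> S then f t else 0) = x"
      unfolding f(3) by (rule sum.mono_neutral_cong_right) (use f g in auto)
    also have "(\<Sum>t\<in>S \<union> T. if t \<in> T then g t else 0) = y"
      unfolding g(3) by (rule sum.mono_neutral_cong_right) (use f g in auto)
    finally have "x + y = sum ?h (S \<union> T)" by (rule sym)
    moreover have "?h t \<in> fpiece V (b i) t" for t
      using f(2) g(2) graded_subD(1)[OF fpiece_graded_sub] by (intro graded_subD(4)[OF fpiece_graded_sub]) auto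
    ultimately show ?thesis unfolding total_def using f(1) g(1) by blast
  qed
  have add: "\<delta> i (x + y) = \<delta> i x + \<delta> i y" if "x \<in> fpiece V (b (Suc i)) t" "y \<in> fpiece V (b (Suc i)) t" for i x y t
    using hom[of i] that unfolding graded_hom_def by (simp add: total_eq totI)
  have var: "vr v \<in> polys V" if "v \<in> V" for v using that by (simp add: polys_def)
  have lin: "\<delta> i (vact v x) = vact v (\<delta> i x)" if "v \<in> V" "x \<in> fpiece V (b (Suc i)) t" for i v x t
  proof -
    have "\<forall>s\<in>polys V. \<forall>x\<in>total (?F (Suc i)). \<delta> i (vmod s x) = vmod s (\<delta> i x)"
      using hom[of i] unfolding graded_hom_def act_free_module by (elim conjE)
    moreover have "x \<in> total (?F (Suc i))" unfolding total_eq using totI[of x "fpiece V (b (Suc i))" t] that(2) by blast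
    ultimately show ?thesis unfolding vact_def using var[OF that(1)] by blast
  qed
  have mem: "\<delta> i x \<in> fpiece V (b i) t" if "x \<in> fpiece V (b (Suc i)) t" for i x t
    using hom[of i] that unfolding graded_hom_def by blast
  \<comment> \<open>\<open>Q i\<close> is the kernel onto which the \<open>Suc i\<close>-th free
    module is to map.\<close>
  define Q where "Q i = (case i of 0 \<Rightarrow> kerp V (b 0) \<epsilon> | Suc i \<Rightarrow> kerp V (b (Suc i)) (\<delta> i))" for i
  have Q_simps: "Q 0 = kerp V (b 0) \<epsilon>" "Q (Suc i) = kerp V (b (Suc i)) (\<delta> i)" for i by (simp_all add: Q_def)
  have F0: "0 \<in> piece (?F i) t" for i t by (rule graded_subD(1)[OF fpiece_graded_sub])
  interpret e: graded_surjection vact "\<lambda>v. sc (vr v)" V "fpiece V (b 0)" P \<epsilon>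
  proof (intro graded_surjection.intro graded_surjection_axioms.intro)
    show "\<epsilon> (x + y) = \<epsilon> x + \<epsilon> y" if "x \<in> fpiece V (b 0) t" "y \<in> fpiece V (b 0) t" for x y t
      using hom0 that unfolding graded_hom_def by (simp add: total_eq totI)
    show "\<epsilon> (vact v x) = sc (vr v) (\<epsilon> x)" if "v \<in> V" "x \<in> fpiece V (b 0) t" for v x t
    proof -
      have "\<forall>s\<in>polys V. \<forall>x\<in>total (?F 0). \<epsilon> (vmod s x) = sc s (\<epsilon> x)"
        using hom0 unfolding graded_hom_def act_free_module by simp
      moreover have "x \<in> total (?F 0)" unfolding total_eq using totI[of x "fpiece V (b 0)" t] that(2) by blast
      ultimately show ?thesis unfolding vact_def using var[OF that(1)] by blast
    qed
    show "\<epsilon> ` fpiece V (b 0) t = P t" for t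
    proof
      show "\<epsilon> ` fpiece V (b 0) t \<subseteq> P t" using hom0 unfolding graded_hom_def by simp
      show "P t \<subseteq> \<epsilon> ` fpiece V (b 0) t"
      proof
        fix z assume z: "z \<in> P t"
        show "z \<in> \<epsilon> ` fpiece V (b 0) t"
          by (rule piece_preimage[OF hom0 F0 _ _ Fadd]) (use z sub indep sur0 in \<open>auto simp: total_eq totI\<close>)
      qed
    qed
  qed (use commuting_vact commuting finV fpiece_graded_sub sub in auto)
  have kere: "e.ker = Q 0" by (simp add: fun_eq_iff e.ker_def Q_simps kerp_def)
  have surj: "graded_surjection vact vact V (fpiece V (b (Suc i))) (Q i) (\<delta> i)" for i
  proof -
    have image: "\<delta> i ` total (?F (Suc i)) = {v \<in> total (?F i). case i of 0 \<Rightarrow> \<epsilon> v = 0 | Suc i' \<Rightarrow> \<delta> i' v = 0}" for i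
      using ex0 ex by (cases i) simp_all
    have Q_eq: "Q i t = {w \<in> fpiece V (b i) t. case i of 0 \<Rightarrow> \<epsilon> w = 0 | Suc i' \<Rightarrow> \<delta> i' w = 0}" for i t
      by (cases i) (simp_all add: Q_simps kerp_def)
    have im: "\<delta> i ` fpiece V (b (Suc i)) t = Q i t" for i t
    proof
      show "\<delta> i ` fpiece V (b (Suc i)) t \<subseteq> Q i t"
        unfolding Q_eq using mem[of _ i t] image[of i] totI[of _ "fpiece V (b (Suc i))" t] unfolding total_eq by blast
      show "Q i t \<subseteq> \<delta> i ` fpiece V (b (Suc i)) t"
      proof
        fix z assume z: "z \<in> Q i t"
        then have z1: "z \<in> fpiece V (b i) t" by (simp add: Q_eq)
        have z2: "z \<in> \<delta> i ` total (?F (Suc i))"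
          unfolding image using z totI[of z "fpiece V (b i)" t] by (simp add: Q_eq total_eq)
        show "z \<in> \<delta> i ` fpiece V (b (Suc i)) t"
          by (rule piece_preimage[OF hom[of i] F0 _ _ _ z1 z2])
            ((rule fpiece_graded_sub indep_pieces_fpiece)+, rule Fadd)
      qed
    qed
    have main: "graded_surjection vact vact V (fpiece V (b (Suc i))) (Q i) (\<delta> i)" if "graded_sub V vact (Q i)" for i
      by (intro graded_surjection.intro graded_surjection_axioms.intro)
        (use that commuting_vact finV fpiece_graded_sub add lin im in auto)
    \<comment> \<open>That \<open>Q (Suc i)\<close> is a graded submodule is known only once the
      preceding map is a graded surjection, hence the induction.\<close>
    show ?thesis
    proof (induction i)
      case 0
      show ?case by (rule main) (use e.ker_graded_sub kere in simp)
    next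
      case (Suc i)
      then interpret s: graded_surjection vact vact V "fpiece V (b (Suc i))" "Q i" "\<delta> i" .
      have "s.ker = Q (Suc i)" by (simp add: fun_eq_iff s.ker_def Q_simps kerp_def)
      then show ?case using s.ker_graded_sub by (intro main) simp
    qed
  qed
  \<comment> \<open>Each step replaces \<open>i\<close>, \<open>n\<close>, \<open>t\<close> by
    \<open>i + 1\<close>, \<open>n - 1\<close>, \<open>t + 1\<close>, so the entry of
    \<open>b\<close> in question never changes.\<close>
  have "b (Suc (i + n)) (t + int n) = 0 \<Longrightarrow> kexact V vact (Q i) Z0 n t" for i n t
  proof (induction n arbitrary: i t)
    case 0
    then show ?case by (intro cover_generated[OF surj]) simp
  next
    case (Suc n)
    interpret s: graded_surjection vact vact V "fpiece V (b (Suc i))" "Q i" "\<delta> i" by (rule surj)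
    have k: "s.ker = Q (Suc i)" by (simp add: fun_eq_iff s.ker_def Q_simps kerp_def)
    have "kexact V vact (Q (Suc i)) Z0 n (t + 1)"
      by (rule Suc.IH) (use Suc.prems in \<open>simp add: algebra_simps\<close>)
    then show ?case by (rule s.kexact_image[OF free_exact, unfolded k])
  qed
  from this[of 0 n "t + 1"] b0 have "kexact V vact (Q 0) Z0 n (t + 1)" by simp
  then show ?thesis by (rule e.kexact_image[OF free_exact, unfolded kere])
qed

section \<open>Syzygies of the Veronese surface\<close>

definition vmonomial :: "((nat \<Rightarrow>\<^sub>0 nat) \<Rightarrow>\<^sub>0 nat) \<Rightarrow> (nat, 'k::comm_ring_1) mpoly" where
  "vmonomial u = (\<Prod>m\<in>Poly_Mapping.keys u. monomial m ^ lk u m)"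

lemma vmonomial_superset:
  "finite S \<Longrightarrow> Poly_Mapping.keys u \<subseteq> S \<Longrightarrow> vmonomial u = (\<Prod>m\<in>S. monomial m ^ lk u m :: (nat, 'k::comm_ring_1) mpoly)"
  unfolding vmonomial_def by (rule prod.mono_neutral_left) (auto simp: in_keys_iff)

lemma vmonomial_add: "vmonomial (u + w) = (vmonomial u * vmonomial w :: (nat, 'k::comm_ring_1) mpoly)"
proof -
  let ?S = "Poly_Mapping.keys u \<union> Poly_Mapping.keys w"
  show ?thesis
    using vmonomial_superset[of ?S u, where 'k = 'k] vmonomial_superset[of ?S w, where 'k = 'k]
      vmonomial_superset[of ?S "u + w", where 'k = 'k]
    by (simp add: keys_add_nat lookup_add power_add prod.distrib)
qed

lemma vmonomial_0 [simp]: "vmonomial 0 = 1" by (simp add: vmonomial_def)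

lemma vmonomial_single [simp]: "vmonomial (Poly_Mapping.single m (Suc 0)) = monomial m"
  by (simp add: vmonomial_def)

lemma veronese_map_superset:
  "finite S \<Longrightarrow> Poly_Mapping.keys s \<subseteq> S \<Longrightarrow> veronese_map s = (\<Sum>u\<in>S. const (lk s u) * vmonomial u)"
  unfolding veronese_map_def vmonomial_def by (rule sum.mono_neutral_left) (auto simp: in_keys_iff)

lemma veronese_map_add: "veronese_map (s + t) = veronese_map s + veronese_map t"
proof -
  let ?S = "Poly_Mapping.keys s \<union> Poly_Mapping.keys t"
  show ?thesis
    using veronese_map_superset[of ?S s] veronese_map_superset[of ?S t] veronese_map_superset[of ?S "s + t"]
    by (simp add: Poly_Mapping.keys_add lookup_add single_add distrib_right sum.distrib)
qed

lemma veronese_map_0 [simp]: "veronese_map 0 = 0" by (simp add: veronese_map_def)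

lemma veronese_map_sum: "veronese_map (sum f S) = (\<Sum>i\<in>S. veronese_map (f i))"
  by (rule sum_additive) (simp_all add: veronese_map_add)

lemma veronese_map_single [simp]: "veronese_map (Poly_Mapping.single u c) = const c * vmonomial u"
  using veronese_map_superset[of "{u}" "Poly_Mapping.single u c"] by simp

lemma veronese_map_mult: "veronese_map (s * t) = veronese_map s * veronese_map t"
proof -
  have "s * t = (\<Sum>u\<in>Poly_Mapping.keys s. \<Sum>w\<in>Poly_Mapping.keys t. Poly_Mapping.single (u + w) (lk s u * lk t w))"
    by (subst sum_single_keys[of s, symmetric], subst sum_single_keys[of t, symmetric]) (simp add: sum_product mult_single)
  then have "veronese_map (s * t) = (\<Sum>u\<in>Poly_Mapping.keys s. \<Sum>w\<in>Poly_Mapping.keys t.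
      (const (lk s u) * vmonomial u) * (const (lk t w) * vmonomial w))"
    by (simp add: veronese_map_sum vmonomial_add mult_single[of 0 _ 0, simplified, symmetric] mult_ac)
  also have "\<dots> = veronese_map s * veronese_map t"
    by (simp add: sum_product veronese_map_superset[of "Poly_Mapping.keys s" s] veronese_map_superset[of "Poly_Mapping.keys t" t])
  finally show ?thesis .
qed

lemma veronese_map_one [simp]: "veronese_map 1 = 1"
  using veronese_map_single[of 0 1] by (simp del: veronese_map_single)

section \<open>The Veronese module and its minimal cover\<close>

context veronese
begin

abbreviation vsc :: "(nat \<Rightarrow>\<^sub>0 nat, 'k::field) mpoly \<Rightarrow> (nat, 'k) mpoly \<Rightarrow> (nat, 'k) mpoly" where
  "vsc \<equiv> \<lambda>s r. veronese_map s * r"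

lemma module_vsc: "module (vsc :: (_, 'k::field) mpoly \<Rightarrow> _)"
  by unfold_locales (simp_all add: veronese_map_add veronese_map_mult algebra_simps)

lemma vsc_vr: "(\<lambda>v. vsc (vr v) :: (nat, 'k::field) mpoly \<Rightarrow> _) = mact (\<lambda>m. m)"
  by (simp add: fun_eq_iff mact_def)

abbreviation PR :: "int \<Rightarrow> (nat, 'k::field) mpoly set" where
  "PR \<equiv> \<lambda>k. forms {0..2} (k * int d)"

lemma R_mP_eq: "(R.mP :: int \<Rightarrow> (nat, 'k::field) mpoly set) = PR"
  by (simp add: fun_eq_iff R.mP_def)

lemma veronese_module_eq: "veronese_module 2 d = \<lparr>piece = PR, act = vsc\<rparr>"
  by (simp add: veronese_module_def)

lemma graded_mod_veronese: "graded_mod V vsc (PR :: int \<Rightarrow> (nat, 'k::field) mpoly set)"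
proof (intro graded_mod.intro graded_mod_axioms.intro)
  show "polynomial_ring V" by unfold_locales (rule finite_veronese_vars)
  show "module (vsc :: (_, 'k) mpoly \<Rightarrow> _)" by (rule module_vsc)
  show "graded_sub V (\<lambda>v. vsc (vr v)) (PR :: int \<Rightarrow> (nat, 'k) mpoly set)"
    unfolding vsc_vr R_mP_eq[symmetric] by (rule R.mP_graded_sub)
  show "indep_pieces (PR :: int \<Rightarrow> (nat, 'k) mpoly set)" by (rule indep_pieces_forms) (use d2 in simp)
  show "vsc (const c) x \<in> PR t" if "x \<in> PR t" for x :: "(nat, 'k) mpoly" and t c
    using that by (auto simp: forms_iff)
  show "\<exists>lb. \<forall>t<lb. (PR t :: (nat, 'k) mpoly set) \<subseteq> {0}"
  proof (intro exI[of _ 0] allI impI subsetI)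
    fix t :: int and x :: "(nat, 'k) mpoly" assume "t < 0" "x \<in> PR t"
    then have "t * int d < 0" using d2 by (intro mult_neg_pos) auto
    have "lk x u = 0" for u
    proof (rule ccontr)
      assume "lk x u \<noteq> 0"
      then have "int (mdeg u) = t * int d" using \<open>x \<in> PR t\<close> by (simp add: forms_iff)
      then show False using \<open>t * int d < 0\<close> by linarith
    qed
    then show "x \<in> {0}" by (simp add: poly_mapping_eqI)
  qed
  fix t :: int
  let ?U = "{u::nat \<Rightarrow>\<^sub>0 nat. Poly_Mapping.keys u \<subseteq> {0..2} \<and> mdeg u = nat (t * int d)}"
  have inj: "inj_on (monomial :: _ \<Rightarrow> (nat, 'k) mpoly) ?U"
    by (rule inj_onI) (metis lookup_single_eq lookup_single_not_eq zero_neq_one)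
  have finU: "finite ?U" by (rule finite_monomials) simp
  show "\<exists>B. finite B \<and> (\<forall>x\<in>(PR t :: (nat, 'k) mpoly set). \<exists>a. x = (\<Sum>y\<in>B. vsc (const (a y)) y))"
  proof (intro exI[of _ "monomial ` ?U"] conjI ballI)
    show "finite (monomial ` ?U)" using finU by simp
    fix x :: "(nat, 'k) mpoly" assume x: "x \<in> PR t"
    define a where "a y = lk x (the_inv_into ?U monomial y)" for y :: "(nat, 'k) mpoly"
    have "x = (\<Sum>u\<in>Poly_Mapping.keys x. Poly_Mapping.single u (lk x u))" by (rule sum_single_keys[symmetric])
    also have "\<dots> = (\<Sum>u\<in>?U. Poly_Mapping.single u (lk x u))"
      by (rule sum.mono_neutral_left[OF finU]) (use x in \<open>auto simp: forms_iff in_keys_iff\<close>)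
    also have "\<dots> = (\<Sum>u\<in>?U. vsc (const (a (monomial u))) (monomial u))"
    proof (rule sum.cong[OF refl])
      fix u assume "u \<in> ?U"
      then have "a (monomial u) = lk x u" unfolding a_def by (subst the_inv_into_f_f[OF inj]) auto
      then show "Poly_Mapping.single u (lk x u) = vsc (const (a (monomial u))) (monomial u)" by (simp add: mult_single)
    qed
    also have "\<dots> = (\<Sum>y\<in>monomial ` ?U. vsc (const (a y)) y)" by (simp add: sum.reindex[OF inj])
    finally have "x = (\<Sum>y\<in>monomial ` ?U. vsc (const (a y)) y)" .
    then show "\<exists>a. x = (\<Sum>y\<in>monomial ` ?U. vsc (const (a y)) y)" by (rule exI[of _ a])
  qed
qed

abbreviation vexact :: "'k::field itself \<Rightarrow> nat \<Rightarrow> int \<Rightarrow> bool" where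
  "vexact K n t \<equiv> kexact V (\<lambda>v. vsc (vr v)) (PR :: int \<Rightarrow> (nat, 'k) mpoly set) Z0 n t"

lemma vexact_eq: "vexact TYPE('k::field) n t = kexact V (mact (\<lambda>m. m)) (R.mP :: int \<Rightarrow> (nat, 'k) mpoly set) Z0 n t"
  unfolding vsc_vr R_mP_eq ..

lemma vexact_outside: "t \<notin> {0..2} \<Longrightarrow> vexact TYPE('k::field) n t"
proof -
  assume "t \<notin> {0..2}"
  then have "t < 0 \<or> 3 \<le> t" by auto
  then have "t < 0 \<or> 3 * int d < 3 + t * int d"
  proof
    assume "3 \<le> t"
    then have "3 * int d \<le> t * int d" by (intro mult_right_mono) auto
    then show ?thesis by linarith
  qed simp
  then show ?thesis unfolding vexact_eq by (rule R_exact_outside)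
qed

text \<open>The cover by the single generator 1 is written down, which fixes \<open>b 0\<close>.
  That it is onto is projective normality, exactness at \<open>n = 0\<close> in every degree but 0.
  Degree 2 is left as an assumption because \<open>d = 2\<close> and \<open>d \<ge> 3\<close> reach
  it by different arguments.\<close>

lemma resolution_of_veronese:
  assumes E2: "vexact TYPE('k::field) 0 2"
  obtains b where "is_graded_betti_table V (veronese_module 2 d :: (_, (nat, 'k) mpoly) graded_module) b"
    "b 0 = (\<lambda>j. if j = 0 then 1 else 0)"
    "\<And>i j. b (Suc i) j \<noteq> 0 \<Longrightarrow> \<not> vexact TYPE('k) (Suc i) (j - int (Suc i))"
proof -
  interpret graded_mod V vsc "PR :: int \<Rightarrow> (nat, 'k) mpoly set" by (rule graded_mod_veronese)
  let ?b = "\<lambda>j::int. if j = 0 then 1 else 0 :: nat"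
  have E0: "vexact TYPE('k) 0 j" if j: "j \<noteq> 0" for j
  proof -
    consider "j = 1" | "j = 2" | "j \<notin> {0..2}" using j by force
    then show ?thesis
    proof cases
      case 1
      then show ?thesis unfolding vexact_eq by (simp add: R_exact_generators)
    next
      case 2
      then show ?thesis using E2 by simp
    qed (rule vexact_outside)
  qed
  have cover: "is_cover V vsc PR ?b (\<lambda>w. \<Sum>l\<in>(SIGMA j:{j. ?b j \<noteq> 0}. {..<?b j}). vsc (w l) (1 :: (nat, 'k) mpoly))"
  proof (rule cover_of_generators)
    show "finite {j. ?b j \<noteq> 0}" by simp
    show "(1 :: (nat, 'k) mpoly) \<in> PR j" if "k < ?b j" for j k
      using that by (auto simp: forms_iff lookup_one when_def split: if_splits)
    show "\<exists>a. x - (\<Sum>k<?b j. vsc (const (a k)) 1) \<in> decomposable j" if x: "x \<in> PR j" for j and x :: "(nat, 'k) mpoly"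
    proof (cases "j = 0")
      case True
      have "x = const (lk x 0)"
        by (rule poly_mapping_eqI) (use x True in \<open>auto simp: forms_iff mdeg_eq_0_iff lookup_single when_def\<close>)
      then have "x - (\<Sum>k<?b j. vsc (const (lk x 0)) 1) = 0" using True by simp
      then have "x - (\<Sum>k<?b j. vsc (const (lk x 0)) 1) \<in> decomposable j" by (simp only: decomposable_0)
      then show ?thesis by (rule exI[of _ "\<lambda>_. lk x 0"])
    next
      case False
      then have "x \<in> decomposable j" using E0[OF False] x unfolding kex_0_iff by blast
      then show ?thesis using False by simp
    qed
    show "a k = 0" if s: "(\<Sum>k<?b j. vsc (const (a k)) 1) \<in> decomposable j" and k: "k < ?b j" for j a k
    proof -
      have j: "j = 0" "k = 0" using k by (auto split: if_splits)
      have "const (a 0) \<in> decomposable 0" using s by (simp add: j)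
      then obtain y :: "_ \<Rightarrow> (nat, 'k) mpoly" where y: "\<forall>v\<in>V. y v \<in> PR (- 1)" "const (a 0) = (\<Sum>v\<in>V. vsc (vr v) (y v))" unfolding decomposable_def by auto
      have "y v = 0" if "v \<in> V" for v
      proof (rule poly_mapping_eqI)
        fix u show "lk (y v) u = lk 0 u" using y(1) that d2 by (force simp: forms_iff)
      qed
      then have "(\<Sum>v\<in>V. vsc (vr v) (y v)) = 0" by (simp add: sum.neutral)
      then have "lk (const (a 0) :: (nat, 'k) mpoly) 0 = 0" using y(2) by simp
      then show ?thesis by (simp add: j)
    qed
  qed
  have fin: "finite {t. \<not> vexact TYPE('k) n t}" for n
  proof (rule finite_subset)
    show "{t. \<not> vexact TYPE('k) n t} \<subseteq> {0..2}"
    proof (rule subsetI, rule ccontr)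
      fix t assume t: "t \<in> {t. \<not> vexact TYPE('k) n t}" "t \<notin> {0..2}"
      have "vexact TYPE('k) n t" by (rule vexact_outside[OF t(2)])
      then show False using t(1) by simp
    qed
  qed simp
  show ?thesis
    unfolding veronese_module_eq
    by (rule resolution_from_cover[OF graded_mod_veronese cover fin]) (rule that[unfolded veronese_module_eq])
qed

end

theorem theorem3p1:
  shows "(\<forall>d p. d \<ge> 3 \<longrightarrow>
            (veronese_satisfies_N TYPE('k::{alg_closed_field, field_char_0}) 2 d p
              \<longleftrightarrow> 0 \<le> p \<and> p \<le> 3 * d - 3)) \<and>
         (\<forall>p. veronese_satisfies_N TYPE('k) 2 2 p)"
proof (intro conjI allI impI)
  fix p
  interpret veronese 2 by unfold_locales simp
  \<comment> \<open>For \<open>d = 2\<close> the quotient by the squares is zero in degree 2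
    already: \<open>3 * 2 < 3 + 2 * 2\<close>.\<close>
  have E2: "vexact TYPE('k) n 2" for n unfolding vexact_eq by (rule R_exact_outside) simp
  have E0: "vexact TYPE('k) n 0" if "1 \<le> n" for n unfolding vexact_eq by (rule R_exact_degree_0[OF that])
  obtain b where b: "is_graded_betti_table V (veronese_module 2 2 :: (_, (nat, 'k) mpoly) graded_module) b"
    "b 0 = (\<lambda>j. if j = 0 then 1 else 0)"
    "\<And>i j. b (Suc i) j \<noteq> 0 \<Longrightarrow> \<not> vexact TYPE('k) (Suc i) (j - int (Suc i))"
    using resolution_of_veronese[OF E2] by blast
  have "b i j = 0" if "1 \<le> i" "j \<noteq> int i + 1" for i j
  proof (rule ccontr)
    assume "b i j \<noteq> 0"
    then have "\<not> vexact TYPE('k) i (j - int i)" using b(3)[of "i - 1" j] that(1) by simp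
    \<comment> \<open>The difference is the coefficient degree; only 1 remains, which is the linear
      strand \<open>j = int i + 1\<close>.\<close>
    then have "j - int i \<in> {0..2}" "j - int i \<noteq> 0" "j - int i \<noteq> 2" using vexact_outside E0[OF that(1)] E2 by metis+
    then show False using that(2) by auto
  qed
  then show "veronese_satisfies_N TYPE('k) 2 2 p"
    unfolding veronese_satisfies_N_def using b(1,2) by (intro exI[of _ b]) auto
next
  fix d p :: nat
  assume d: "3 \<le> d"
  interpret veronese3 d by unfold_locales (use d in auto)
  have E0: "vexact TYPE('k) n 0" if "1 \<le> n" for n unfolding vexact_eq by (rule R_exact_degree_0[OF that])
  have E2: "vexact TYPE('k) n 2" if "n \<le> 3 * d - 3" for n unfolding vexact_eq by (rule R_exact_2[OF that])
  show "veronese_satisfies_N TYPE('k) 2 d p \<longleftrightarrow> 0 \<le> p \<and> p \<le> 3 * d - 3"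
  proof
    assume p: "0 \<le> p \<and> p \<le> 3 * d - 3"
    obtain b where b: "is_graded_betti_table V (veronese_module 2 d :: (_, (nat, 'k) mpoly) graded_module) b"
      "b 0 = (\<lambda>j. if j = 0 then 1 else 0)"
      "\<And>i j. b (Suc i) j \<noteq> 0 \<Longrightarrow> \<not> vexact TYPE('k) (Suc i) (j - int (Suc i))"
      using resolution_of_veronese[OF E2[of 0]] by auto
    have "b i j = 0" if "1 \<le> i" "i \<le> p" "j \<noteq> int i + 1" for i j
    proof (rule ccontr)
      assume "b i j \<noteq> 0"
      then have "\<not> vexact TYPE('k) i (j - int i)" using b(3)[of "i - 1" j] that(1) by simp
      then have "j - int i \<in> {0..2}" "j - int i \<noteq> 0" "j - int i \<noteq> 2"
        using vexact_outside E0[OF that(1)] E2[of i] that(2) p by (metis, metis, metis le_trans)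
      then show False using that(3) by auto
    qed
    then show "veronese_satisfies_N TYPE('k) 2 d p"
      unfolding veronese_satisfies_N_def using b(1,2) by (intro exI[of _ b]) auto
  next
    assume N: "veronese_satisfies_N TYPE('k) 2 d p"
    have "p \<le> 3 * d - 3"
    proof (rule ccontr)
      assume p: "\<not> p \<le> 3 * d - 3"
      obtain b where b: "is_graded_betti_table V (veronese_module 2 d :: (_, (nat, 'k) mpoly) graded_module) b"
        and b0: "\<And>i j. 1 \<le> i \<Longrightarrow> i \<le> p \<Longrightarrow> j \<noteq> int i + 1 \<Longrightarrow> b i j = 0"
        using N unfolding veronese_satisfies_N_def by blast
      obtain \<delta> \<epsilon> where res: "minimal_graded_free_resolution V \<lparr>piece = (PR :: int \<Rightarrow> (nat, 'k) mpoly set), act = vsc\<rparr> b \<delta> \<epsilon>"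
        using b unfolding is_graded_betti_table_def veronese_module_eq by blast
      let ?n = "3 * d - 3"
      \<comment> \<open>Step \<open>3 * d - 2\<close> in degree \<open>3 * d\<close>, one above the
        linear strand: property \<open>N_p\<close> makes this entry vanish as soon as
        \<open>p\<close> exceeds \<open>3 * d - 3\<close>.\<close>
      have "b (Suc ?n) (2 + 1 + int ?n) = 0" by (rule b0) (use p in auto)
      then have "vexact TYPE('k) (Suc ?n) 2" by (rule exact_of_betti_zero[OF graded_mod_veronese res])
      moreover have "Suc ?n = 3 * d - 2" using d by simp
      ultimately show False using R_not_exact[where 'k = 'k] unfolding vexact_eq by simp
    qed
    then show "0 \<le> p \<and> p \<le> 3 * d - 3" by simp
  qed
qed

end
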